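(* For any $\delta\in(0,1]$, $p\in(0,1/2]$, $\varepsilon\in(0,p)$, $K,M\geq 1$ there are $n_1=n_1(\delta,\varepsilon,p,K,M)\geq 1$ and $\eta=\eta(\delta,\varepsilon,p,K,M)\in(0,1]$ depending on $\delta,\varepsilon,p,K,M$, and $L=L(\delta,\varepsilon,p,K)>0$ depending only on $\delta,\varepsilon,p,K$ (and not on $M$), with the following property. Let $n\geq n_1$, let $N$ be an integer with $1\leq N\leq (1-p+\varepsilon)^{-n}$, let $\mathcal A$ be an $(N,n,K,\delta)$-admissible set, and let $f:\mathbb{Z}\to[0,\infty)$ be a function with $\|f\|_1=\sum_{t\in\mathbb{Z}}f(t)=1$ such that $\log_2 f$ is $\eta$-Lipschitz. Then $$\mathbb{P}\big\{\|f_{\mathcal A,p,n}\|_\infty> L\,(N\sqrt{n})^{-1}\big\}\leq \exp(-Mn).$$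
   Context: A map $g:\mathbb{Z}\to\mathbb{R}$ is $L$-Lipschitz if $|g(t)-g(t+1)|\leq L$ for all $t\in\mathbb{Z}$. For integers $N,n\geq1$ and reals $\delta\in(0,1]$, $K\geq1$, a set $\mathcal A\subset\mathbb{Z}^n$ is $(N,n,K,\delta)$-admissible if: $\mathcal A=A_1\times\dots\times A_n$ with each $A_i$ an origin-symmetric subset of $\mathbb{Z}$; $A_i$ is an integer interval of cardinality at least $2N+1$ for every $i>\delta n$; for every $i\leq\delta n$, $A_i$ is a union of two integer intervals of total cardinality at least $2N$ and $A_i\cap[-N,N]=\emptyset$; $|A_1|\cdots|A_n|\leq (KN)^n$; and $\max A_i<nN$ for all $i$. Given such $\mathcal A$, $p\in(0,1)$ and $f:\mathbb{Z}\to\mathbb{R}$, let $X_1,\dots,X_n$ be independent with $X_i$ uniform on $A_i$, and for $\ell\leq n$ define the random function $$f_{\mathcal A,p,\ell}(t)=\sum_{(v_j)_{j=1}^\ell\in\{0,1\}^\ell}p^{\sum_j v_j}(1-p)^{\ell-\sum_j v_j} f(t+v_1X_1+\dots+v_\ell X_\ell),\quad t\in\mathbb{Z}.$$ The probability is with respect to $X_1,\dots,X_n$; $\|\cdot\|_\infty$ is the supremum over $\mathbb{Z}$. *)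

theory Defs
  imports "HOL-Analysis.Analysis"
begin

definition int_interval :: "int set \<Rightarrow> bool" where
  "int_interval S \<longleftrightarrow> (\<exists>a b. S = {a..b})"

definition origin_symmetric :: "int set \<Rightarrow> bool" where
  "origin_symmetric S \<longleftrightarrow> (\<forall>x. x \<in> S \<longleftrightarrow> - x \<in> S)"

definition admissible :: "nat \<Rightarrow> nat \<Rightarrow> real \<Rightarrow> real \<Rightarrow> (nat \<Rightarrow> int set) \<Rightarrow> bool" where
  "admissible N n K \<delta> A \<longleftrightarrow>
     (\<forall>i\<in>{1..n}. origin_symmetric (A i)) \<and>
     (\<forall>i\<in>{1..n}. real i > \<delta> * real n \<longrightarrow>
         int_interval (A i) \<and> card (A i) \<ge> 2 * N + 1) \<and>
     (\<forall>i\<in>{1..n}. real i \<le> \<delta> * real n \<longrightarrow>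
         (\<exists>I J. int_interval I \<and> int_interval J \<and> A i = I \<union> J) \<and>
         card (A i) \<ge> 2 * N \<and> A i \<inter> {- int N..int N} = {}) \<and>
     (\<Prod>i\<in>{1..n}. real (card (A i))) \<le> (K * real N) ^ n \<and>
     (\<forall>i\<in>{1..n}. \<forall>x\<in>A i. x < int n * int N)"

text \<open>The random function f_{A,p,l} evaluated at a realisation X of (X_1,...,X_n);
  the vector v ranges over {0,1}^l, encoded as functions on {1..l} with values in {0,1}.\<close>

definition f_Apl :: "(int \<Rightarrow> real) \<Rightarrow> real \<Rightarrow> nat \<Rightarrow> (nat \<Rightarrow> int) \<Rightarrow> int \<Rightarrow> real" where
  "f_Apl f p l X t =
     (\<Sum>v\<in>({1..l} \<rightarrow>\<^sub>E {0::nat, 1}).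
        p ^ (\<Sum>j\<in>{1..l}. v j) * (1 - p) ^ (l - (\<Sum>j\<in>{1..l}. v j)) *
        f (t + (\<Sum>j\<in>{1..l}. int (v j) * X j)))"

definition sup_norm :: "(int \<Rightarrow> real) \<Rightarrow> real" where
  "sup_norm g = (SUP t. \<bar>g t\<bar>)"

text \<open>Probability with respect to independent X_1,...,X_n, X_i uniform on the finite set A i:
  the uniform (counting) measure on the product set.\<close>

definition prob_unif :: "nat \<Rightarrow> (nat \<Rightarrow> int set) \<Rightarrow> ((nat \<Rightarrow> int) \<Rightarrow> bool) \<Rightarrow> real" where
  "prob_unif n A E =
     real (card {X \<in> PiE {1..n} A. E X})
     / real (card (PiE {1..n} A))"

end

theory Submission
  imports Defs
begin

text \<open>Write \<open>mix x g t = (1 - p) g(t) + p g(t + x)\<close>; the random function is an iterated \<open>mix\<close> of \<open>f\<close> along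
  \<open>X\<^sub>1, \<dots>, X\<^sub>n\<close>, in any order. About \<open>\<gamma>n\<close> coordinates of index at most \<open>\<delta>n\<close> come first: their steps exceed \<open>N\<close>,
  so Littlewood--Offord bounds every sum over a window of length \<open>N\<close> by some \<open>w\<close> of order \<open>1 / sqrt n\<close>, for good.

  The supremum is controlled by the energy \<open>\<Sum>\<^sub>t max(0, g(t) - T) ^ (s + 1)\<close>. By convexity its mean is multiplied in one
  step by at most \<open>(1 - p) ^ (s + 1) + p ^ (s + 1) + P(g(t + X) > T)\<close>. With \<open>T = R w / N\<close> and \<open>s\<close>, \<open>R\<close> large in terms of \<open>M\<close>, the
  bound on \<open>N\<close> makes the energy die out, whence a supremum of order \<open>R w / N\<close> outside an event of
  probability \<open>exp(-Mn)\<close>.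

  To remove the dependence on \<open>M\<close>, the last \<open>\<gamma>n\<close> steps are grouped into blocks of a large constant length \<open>m\<close> and
  \<open>T\<close> is a fixed multiple of \<open>w / N\<close>. By Hoelder's inequality a block divides the mean energy by a large constant,
  up to the probability that a whole cube \<open>t + \<Sum>u\<^sub>jX\<^sub>j\<close> lies in \<open>B = {g > T}\<close>. That probability is at most
  \<open>exp(-cm)\<close> with \<open>c\<close> as large as we like: otherwise a positive proportion of the steps would almost preserve \<open>B\<close>;
  by a covering argument boundedly many differences of such steps reach every point of \<open>[0, N]\<close> up to a bounded
  error, and as \<open>log f\<close> varies slowly, \<open>{g > T/2}\<close> would fill half of a window of length \<open>N\<close>, against the
  bound \<open>w\<close>.\<close>

section \<open>Antichains and binomial weights\<close>

text \<open>The two stages share out the cost of Markov's inequality: at a threshold of order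
  \<open>1 / N\<close>, an energy of exponent \<open>s + 1\<close> costs about
  \<open>N ^ (s + 1)\<close>. In the first stage every step gains \<open>(1 - p) ^ (s + 1)\<close>
  up to a constant, once \<open>1 / R\<close> is that small. Since \<open>N\<close> is at most
  \<open>(1 - p + \<epsilon>) ^ (- n)\<close>, gain beats cost at an exponential rate proportional
  to \<open>s\<close>, so a large \<open>s\<close> reaches any \<open>M\<close>; the price is an
  \<open>R\<close> that grows with \<open>M\<close>. At a threshold free of \<open>M\<close>, the
  density of a level set is only bounded by a constant, so a single step need not gain more than a
  constant, whatever \<open>s\<close> is. A block does better, because one vertex of its cube
  outside the level set is enough for a gain. Still, the gain of a block is a fixed rate per step
  and could not pay for \<open>N ^ (s + 1)\<close>. It does not have to: the supremum is already of
  order \<open>R w / N\<close>, hence the initial energy is of order \<open>(R w / N) ^ s\<close>,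
  and a single factor \<open>N\<close> remains however large \<open>s\<close> is.\<close>

lemma LYM_inequality:
  fixes S :: "'a set"
  assumes "finite S" "\<F> \<subseteq> Pow S" "\<And>F G. F \<in> \<F> \<Longrightarrow> G \<in> \<F> \<Longrightarrow> F \<subset> G \<Longrightarrow> False"
  shows "(\<Sum>F\<in>\<F>. 1 / real (card S choose card F)) \<le> 1"
  using assms
proof (induction "card S" arbitrary: S \<F>)
  case 0
  from 0(1,2) have "S = {}" by simp
  with 0(3) have "\<F> = {} \<or> \<F> = {{}}" by auto
  then show ?case by auto
next
  case (Suc k)
  have finF: "finite \<F>" using Suc.prems(1,2) by (meson finite_Pow_iff finite_subset)
  show ?case
  proof (cases "S \<in> \<F>")
    case True
    have "F = S" if "F \<in> \<F>" for F
      using Suc.prems(2) Suc.prems(3)[OF that True] that by blast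
    with True have "\<F> = {S}" by blast
    then show ?thesis by simp
  next
    case False
    have lt: "card F < Suc k" "finite F" "F \<subseteq> S" if "F \<in> \<F>" for F
    proof -
      have "F \<subset> S" using that Suc.prems(2) False by blast
      then show "card F < Suc k" "finite F" "F \<subseteq> S"
        using Suc.hyps(2) Suc.prems(1) psubset_card_mono[of S F] finite_subset[of F S] by auto
    qed
    \<comment> \<open>The weight of \<open>F\<close> is spread over the points \<open>i\<close>
      outside \<open>F\<close>. After the sums are exchanged, each \<open>i\<close> meets an
      antichain in \<open>S - {i}\<close>, to which the induction hypothesis applies.\<close>
    have "1 / real (card S choose card F)
        = (\<Sum>i\<in>S - F. 1 / real (k choose card F)) / real (Suc k)" if "F \<in> \<F>" for F
    proof -
      have "card (S - F) = Suc k - card F"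
        using lt[OF that] Suc.hyps(2) by (simp add: card_Diff_subset)
      moreover have "(Suc k - card F) * (Suc k choose card F) = Suc k * (k choose card F)"
        using lt(1)[OF that] binomial_absorb_comp[of "Suc k" "card F"] by simp
      then have "real (Suc k - card F) * real (Suc k choose card F) = real (Suc k) * real (k choose card F)"
        by (metis of_nat_mult)
      moreover have "real (Suc k choose card F) > 0" "real (k choose card F) > 0"
        using lt(1)[OF that] by (simp_all add: zero_less_binomial)
      ultimately show ?thesis using Suc.hyps(2) by (simp add: field_simps)
    qed
    then have "(\<Sum>F\<in>\<F>. 1 / real (card S choose card F))
        = (\<Sum>F\<in>\<F>. \<Sum>i\<in>S - F. 1 / real (k choose card F)) / real (Suc k)"
      by (simp add: sum_divide_distrib)
    also have "(\<Sum>F\<in>\<F>. \<Sum>i\<in>S - F. 1 / real (k choose card F))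
        = (\<Sum>F\<in>\<F>. \<Sum>i\<in>S. if i \<notin> F then 1 / real (k choose card F) else 0)"
      using Suc.prems(1) by (intro sum.cong refl sum.mono_neutral_cong_left) auto
    also have "\<dots> = (\<Sum>i\<in>S. \<Sum>F\<in>\<F>. if i \<notin> F then 1 / real (k choose card F) else 0)"
      by (rule sum.swap)
    also have "\<dots> = (\<Sum>i\<in>S. \<Sum>F\<in>{F\<in>\<F>. i \<notin> F}. 1 / real (k choose card F))"
      using finF by (intro sum.cong refl sum.mono_neutral_cong_right) auto
    also have "\<dots> \<le> (\<Sum>i\<in>S. 1)"
    proof (rule sum_mono)
      fix i assume i: "i \<in> S"
      have c: "k = card (S - {i})" using i Suc.hyps(2) Suc.prems(1) by simp
      have "(\<Sum>F\<in>{F\<in>\<F>. i \<notin> F}. 1 / real (card (S - {i}) choose card F)) \<le> 1"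
        by (rule Suc.hyps(1)[OF c]) (use Suc.prems in \<open>blast+\<close>)
      then show "(\<Sum>F\<in>{F\<in>\<F>. i \<notin> F}. 1 / real (k choose card F)) \<le> 1" using c by simp
    qed
    also have "\<dots> = real (Suc k)" using Suc.hyps(2) by simp
    finally show ?thesis by (simp add: divide_simps)
  qed
qed

text \<open>With variance \<open>D = k * p * (1 - p)\<close>, the weights up to about
  \<open>sqrt (D / 2)\<close> places to the right of the mode are at least half of the largest one.
  All weights sum to 1, so the largest is of order \<open>1 / sqrt D\<close>.\<close>

lemma binomial_weight_le:
  fixes p :: real
  assumes p: "0 < p" "p < 1" and k: "0 < k" and j: "j \<le> k"
  shows "real (k choose j) * p ^ j * (1 - p) ^ (k - j) \<le> 2 * sqrt 2 / sqrt (real k * p * (1 - p))"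
proof -
  define b where "b j = real (k choose j) * p ^ j * (1 - p) ^ (k - j)" for j
  define q where "q = 1 - p"
  have q: "0 < q" "q < 1" "p + q = 1" using p by (auto simp: q_def)
  have b0: "b j \<ge> 0" for j using p by (simp add: b_def)
  have ratio: "b (Suc i) * (real (Suc i) * q) = b i * (real (k - i) * p)" if "i < k" for i
  proof -
    have "Suc i * (k choose Suc i) = (k - i) * (k choose i)"
      by (metis binomial_absorb_comp binomial_absorption mult.commute)
    then have "real (Suc i) * real (k choose Suc i) = real (k - i) * real (k choose i)"
      by (metis of_nat_mult)
    moreover have "q ^ (k - i) = q * q ^ (k - Suc i)" using that by (metis Suc_diff_Suc power_Suc)
    ultimately have e: "real (Suc i) * real (k choose Suc i) = real (k - i) * real (k choose i)"
      "q ^ (k - i) = q * q ^ (k - Suc i)" by auto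
    have "b (Suc i) * (real (Suc i) * q) = (real (Suc i) * real (k choose Suc i)) * (p * p ^ i * (q * q ^ (k - Suc i)))"
      unfolding b_def q_def[symmetric] power_Suc by (simp only: mult_ac)
    also have "\<dots> = b i * (real (k - i) * p)"
      unfolding b_def q_def[symmetric] e(1) e(2)[symmetric] by (simp only: mult_ac)
    finally show ?thesis .
  qed
  have "Max (b ` {..k}) \<in> b ` {..k}" by (intro Max_in) auto
  then obtain j0 where j0': "Max (b ` {..k}) = b j0" "j0 \<in> {..k}" by (rule imageE)
  have j0: "j0 \<le> k" "\<And>j. j \<le> k \<Longrightarrow> b j \<le> b j0"
    using j0' by (auto simp flip: j0'(1))
  have tot: "(\<Sum>j\<le>k. b j) = 1"
    using binomial_ring[of p "1 - p" k] by (simp add: b_def)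
  have bpos: "b j0 > 0"
  proof -
    have "b k > 0" using p by (simp add: b_def)
    then show ?thesis using j0(2)[of k] by simp
  qed
  \<comment> \<open>A maximal weight dominates both neighbours; by the ratio of consecutive weights,
    \<open>low\<close> and \<open>up\<close> place the mode within 1 of
    \<open>k * p\<close>.\<close>
  have low: "real k * p \<le> real j0 + 1"
  proof (cases "j0 < k")
    case True
    have "b (Suc j0) * (real (Suc j0) * q) \<le> b j0 * (real (Suc j0) * q)"
      using j0(2)[of "Suc j0"] True q by (intro mult_right_mono) auto
    then have "b j0 * (real (k - j0) * p) \<le> b j0 * (real (Suc j0) * q)" by (simp only: ratio[OF True])
    then have "real (k - j0) * p \<le> real (Suc j0) * q" using bpos by simp
    then have "(real k - real j0) * p \<le> (real j0 + 1) * (1 - p)" using j0 by (simp add: q_def of_nat_diff add.commute)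
    then show ?thesis using p by (simp add: algebra_simps)
  next
    case False
    then have "j0 = k" using j0 by simp
    then show ?thesis using mult_left_le[of p "real k"] p by simp
  qed
  have up: "real j0 * q \<le> (real k - real j0 + 1) * p"
  proof (cases j0)
    case 0
    then show ?thesis using p by simp
  next
    case (Suc i)
    have "b i * (real (k - i) * p) \<le> b j0 * (real (k - i) * p)"
      using j0(2)[of i] j0(1) Suc p by (intro mult_right_mono) auto
    then have "b j0 * (real j0 * q) \<le> b j0 * (real (k - i) * p)"
      using ratio[of i] Suc j0(1) by (simp only: Suc)
    then show ?thesis using bpos Suc j0(1) by (simp add: of_nat_diff)
  qed
  define D where "D = real k * p * q"
  have D: "D > 0" using k p q by (simp add: D_def)
  have lowq: "D \<le> (real j0 + 1) * q" using low q unfolding D_def by (intro mult_right_mono) auto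
  define s where "s = nat \<lfloor>sqrt (D / 2)\<rfloor>"
  have s1: "real s \<le> sqrt (D/2)" using D by (simp add: s_def)
  have s2: "sqrt (D/2) \<le> real s + 1" using D unfolding s_def by linarith
  have ss: "real s * real s \<le> D / 2"
    using mult_mono[OF s1 s1] D by simp
  \<comment> \<open>One place to the right costs a relative loss of at most \<open>s / D\<close>;
    measured against \<open>b j0\<close> the losses only add up, to at most
    \<open>s * s / D\<close>, which is at most 1/2. The disjunction keeps the indices in the range
    where the total mass is known.\<close>
  have step: "b (j0 + i) \<ge> b j0 * (1 - real i * real s / D) \<and> (i = 0 \<or> j0 + i \<le> k)" if "i \<le> s" for i
    using that
  proof (induction i)
    case 0 then show ?case by simp
  next
    case (Suc i)
    have IH: "b (j0 + i) \<ge> b j0 * (1 - real i * real s / D)" "i = 0 \<or> j0 + i \<le> k" using Suc by auto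
    define y where "y = (real j0 + real i + 1) * q"
    have y: "y \<ge> D" using lowq q mult_right_mono[of "real j0 + 1" "real j0 + real i + 1" q] unfolding y_def by linarith
    have num: "y - (real k - real j0 - real i) * p \<le> real s"
    proof -
      have "y - (real k - real j0 - real i) * p
        = (real j0 * q - (real k - real j0 + 1) * p) + (real i + 1) * (p + q)"
        unfolding y_def by (simp add: algebra_simps)
      also have "\<dots> \<le> real i + 1" using up q by simp
      finally show ?thesis using Suc.prems by simp
    qed
    have sD: "real s < D"
    proof -
      have "real s * real s < D \<or> s = 0" using ss D by linarith
      then show ?thesis
      proof (cases "s \<le> 1")
        case True
        then have "s = 0 \<or> s = 1" by auto
        then show ?thesis using ss D by auto
      next
        case False
        then have "real s * 1 \<le> real s * real s" by (intro mult_left_mono) auto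
        then show ?thesis using ss D by linarith
      qed
    qed
    have "(real k - real j0 - real i) * p > 0" using num y sD by linarith
    then have lt: "j0 + i < k" using p by (simp add: zero_less_mult_iff)
    have r: "b (Suc (j0+i)) * y = b (j0+i) * ((real k - real j0 - real i) * p)"
      using ratio[OF lt] lt by (simp add: y_def of_nat_diff algebra_simps)
    have yp: "y > 0" using y D by simp
    have "(real k - real j0 - real i) * p / y \<ge> 1 - real s / D"
    proof -
      have "1 - (real k - real j0 - real i) * p / y = (y - (real k - real j0 - real i) * p) / y"
        using yp by (simp add: field_simps)
      also have "\<dots> \<le> real s / y" using num yp by (intro divide_right_mono) auto
      also have "\<dots> \<le> real s / D" using y D by (intro divide_left_mono) auto
      finally show ?thesis by simp
    qed
    then have "b (j0+i) * (1 - real s / D) \<le> b (j0+i) * ((real k - real j0 - real i) * p / y)"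
      using b0 by (intro mult_left_mono) auto
    also have "\<dots> = b (Suc (j0+i))" using r yp by (simp add: field_simps)
    finally have A: "b (j0+i) - real s / D * b (j0+i) \<le> b (Suc (j0+i))" by (simp add: algebra_simps)
    have "real s / D * b (j0+i) \<le> real s / D * b j0"
      using j0(2)[of "j0+i"] lt D by (intro mult_left_mono) auto
    then have "b (Suc (j0+i)) \<ge> b j0 * (1 - real i * real s / D) - real s / D * b j0" using A IH by linarith
    then show ?case using lt by (simp add: algebra_simps add_divide_distrib)
  qed
  have half: "b (j0 + i) \<ge> b j0 / 2" if "i \<le> s" for i
  proof -
    have "real i * real s \<le> real s * real s" using that by (intro mult_right_mono) auto
    then have "real i * real s / D \<le> 1/2" using ss D by (simp add: field_simps)
    then have "b j0 * (1 - real i * real s / D) \<ge> b j0 * (1/2)"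
      using bpos by (intro mult_left_mono) auto
    then show ?thesis using step[OF that] by linarith
  qed
  have "(real s + 1) * (b j0 / 2) = (\<Sum>i\<le>s. b j0 / 2)" by simp
  also have "\<dots> \<le> (\<Sum>i\<le>s. b (j0 + i))" by (intro sum_mono half) auto
  also have "\<dots> = (\<Sum>i\<in>(+) j0 ` {..s}. b i)" by (simp add: sum.reindex)
  also have "\<dots> \<le> (\<Sum>j\<le>k. b j)"
  proof (rule sum_mono2)
    show "(+) j0 ` {..s} \<subseteq> {..k}" using step j0(1) by fastforce
  qed (use b0 in auto)
  finally have "(real s + 1) * (b j0 / 2) \<le> 1" using tot by simp
  moreover have "sqrt (D/2) * (b j0 / 2) \<le> (real s + 1) * (b j0 / 2)"
    using s2 bpos by (intro mult_right_mono) auto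
  ultimately have "sqrt (D/2) * (b j0 / 2) \<le> 1" by linarith
  then have "b j0 \<le> 2 * sqrt 2 / sqrt D"
    using D by (simp add: real_sqrt_divide field_simps)
  then show ?thesis using j0(2)[OF j] by (simp add: b_def D_def q_def)
qed

section \<open>Mixing along a step\<close>

locale bernoulli_mixing =
  fixes p :: real
  assumes p_pos: "0 < p" and p_le: "p \<le> 1/2"
begin

definition mix :: "int \<Rightarrow> (int \<Rightarrow> real) \<Rightarrow> int \<Rightarrow> real" where
  "mix x g t = (1 - p) * g t + p * g (t + x)"

fun mixl :: "int list \<Rightarrow> (int \<Rightarrow> real) \<Rightarrow> int \<Rightarrow> real" where
  "mixl [] g = g"
| "mixl (x # xs) g = mixl xs (mix x g)"

lemma mixl_append: "mixl (xs @ ys) g = mixl ys (mixl xs g)"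
  by (induction xs arbitrary: g) auto

lemma mix_commute: "mix x (mix y g) = mix y (mix x g)"
  by (rule ext) (simp add: mix_def algebra_simps)

lemma mixl_mix: "mixl xs (mix x g) = mix x (mixl xs g)"
proof (induction xs arbitrary: g)
  case (Cons y ys)
  then show ?case using Cons.IH[of "mix y g"] by (simp add: mix_commute[of y x])
qed simp

text \<open>The defining equation of \<open>mixl\<close> changes the function; since mixing steps
  commute, the first step can be moved to the evaluation point instead, and inductions then vary
  \<open>t\<close> with \<open>g\<close> fixed.\<close>

lemma mixl_Cons: "mixl (x # xs) g t = (1 - p) * mixl xs g t + p * mixl xs g (t + x)"
  by (simp add: mixl_mix) (simp add: mix_def)

lemma mixl_linear: "mixl xs (\<lambda>z. a * g z + b * h z) t = a * mixl xs g t + b * mixl xs h t"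
proof (induction xs arbitrary: t)
  case (Cons y ys)
  then show ?case by (simp only: mixl_Cons) (simp add: algebra_simps)
qed simp

lemma mixl_const: "mixl xs (\<lambda>z. c) t = c"
  by (induction xs arbitrary: t) (simp_all only: mixl_Cons, simp_all add: algebra_simps)

lemma mixl_mono:
  assumes "\<And>z. g z \<le> h z" shows "mixl xs g t \<le> mixl xs h t"
proof (induction xs arbitrary: t)
  case (Cons y ys)
  then show ?case unfolding mixl_Cons
    using p_pos p_le by (intro add_mono mult_left_mono) auto
qed (use assms in simp)

lemma mixl_nonneg: "(\<And>z. 0 \<le> g z) \<Longrightarrow> 0 \<le> mixl xs g t"
  using mixl_mono[of "\<lambda>_. 0" g xs t] mixl_const[of xs 0 t] by simp

lemma mixl_subsets:
  assumes "distinct js"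
  shows "mixl (map X js) g t =
    (\<Sum>F\<in>Pow (set js). p ^ card F * (1 - p) ^ card (set js - F) * g (t + sum X F))"
  using assms
proof (induction js arbitrary: t)
  case (Cons j js)
  let ?S = "set js"
  have inj: "inj_on (insert j) (Pow ?S)" using Cons.prems by (auto simp: inj_on_def)
  have disj: "Pow ?S \<inter> insert j ` Pow ?S = {}" using Cons.prems by auto
  have a: "p ^ card F * (1 - p) ^ card (set (j # js) - F) * g (t + sum X F)
      = (1 - p) * (p ^ card F * (1 - p) ^ card (?S - F) * g (t + sum X F))" if "F \<in> Pow ?S" for F
  proof -
    have "set (j # js) - F = insert j (?S - F)" "j \<notin> ?S - F" using that Cons.prems by auto
    then show ?thesis by simp
  qed
  have b: "p ^ card (insert j F) * (1 - p) ^ card (set (j # js) - insert j F) * g (t + sum X (insert j F))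
      = p * (p ^ card F * (1 - p) ^ card (?S - F) * g (t + X j + sum X F))" if "F \<in> Pow ?S" for F
  proof -
    have "set (j # js) - insert j F = ?S - F" "j \<notin> F" "finite F"
      using that Cons.prems finite_subset by auto
    then show ?thesis by (simp add: add.assoc)
  qed
  let ?w = "\<lambda>F. p ^ card F * (1 - p) ^ card (?S - F)"
  have "(\<Sum>F\<in>Pow (set (j # js)). p ^ card F * (1 - p) ^ card (set (j # js) - F) * g (t + sum X F))
    = (\<Sum>F\<in>Pow ?S. p ^ card F * (1 - p) ^ card (set (j # js) - F) * g (t + sum X F)) +
      (\<Sum>F\<in>insert j ` Pow ?S. p ^ card F * (1 - p) ^ card (set (j # js) - F) * g (t + sum X F))"
    unfolding list.set(2)[of j js] Pow_insert by (rule sum.union_disjoint) (use disj in auto)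
  also have "(\<Sum>F\<in>insert j ` Pow ?S. p ^ card F * (1 - p) ^ card (set (j # js) - F) * g (t + sum X F))
    = (\<Sum>F\<in>Pow ?S. p * (?w F * g (t + X j + sum X F)))"
    unfolding sum.reindex[OF inj] o_def by (rule sum.cong[OF refl b])
  also have "(\<Sum>F\<in>Pow ?S. p ^ card F * (1 - p) ^ card (set (j # js) - F) * g (t + sum X F))
    = (\<Sum>F\<in>Pow ?S. (1 - p) * (?w F * g (t + sum X F)))"
    by (rule sum.cong[OF refl a])
  also have "(\<Sum>F\<in>Pow ?S. (1 - p) * (?w F * g (t + sum X F))) + (\<Sum>F\<in>Pow ?S. p * (?w F * g (t + X j + sum X F)))
    = mixl (map X (j # js)) g t"
    using Cons.IH Cons.prems by (simp only: list.map mixl_Cons sum_distrib_left[symmetric]) simp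
  finally show ?case ..
qed simp

text \<open>Any enumeration \<open>js\<close> will do, which leaves the two stages free to choose
  their coordinates.\<close>

lemma f_Apl_eq_mixl:
  assumes "distinct js" "set js = {1..n}"
  shows "f_Apl f p n X = mixl (map X js) f"
proof
  fix t
  let ?E = "{1..n} \<rightarrow>\<^sub>E {0::nat, 1}"
  have "(\<Sum>F\<in>Pow {1..n}. p ^ card F * (1 - p) ^ card ({1..n} - F) * f (t + sum X F)) = f_Apl f p n X t"
    unfolding f_Apl_def
  proof (rule sum.reindex_bij_witness[of _ "\<lambda>v. {j\<in>{1..n}. v j = 1}" "\<lambda>F. \<lambda>j\<in>{1..n}. if j \<in> F then 1 else 0"])
    fix F assume F: "F \<in> Pow {1..n}"
    let ?v = "\<lambda>j\<in>{1..n}. if j \<in> F then 1 else (0::nat)"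
    show "{j\<in>{1..n}. ?v j = 1} = F" "?v \<in> ?E" using F by auto
    have "(\<Sum>j\<in>{1..n}. ?v j) = (\<Sum>j\<in>{1..n}. if j \<in> F then 1 else 0)" by (intro sum.cong) auto
    also have "\<dots> = card F" using F by (simp add: sum.If_cases Int_absorb1)
    finally have 1: "(\<Sum>j\<in>{1..n}. ?v j) = card F" .
    have "(\<Sum>j\<in>{1..n}. int (?v j) * X j) = (\<Sum>j\<in>{1..n}. if j \<in> F then X j else 0)" by (intro sum.cong) auto
    also have "\<dots> = sum X F" using F by (simp add: sum.If_cases Int_absorb1)
    finally have 2: "(\<Sum>j\<in>{1..n}. int (?v j) * X j) = sum X F" .
    have 3: "card ({1..n} - F) = n - card F" using F by (simp add: card_Diff_subset finite_subset[of F "{1..n}"])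
    show "p ^ (\<Sum>j\<in>{1..n}. ?v j) * (1 - p) ^ (n - (\<Sum>j\<in>{1..n}. ?v j)) * f (t + (\<Sum>j\<in>{1..n}. int (?v j) * X j))
      = p ^ card F * (1 - p) ^ card ({1..n} - F) * f (t + sum X F)"
      unfolding 1 2 3 ..
  next
    fix v assume "v \<in> ?E"
    then show "(\<lambda>j\<in>{1..n}. if j \<in> {j\<in>{1..n}. v j = 1} then 1 else 0) = v" "{j\<in>{1..n}. v j = 1} \<in> Pow {1..n}"
      by (auto simp: fun_eq_iff PiE_def Pi_def extensional_def)
  qed
  then show "f_Apl f p n X t = mixl (map X js) f t"
    using mixl_subsets[OF assms(1), of X f t] assms(2) by simp
qed

text \<open>The invariants of a mixing step. The doubling clause looks only to the right, because a
  set is only ever thickened in the form \<open>x + e \<in> B\<close> with \<open>e\<close>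
  nonnegative.\<close>

definition regular :: "nat \<Rightarrow> real \<Rightarrow> nat \<Rightarrow> (int \<Rightarrow> real) \<Rightarrow> bool" where
  "regular N w l g \<longleftrightarrow> (\<forall>t. 0 \<le> g t) \<and> (g has_sum 1) UNIV \<and>
     (\<forall>a. (\<Sum>t\<in>{a..<a + int N}. g t) \<le> w) \<and> (\<forall>t. \<forall>e\<in>{0..int l}. g (t + e) \<le> 2 * g t)"

lemma has_sum_translate:
  fixes g :: "int \<Rightarrow> real"
  assumes "(g has_sum s) UNIV" shows "((\<lambda>t. g (t + x)) has_sum s) UNIV"
proof -
  have "bij (\<lambda>t. t + x)" by (rule bij_betw_byWitness[of _ "\<lambda>t. t - x"]) auto
  from has_sum_reindex_bij_betw[OF this, of g s] assms show ?thesis by simp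
qed

lemma mix_window_sum_le:
  assumes "\<And>a. (\<Sum>t\<in>{a..<a + int N}. g t) \<le> w"
  shows "(\<Sum>t\<in>{a..<a + int N}. mix x g t) \<le> w"
proof -
  have "(\<Sum>t\<in>{a..<a + int N}. g (t + x)) = (\<Sum>t\<in>{a+x..<a+x + int N}. g t)"
    by (rule sum.reindex_bij_witness[of _ "\<lambda>t. t - x" "\<lambda>t. t + x"]) auto
  then have "sum (mix x g) {a..<a + int N}
     = (1 - p) * (\<Sum>t\<in>{a..<a + int N}. g t) + p * (\<Sum>t\<in>{a+x..<a+x + int N}. g t)"
    by (simp add: mix_def[abs_def] sum.distrib flip: sum_distrib_left)
  also have "\<dots> \<le> (1 - p) * w + p * w"
    using assms p_pos p_le by (intro add_mono mult_left_mono) auto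
  finally show ?thesis by (simp add: algebra_simps)
qed

lemma regular_mix:
  assumes "regular N w l g" shows "regular N w l (mix x g)"
  unfolding regular_def
proof (intro conjI allI ballI)
  note g = assms[unfolded regular_def]
  show "0 \<le> mix x g t" for t using g p_pos p_le by (simp add: mix_def)
  have "((\<lambda>t. (1 - p) * g t + p * g (t + x)) has_sum (1 - p) * 1 + p * 1) UNIV"
    using g by (intro has_sum_add has_sum_cmult_right has_sum_translate) auto
  then show "(mix x g has_sum 1) UNIV" by (simp add: mix_def[abs_def])
  show "sum (mix x g) {a..<a + int N} \<le> w" for a
    using g by (intro mix_window_sum_le) auto
  fix t e :: int assume e: "e \<in> {0..int l}"
  have "g (t + e) \<le> 2 * g t" "g (t + x + e) \<le> 2 * g (t + x)" using g e by auto
  then have "(1 - p) * g (t + e) + p * g (t + x + e) \<le> (1 - p) * (2 * g t) + p * (2 * g (t + x))"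
    using p_pos p_le by (intro add_mono mult_left_mono) auto
  then show "mix x g (t + e) \<le> 2 * mix x g t" by (simp add: mix_def algebra_simps)
qed

lemma regular_mixl: "regular N w l g \<Longrightarrow> regular N w l (mixl xs g)"
  by (induction xs arbitrary: g) (auto simp: regular_mix)

lemma le_one_of_has_sum:
  fixes g :: "'a \<Rightarrow> real"
  assumes "(g has_sum 1) UNIV" "\<And>t. 0 \<le> g t" shows "g t \<le> 1"
  using finite_sum_le_has_sum[OF assms(1), of "{t}"] assms(2) by simp

text \<open>Subset sums falling into one window of length \<open>N\<close> form an antichain, so LYM bounds their
  Bernoulli weight by the largest binomial weight.\<close>

lemma antichain_window_sum_le:
  fixes X :: "'b \<Rightarrow> int"
  assumes J: "finite J" "J \<noteq> {}" and X: "(\<forall>j\<in>J. X j > int N) \<or> (\<forall>j\<in>J. X j < - int N)"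
    and f: "\<And>t. 0 \<le> f t" "(f has_sum 1) UNIV"
  shows "(\<Sum>t\<in>{a..<a + int N}. \<Sum>F\<in>Pow J. p ^ card F * (1 - p) ^ card (J - F) * f (t + sum X F))
     \<le> 2 * sqrt 2 / sqrt (real (card J) * p * (1 - p))"
proof -
  define c where "c = 2 * sqrt 2 / sqrt (real (card J) * p * (1 - p))"
  define W where "W F = p ^ card F * (1 - p) ^ card (J - F)" for F
  let ?I = "{a..<a + int N}"
  \<comment> \<open>A finite set of all arguments of \<open>f\<close> that occur, so that the
    exchange of sums below is finite.\<close>
  define Z where "Z = (\<Union>F\<in>Pow J. (\<lambda>t. t + sum X F) ` ?I)"
  have q: "p < 1" using p_le by simp
  have c0: "c \<ge> 0" using p_pos q by (simp add: c_def)
  have finZ: "finite Z" using J by (auto simp: Z_def)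
  \<comment> \<open>Strictly nested subsets differ by at least one step longer than
    \<open>N\<close>, and steps of one sign cannot cancel; so their sums never lie in a common
    window of length \<open>N\<close>.\<close>
  have strict: "\<bar>sum X G - sum X F\<bar> > int N" if "F \<subset> G" "G \<subseteq> J" for F G
  proof -
    have fin: "finite G" using that J finite_subset by blast
    have d: "sum X G - sum X F = sum X (G - F)" using that fin by (simp add: sum_diff psubset_imp_subset)
    have ne: "G - F \<noteq> {}" "finite (G - F)" using that fin by auto
    then obtain j where j: "j \<in> G - F" by auto
    from X show ?thesis
    proof
      assume A: "\<forall>j\<in>J. X j > int N"
      have "X j \<le> sum X (G - F)" using A j ne that by (intro member_le_sum) (force+)
      moreover have "X j > int N" using A j that by auto
      ultimately show ?thesis using d by linarith
    next
      assume A: "\<forall>j\<in>J. X j < - int N"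
      have "- X j \<le> (\<Sum>j\<in>G - F. - X j)" using A j ne that by (intro member_le_sum) (force+)
      moreover have "X j < - int N" using A j that by auto
      ultimately show ?thesis using d by (simp add: sum_negf)
    qed
  qed
  have inner: "(\<Sum>F\<in>{F\<in>Pow J. z - sum X F \<in> ?I}. W F) \<le> c" for z
  proof -
    let ?F = "{F\<in>Pow J. z - sum X F \<in> ?I}"
    have "(\<Sum>F\<in>?F. W F) \<le> (\<Sum>F\<in>?F. c * (1 / real (card J choose card F)))"
    proof (rule sum_mono)
      fix F assume "F \<in> ?F"
      then have F: "F \<subseteq> J" "finite F" "card F \<le> card J"
        using J finite_subset card_mono by auto
      have "real (card J choose card F) * p ^ card F * (1 - p) ^ (card J - card F) \<le> c"
        unfolding c_def using J F by (intro binomial_weight_le p_pos q) (auto simp: card_gt_0_iff)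
      moreover have "card (J - F) = card J - card F" using F by (simp add: card_Diff_subset)
      moreover have "real (card J choose card F) > 0" using F by (simp add: zero_less_binomial)
      ultimately show "W F \<le> c * (1 / real (card J choose card F))"
        by (simp add: W_def field_simps)
    qed
    also have "\<dots> = c * (\<Sum>F\<in>?F. 1 / real (card J choose card F))" by (simp add: sum_distrib_left)
    also have "\<dots> \<le> c * 1"
    proof (intro mult_left_mono c0 LYM_inequality J)
      fix F G assume FG: "F \<in> ?F" "G \<in> ?F" "F \<subset> G"
      then show False using strict[of F G] by auto
    qed auto
    finally show ?thesis by simp
  qed
  have "(\<Sum>t\<in>?I. \<Sum>F\<in>Pow J. W F * f (t + sum X F)) = (\<Sum>F\<in>Pow J. W F * (\<Sum>t\<in>?I. f (t + sum X F)))"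
    by (subst sum.swap) (simp add: sum_distrib_left)
  also have "\<dots> = (\<Sum>F\<in>Pow J. \<Sum>z\<in>Z. if z - sum X F \<in> ?I then W F * f z else 0)"
  proof (rule sum.cong[OF refl])
    fix F assume F: "F \<in> Pow J"
    have "(\<Sum>t\<in>?I. f (t + sum X F)) = (\<Sum>z\<in>{z\<in>Z. z - sum X F \<in> ?I}. f z)"
    proof (rule sum.reindex_bij_witness[of _ "\<lambda>z. z - sum X F" "\<lambda>t. t + sum X F"])
      fix t assume "t \<in> ?I"
      then have "t + sum X F \<in> Z" using F unfolding Z_def by blast
      with \<open>t \<in> ?I\<close> show "t + sum X F \<in> {z \<in> Z. z - sum X F \<in> ?I}" by simp
    qed auto
    then show "W F * (\<Sum>t\<in>?I. f (t + sum X F)) = (\<Sum>z\<in>Z. if z - sum X F \<in> ?I then W F * f z else 0)"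
      using finZ by (auto simp: sum_distrib_left sum.inter_filter intro!: sum.cong)
  qed
  also have "\<dots> = (\<Sum>z\<in>Z. \<Sum>F\<in>Pow J. if z - sum X F \<in> ?I then W F * f z else 0)" by (rule sum.swap)
  also have "\<dots> = (\<Sum>z\<in>Z. f z * (\<Sum>F\<in>{F\<in>Pow J. z - sum X F \<in> ?I}. W F))"
    using J by (intro sum.cong refl) (simp add: sum_distrib_left sum.inter_filter mult.commute flip: sum.inter_filter)
  also have "\<dots> \<le> (\<Sum>z\<in>Z. f z * c)" by (intro sum_mono mult_left_mono inner f)
  also have "\<dots> = sum f Z * c" by (simp add: sum_distrib_right)
  also have "\<dots> \<le> 1 * c" by (intro mult_right_mono c0 finite_sum_le_has_sum[OF f(2)]) (use f finZ in auto)
  finally show ?thesis by (simp add: W_def c_def)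
qed

lemma mixl_window_sum_mono:
  assumes "\<And>a. (\<Sum>t\<in>{a..<a + int N}. g t) \<le> w"
  shows "(\<Sum>t\<in>{a..<a + int N}. mixl xs g t) \<le> w"
  using assms
proof (induction xs arbitrary: g a)
  case (Cons x xs)
  show ?case using Cons.IH[OF mix_window_sum_le[OF Cons.prems]] by simp
qed simp

text \<open>The antichain bound needs steps of one sign. The more frequent sign accounts for at
  least half of the steps, whence the constant 4 in place of \<open>2 * sqrt 2\<close>; the
  remaining steps only average window sums and cannot raise the bound.\<close>

lemma littlewood_offord_window:
  assumes xs: "length xs = k" "0 < k" "\<forall>x\<in>set xs. \<bar>x\<bar> > int N"
    and f: "\<And>t. 0 \<le> f t" "(f has_sum 1) UNIV"
  shows "(\<Sum>t\<in>{a..<a + int N}. mixl xs f t) \<le> 4 / sqrt (real k * p * (1 - p))"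
proof -
  have q: "0 < 1 - p" using p_le by simp
  define P where "P = [j \<leftarrow> [0..<k]. xs ! j > int N]"
  define M where "M = [j \<leftarrow> [0..<k]. \<not> xs ! j > int N]"
  have len: "length P + length M = k"
    unfolding P_def M_def using sum_length_filter_compl[of _ "[0..<k]"] by simp
  have big: "\<bar>xs ! j\<bar> > int N" if "j < k" for j using that xs by simp
  have main: "(\<Sum>t\<in>{a..<a + int N}. mixl (map ((!) xs) js) f t) \<le> 4 / sqrt (real k * p * (1 - p))"
    if js: "distinct js" "2 * length js \<ge> k"
      "(\<forall>j\<in>set js. xs ! j > int N) \<or> (\<forall>j\<in>set js. xs ! j < - int N)" for js a
  proof -
    have card: "card (set js) = length js" using js by (simp add: distinct_card)
    have "(\<Sum>t\<in>{a..<a + int N}. mixl (map ((!) xs) js) f t)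
      \<le> 2 * sqrt 2 / sqrt (real (card (set js)) * p * (1 - p))"
      unfolding mixl_subsets[OF js(1)] using js xs f by (intro antichain_window_sum_le) auto
    also have "\<dots> = 4 / sqrt (real (2 * length js) * p * (1 - p))"
    proof -
      have "sqrt (real (2 * length js) * p * (1 - p)) = sqrt 2 * sqrt (real (length js) * p * (1 - p))"
        by (simp only: of_nat_mult of_nat_numeral mult.assoc real_sqrt_mult)
      moreover have "sqrt 2 * sqrt 2 = (2::real)" by simp
      ultimately show ?thesis using card by (simp add: divide_simps del: real_sqrt_mult_self)
    qed
    also have "\<dots> \<le> 4 / sqrt (real k * p * (1 - p))"
    proof -
      have "length js > 0" using xs(2) js(2) by linarith
      then show ?thesis
        using xs(2) js(2) q p_pos
        by (intro divide_left_mono real_sqrt_le_mono mult_right_mono mult_pos_pos real_sqrt_gt_zero) auto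
    qed
    finally show ?thesis .
  qed
  have eq: "mixl xs f = mixl (map ((!) xs) (js @ ks)) f"
    if "distinct (js @ ks)" "set (js @ ks) = {..<k}" for js ks
  proof
    fix t
    have "xs = map ((!) xs) [0..<k]" using xs(1) map_nth by metis
    then have "mixl xs f t = mixl (map ((!) xs) [0..<k]) f t" by simp
    also have "\<dots> = mixl (map ((!) xs) (js @ ks)) f t"
      using that by (subst mixl_subsets, simp, subst mixl_subsets, simp, simp only: that set_upt)
        (simp add: atLeast0LessThan)
    finally show "mixl xs f t = mixl (map ((!) xs) (js @ ks)) f t" .
  qed
  have d: "distinct (P @ M)" "set (P @ M) = {..<k}" "distinct (M @ P)" "set (M @ P) = {..<k}"
    by (auto simp: P_def M_def)
  have pm: "\<forall>j\<in>set P. xs ! j > int N" "\<forall>j\<in>set M. xs ! j < - int N"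
    using big by (force simp: P_def M_def)+
  show ?thesis
  proof (cases "2 * length P \<ge> k")
    case True
    then show ?thesis
      unfolding eq[OF d(1,2)] map_append mixl_append
      using d pm by (intro mixl_window_sum_mono main) auto
  next
    case False
    then have "2 * length M \<ge> k" using len by linarith
    then show ?thesis
      unfolding eq[OF d(3,4)] map_append mixl_append
      using d pm by (intro mixl_window_sum_mono main) auto
  qed
qed

end

section \<open>Averaging over the steps and the energy\<close>

text \<open>Expectation over independent uniform entries, as a recursion on lists: conditioning on
  the earlier steps is then just \<open>mean_list_append\<close>.\<close>

fun mean_list :: "'a set list \<Rightarrow> ('a list \<Rightarrow> real) \<Rightarrow> real" where
  "mean_list [] F = F []"
| "mean_list (A # As) F = (\<Sum>x\<in>A. mean_list As (\<lambda>xs. F (x # xs))) / real (card A)"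

lemma mean_list_mono:
  assumes "\<And>xs. xs \<in> listset As \<Longrightarrow> F xs \<le> G xs"
  shows "mean_list As F \<le> mean_list As G"
  using assms
proof (induction As arbitrary: F G)
  case (Cons A As)
  have "mean_list As (\<lambda>xs. F (x # xs)) \<le> mean_list As (\<lambda>xs. G (x # xs))" if "x \<in> A" for x
    by (rule Cons.IH) (use Cons.prems that in \<open>auto simp: set_Cons_def\<close>)
  then show ?case by (auto intro!: divide_right_mono sum_mono)
qed simp

lemma mean_list_const:
  assumes "\<forall>A\<in>set As. finite A \<and> A \<noteq> {}" shows "mean_list As (\<lambda>_. c) = c"
  using assms by (induction As) auto

lemma mean_list_nonneg:
  assumes "\<And>xs. xs \<in> listset As \<Longrightarrow> 0 \<le> F xs" shows "0 \<le> mean_list As F"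
  using assms
proof (induction As arbitrary: F)
  case (Cons A As)
  have "0 \<le> mean_list As (\<lambda>xs. F (x # xs))" if "x \<in> A" for x
    by (rule Cons.IH) (use Cons.prems that in \<open>auto simp: set_Cons_def\<close>)
  then show ?case by (auto intro!: divide_nonneg_nonneg sum_nonneg)
qed simp

lemma mean_list_le:
  assumes "\<forall>A\<in>set As. finite A \<and> A \<noteq> {}" "\<And>xs. xs \<in> listset As \<Longrightarrow> F xs \<le> c"
  shows "mean_list As F \<le> c"
  using mean_list_mono[of As F "\<lambda>_. c"] mean_list_const assms by metis

lemma mean_list_linear:
  "mean_list As (\<lambda>xs. a * F xs + b * G xs) = a * mean_list As F + b * mean_list As G"
  by (induction As arbitrary: F G) (simp_all add: sum.distrib add_divide_distrib flip: sum_distrib_left)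

lemma mean_list_cmult: "mean_list As (\<lambda>xs. a * F xs) = a * mean_list As F"
  using mean_list_linear[of As a F 0] by simp

lemma mean_list_add: "mean_list As (\<lambda>xs. F xs + G xs) = mean_list As F + mean_list As G"
  using mean_list_linear[of As 1 F 1 G] by simp

lemma mean_list_sum: "finite I \<Longrightarrow> mean_list As (\<lambda>xs. \<Sum>i\<in>I. F i xs) = (\<Sum>i\<in>I. mean_list As (F i))"
proof (induction I rule: finite_induct)
  case empty
  show ?case using mean_list_cmult[of As 0] by simp
qed (simp add: mean_list_add)

lemma mean_list_append:
  "mean_list (As @ Bs) F = mean_list As (\<lambda>xs. mean_list Bs (\<lambda>ys. F (xs @ ys)))"
  by (induction As arbitrary: F) auto

lemma prob_unif_eq_mean_list:
  assumes "distinct js" "set js = {1..n}" "\<And>i. i \<in> {1..n} \<Longrightarrow> finite (A i)"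
  shows "prob_unif n A (\<lambda>X. P (map X js)) = mean_list (map A js) (\<lambda>xs. of_bool (P xs))"
proof -
  have main: "(\<Sum>X\<in>PiE (set js) A. F (map X js)) / real (card (PiE (set js) A)) = mean_list (map A js) F"
    if "distinct js" "\<forall>i\<in>set js. finite (A i)" for js and F :: "int list \<Rightarrow> real"
    using that
  proof (induction js arbitrary: F)
    case (Cons j js)
    have eq: "PiE (set (j # js)) A = (\<lambda>(y, g). g(j := y)) ` (A j \<times> PiE (set js) A)"
      by (simp add: PiE_insert_eq)
    have inj: "inj_on (\<lambda>(y, g). g(j := y)) (A j \<times> PiE (set js) A)"
      using inj_combinator[of j "set js" A] Cons.prems by simp
    have upd: "map (g(j := y)) js = map g js" for g :: "nat \<Rightarrow> int" and y
      using Cons.prems by (intro map_cong) auto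
    have "(\<Sum>X\<in>PiE (set (j # js)) A. F (map X (j # js)))
        = (\<Sum>y\<in>A j. \<Sum>g\<in>PiE (set js) A. F (y # map g js))"
      unfolding eq sum.reindex[OF inj] by (simp add: sum.cartesian_product o_def case_prod_unfold upd)
    moreover have "card (PiE (set (j # js)) A) = card (A j) * card (PiE (set js) A)"
      unfolding eq by (simp add: card_image[OF inj] card_cartesian_product)
    ultimately have "(\<Sum>X\<in>PiE (set (j # js)) A. F (map X (j # js))) / real (card (PiE (set (j # js)) A))
      = (\<Sum>y\<in>A j. (\<Sum>g\<in>PiE (set js) A. F (y # map g js)) / real (card (PiE (set js) A))) / real (card (A j))"
      by (simp add: sum_divide_distrib mult.commute)
    also have "\<dots> = mean_list (map A (j # js)) F"
      using Cons.IH[of "\<lambda>xs. F (_ # xs)"] Cons.prems by simp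
    finally show ?case .
  qed simp
  have "real (card {X \<in> PiE {1..n} A. P (map X js)}) = (\<Sum>X\<in>PiE {1..n} A. of_bool (P (map X js)))"
  proof -
    have "finite (PiE {1..n} A)" using assms(3) by (intro finite_PiE) auto
    then show ?thesis by (simp add: sum.If_cases of_bool_def Int_def)
  qed
  then show ?thesis using main[of js "\<lambda>xs. of_bool (P xs)"] assms by (simp add: prob_unif_def)
qed

text \<open>Convexity of the power, by induction with Chebyshev's inequality for the similarly
  ordered pairs \<open>a, b\<close> and \<open>a ^ Suc s, b ^ Suc s\<close>. The weights are not
  normalised: \<open>hoelder_2\<close> gains from a total below 1.\<close>

lemma power_mean_2:
  fixes a b \<alpha> \<beta> :: real
  assumes "0 \<le> a" "0 \<le> b" "0 \<le> \<alpha>" "0 \<le> \<beta>"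
  shows "(\<alpha> * a + \<beta> * b) ^ Suc s \<le> (\<alpha> + \<beta>) ^ s * (\<alpha> * a ^ Suc s + \<beta> * b ^ Suc s)"
proof (induction s)
  case (Suc s)
  have "0 \<le> (a - b) * (a ^ Suc s - b ^ Suc s)"
    using assms power_mono[of a b "Suc s"] power_mono[of b a "Suc s"]
    by (cases "a \<le> b") (simp_all add: mult_nonneg_nonneg mult_nonpos_nonpos del: power_Suc)
  then have "0 \<le> \<alpha> * \<beta> * ((a - b) * (a ^ Suc s - b ^ Suc s))" using assms by simp
  then have *: "(\<alpha> * a + \<beta> * b) * (\<alpha> * a ^ Suc s + \<beta> * b ^ Suc s)
      \<le> (\<alpha> + \<beta>) * (\<alpha> * a ^ Suc (Suc s) + \<beta> * b ^ Suc (Suc s))"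
    by (simp add: algebra_simps)
  have "(\<alpha> * a + \<beta> * b) ^ Suc (Suc s) = (\<alpha> * a + \<beta> * b) * (\<alpha> * a + \<beta> * b) ^ Suc s" by simp
  also have "\<dots> \<le> (\<alpha> * a + \<beta> * b) * ((\<alpha> + \<beta>) ^ s * (\<alpha> * a ^ Suc s + \<beta> * b ^ Suc s))"
    using assms by (intro mult_left_mono Suc.IH) auto
  also have "\<dots> = (\<alpha> + \<beta>) ^ s * ((\<alpha> * a + \<beta> * b) * (\<alpha> * a ^ Suc s + \<beta> * b ^ Suc s))"
    by (simp only: mult_ac)
  also have "\<dots> \<le> (\<alpha> + \<beta>) ^ s * ((\<alpha> + \<beta>) * (\<alpha> * a ^ Suc (Suc s) + \<beta> * b ^ Suc (Suc s)))"
    using assms by (intro mult_left_mono *) auto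
  finally show ?case by (simp only: power_Suc mult_ac)
qed simp

section \<open>Energy above a threshold\<close>

definition excess :: "nat \<Rightarrow> real \<Rightarrow> (int \<Rightarrow> real) \<Rightarrow> int \<Rightarrow> real" where
  "excess s T g t = (max 0 (g t - T)) ^ Suc s"

definition energy :: "nat \<Rightarrow> real \<Rightarrow> (int \<Rightarrow> real) \<Rightarrow> real" where
  "energy s T g = (\<Sum>\<^sub>\<infinity>t. excess s T g t)"

lemma excess_nonneg: "0 \<le> excess s T g t"
  by (simp add: excess_def)

lemma infsum_finite_sum:
  fixes F :: "'b \<Rightarrow> 'a \<Rightarrow> real"
  assumes "finite I" "\<And>i. i \<in> I \<Longrightarrow> F i summable_on UNIV"
  shows "(\<lambda>t. \<Sum>i\<in>I. F i t) summable_on UNIV" "(\<Sum>\<^sub>\<infinity>t. \<Sum>i\<in>I. F i t) = (\<Sum>i\<in>I. \<Sum>\<^sub>\<infinity>t. F i t)"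
  using assms by (induction I rule: finite_induct) (auto simp: infsum_add summable_on_add)

lemma infsum_translate:
  fixes F :: "int \<Rightarrow> real"
  shows "(\<Sum>\<^sub>\<infinity>t. F (t + x)) = (\<Sum>\<^sub>\<infinity>t. F t)" "(\<lambda>t. F (t + x)) summable_on UNIV \<longleftrightarrow> F summable_on UNIV"
proof -
  have "bij (\<lambda>t. t + x)" by (rule bij_betw_byWitness[of _ "\<lambda>t. t - x"]) auto
  from infsum_reindex_bij_betw[OF this, of F] summable_on_reindex_bij_betw[OF this, of F]
  show "(\<Sum>\<^sub>\<infinity>t. F (t + x)) = (\<Sum>\<^sub>\<infinity>t. F t)" "(\<lambda>t. F (t + x)) summable_on UNIV \<longleftrightarrow> F summable_on UNIV"
    by auto
qed

lemma summable_mult_le_one: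
  fixes F G :: "'a \<Rightarrow> real"
  assumes "F summable_on UNIV" "\<And>t. 0 \<le> F t" "\<And>t. 0 \<le> G t" "\<And>t. G t \<le> 1"
  shows "(\<lambda>t. F t * G t) summable_on UNIV"
  by (rule summable_on_comparison_test[OF assms(1)])
    (use assms in \<open>auto intro: mult_left_le\<close>)

lemma mean_list_infsum:
  fixes F :: "'b list \<Rightarrow> 'a \<Rightarrow> real"
  assumes "\<And>xs. F xs summable_on UNIV" "\<forall>A\<in>set As. finite A"
  shows "(\<lambda>t. mean_list As (\<lambda>xs. F xs t)) summable_on UNIV \<and>
    mean_list As (\<lambda>xs. \<Sum>\<^sub>\<infinity>t. F xs t) = (\<Sum>\<^sub>\<infinity>t. mean_list As (\<lambda>xs. F xs t))"
  using assms
proof (induction As arbitrary: F)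
  case (Cons A As)
  have IH: "(\<lambda>t. mean_list As (\<lambda>xs. F (x # xs) t)) summable_on UNIV"
    "mean_list As (\<lambda>xs. \<Sum>\<^sub>\<infinity>t. F (x # xs) t) = (\<Sum>\<^sub>\<infinity>t. mean_list As (\<lambda>xs. F (x # xs) t))" for x
    using Cons.IH[of "\<lambda>xs. F (x # xs)"] Cons.prems by auto
  have fin: "finite A" using Cons.prems by simp
  show ?case
    using infsum_finite_sum[OF fin, of "\<lambda>x t. mean_list As (\<lambda>xs. F (x # xs) t)"] IH
    by (auto simp: divide_inverse infsum_cmult_left' intro: summable_on_cmult_left)
qed simp

context bernoulli_mixing
begin

lemma regular_infsum: "regular N w l g \<Longrightarrow> infsum g UNIV = 1"
  by (intro infsumI) (simp add: regular_def)

lemma excess_le: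
  assumes "regular N w l g" "0 \<le> T" shows "excess s T g t \<le> g t"
proof -
  have "0 \<le> g t" "g t \<le> 1"
    using assms le_one_of_has_sum[of g t] by (auto simp: regular_def)
  then have m: "0 \<le> max 0 (g t - T)" "max 0 (g t - T) \<le> 1" "max 0 (g t - T) \<le> g t"
    using assms by auto
  have "excess s T g t = max 0 (g t - T) ^ s * max 0 (g t - T)" by (simp add: excess_def)
  also have "\<dots> \<le> 1 * max 0 (g t - T)" using m by (intro mult_right_mono power_le_one) auto
  also have "\<dots> = max 0 (g t - T)" by simp
  also note m(3)
  finally show ?thesis .
qed

lemma excess_summable:
  assumes "regular N w l g" "0 \<le> T" shows "excess s T g summable_on UNIV"
  by (rule summable_on_comparison_test[of g])
    (use assms excess_le[OF assms] in \<open>auto simp: regular_def excess_nonneg has_sum_imp_summable\<close>)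

lemma energy_nonneg: "0 \<le> energy s T g"
  unfolding energy_def by (rule infsum_nonneg) (simp add: excess_nonneg)

lemma energy_le_one:
  assumes "regular N w l g" "0 \<le> T" shows "energy s T g \<le> 1"
proof -
  have "energy s T g \<le> infsum g UNIV"
    unfolding energy_def using assms excess_le[OF assms]
    by (intro infsum_mono excess_summable) (auto simp: regular_def has_sum_imp_summable)
  then show ?thesis using regular_infsum[OF assms(1)] by simp
qed

lemma energy_ge_point:
  assumes "regular N w l g" "0 \<le> T" shows "excess s T g t \<le> energy s T g"
  using finite_sum_le_infsum[OF excess_summable[OF assms], of "{t}"]
  by (simp add: energy_def excess_nonneg)

text \<open>One factor of the excess is spent on the total mass 1, the other \<open>s\<close> are
  bounded by \<open>b\<close>. This hands the supremum reached in the first stage over to the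
  second.\<close>

lemma energy_le_sup:
  assumes "regular N w l g" "0 \<le> T" "\<And>t. g t \<le> b" "0 \<le> b" shows "energy s T g \<le> b ^ s"
proof -
  have "excess s T g t \<le> b ^ s * g t" for t
  proof -
    have g: "0 \<le> g t" using assms by (simp add: regular_def)
    have "excess s T g t \<le> g t ^ Suc s"
      unfolding excess_def using g assms by (intro power_mono) auto
    also have "\<dots> \<le> b ^ s * g t" using mult_right_mono[OF power_mono[of "g t" b s] g] g assms(3) by (simp add: mult.commute)
    finally show ?thesis .
  qed
  then have "energy s T g \<le> (\<Sum>\<^sub>\<infinity>t. b ^ s * g t)"
    unfolding energy_def using assms
    by (intro infsum_mono excess_summable summable_on_cmult_right) (auto simp: regular_def has_sum_imp_summable)
  then show ?thesis using regular_infsum[OF assms(1)] by (simp add: infsum_cmult_right')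
qed

text \<open>If at most one end of the step lies above \<open>T\<close>, the excess shrinks by the
  full power \<open>(1 - p) ^ Suc s\<close> or \<open>p ^ Suc s\<close>. Only when both ends do is
  plain convexity, without gain, all that is left; the indicators record this case.\<close>

lemma excess_mix_le:
  assumes "0 \<le> T"
  shows "excess s T (mix x g) t \<le> (1 - p) ^ Suc s * excess s T g t + p ^ Suc s * excess s T g (t + x)
     + (1 - p) * (excess s T g t * of_bool (g (t + x) > T)) + p * (excess s T g (t + x) * of_bool (g t > T))"
proof -
  define a where "a = max 0 (g t - T)"
  define b where "b = max 0 (g (t + x) - T)"
  have ab: "0 \<le> a" "0 \<le> b" by (auto simp: a_def b_def)
  have q: "0 \<le> 1 - p" "0 \<le> p" using p_pos p_le by auto
  have "mix x g t - T = (1 - p) * (g t - T) + p * (g (t + x) - T)" by (simp add: mix_def algebra_simps)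
  also have "\<dots> \<le> (1 - p) * a + p * b"
    using q by (intro add_mono mult_left_mono) (auto simp: a_def b_def)
  finally have "max 0 (mix x g t - T) \<le> (1 - p) * a + p * b" using q ab by simp
  then have E: "excess s T (mix x g) t \<le> ((1 - p) * a + p * b) ^ Suc s"
    unfolding excess_def by (intro power_mono) auto
  consider "g t \<le> T" | "g (t + x) \<le> T" | "g t > T" "g (t + x) > T" by linarith
  then show ?thesis
  proof cases
    case 1
    then have "a = 0" by (simp add: a_def)
    then show ?thesis using E 1 q ab by (simp add: excess_def a_def[symmetric] b_def[symmetric] power_mult_distrib del: power_Suc)
  next
    case 2
    then have "b = 0" by (simp add: b_def)
    then show ?thesis using E 2 q ab by (simp add: excess_def a_def[symmetric] b_def[symmetric] power_mult_distrib del: power_Suc)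
  next
    case 3
    have "((1 - p) * a + p * b) ^ Suc s \<le> (1 - p) * a ^ Suc s + p * b ^ Suc s"
      using power_mean_2[of a b "1 - p" p s] q ab by simp
    moreover have "0 \<le> (1 - p) ^ Suc s * a ^ Suc s" "0 \<le> p ^ Suc s * b ^ Suc s" using q ab by auto
    ultimately show ?thesis using E 3 by (simp add: excess_def a_def[symmetric] b_def[symmetric])
  qed
qed

lemma mean_energy_mix_le:
  assumes g: "regular N w l g" and T: "0 \<le> T"
    and A: "finite A" "A \<noteq> {}" "origin_symmetric A"
    and \<rho>: "\<And>t. real (card {x\<in>A. g (t + x) > T}) \<le> \<rho> * real (card A)"
  shows "mean_list [A] (\<lambda>xs. energy s T (mixl xs g)) \<le> ((1 - p) ^ Suc s + p ^ Suc s + \<rho>) * energy s T g"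
proof -
  let ?E = "excess s T g"
  let ?P = "energy s T g"
  let ?c = "real (card A)"
  note sm = excess_summable[OF g T, of s]
  have ind: "(\<lambda>t. ?E t * of_bool (g (t + x) > T)) summable_on UNIV" for x
    by (intro summable_mult_le_one sm excess_nonneg) auto
  have tr: "(\<lambda>t. ?E (t + x) * of_bool (g t > T)) summable_on UNIV"
    "(\<Sum>\<^sub>\<infinity>t. ?E (t + x) * of_bool (g t > T)) = (\<Sum>\<^sub>\<infinity>t. ?E t * of_bool (g (t + - x) > T))" for x
    using infsum_translate[of "\<lambda>t. ?E t * of_bool (g (t + - x) > T)" x] ind[of "- x"] by auto
  have smx: "(\<lambda>t. ?E (t + x)) summable_on UNIV" "(\<Sum>\<^sub>\<infinity>t. ?E (t + x)) = ?P" for x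
    using infsum_translate[of ?E x] sm by (auto simp: energy_def)
  define I where "I x = (\<Sum>\<^sub>\<infinity>t. ?E t * of_bool (g (t + x) > T))" for x
  have step: "energy s T (mix x g) \<le> ((1 - p) ^ Suc s + p ^ Suc s) * ?P + (1 - p) * I x + p * I (- x)" for x
  proof -
    have "energy s T (mix x g) \<le> (\<Sum>\<^sub>\<infinity>t. (1 - p) ^ Suc s * ?E t + p ^ Suc s * ?E (t + x)
     + (1 - p) * (?E t * of_bool (g (t + x) > T)) + p * (?E (t + x) * of_bool (g t > T)))"
      unfolding energy_def
      by (intro infsum_mono excess_mix_le[OF T] excess_summable[OF regular_mix[OF g] T]
          summable_on_add summable_on_cmult_right sm smx ind tr)
    also have "\<dots> = (1 - p) ^ Suc s * ?P + p ^ Suc s * ?P + (1 - p) * I x + p * I (- x)"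
      by (subst infsum_add, intro summable_on_add summable_on_cmult_right sm smx ind tr,
          intro summable_on_cmult_right sm smx ind tr)+
        (simp add: infsum_cmult_right' smx tr I_def del: power_Suc flip: energy_def)
    finally show ?thesis by (simp add: algebra_simps)
  qed
  have sumI: "(\<Sum>x\<in>A. I x) \<le> \<rho> * ?c * ?P"
  proof -
    have "(\<Sum>x\<in>A. I x) = (\<Sum>\<^sub>\<infinity>t. \<Sum>x\<in>A. ?E t * of_bool (g (t + x) > T))"
      unfolding I_def by (rule infsum_finite_sum(2)[symmetric]) (use A ind in auto)
    also have "\<dots> \<le> (\<Sum>\<^sub>\<infinity>t. (\<rho> * ?c) * ?E t)"
    proof (intro infsum_mono infsum_finite_sum(1) summable_on_cmult_right sm A ind)
      fix t
      have "(\<Sum>x\<in>A. ?E t * of_bool (g (t + x) > T)) = ?E t * real (card {x\<in>A. g (t + x) > T})"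
        using A by (simp add: sum.If_cases of_bool_def Int_def flip: sum_distrib_left)
      also have "\<dots> \<le> ?E t * (\<rho> * ?c)" by (intro mult_left_mono \<rho> excess_nonneg)
      finally show "(\<Sum>x\<in>A. ?E t * of_bool (g (t + x) > T)) \<le> (\<rho> * ?c) * ?E t" by (simp add: mult.commute)
    qed
    finally show ?thesis by (simp add: infsum_cmult_right' energy_def)
  qed
  \<comment> \<open>The term weighted by the excess at the far end involves the reversed step;
    symmetry of \<open>A\<close> gives it the same sum as the other term, and the weights
    \<open>1 - p\<close> and \<open>p\<close> add up to 1.\<close>
  have neg: "(\<Sum>x\<in>A. I (- x)) = (\<Sum>x\<in>A. I x)"
    by (rule sum.reindex_bij_witness[of _ uminus uminus]) (use A(3) in \<open>auto simp: origin_symmetric_def\<close>)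
  have "(\<Sum>x\<in>A. energy s T (mix x g)) \<le> (\<Sum>x\<in>A. ((1 - p) ^ Suc s + p ^ Suc s) * ?P + (1 - p) * I x + p * I (- x))"
    by (intro sum_mono step)
  also have "\<dots> = ?c * (((1 - p) ^ Suc s + p ^ Suc s) * ?P) + (1 - p) * (\<Sum>x\<in>A. I x) + p * (\<Sum>x\<in>A. I x)"
    by (simp add: sum.distrib neg del: power_Suc flip: sum_distrib_left)
  also have "\<dots> = ?c * (((1 - p) ^ Suc s + p ^ Suc s) * ?P) + (\<Sum>x\<in>A. I x)"
    by (simp add: algebra_simps del: power_Suc)
  also have "\<dots> \<le> ?c * (((1 - p) ^ Suc s + p ^ Suc s) * ?P) + \<rho> * ?c * ?P" using sumI by simp
  also have "\<dots> = (((1 - p) ^ Suc s + p ^ Suc s + \<rho>) * ?P) * ?c"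
    by (simp add: algebra_simps del: power_Suc)
  finally show ?thesis using A by (simp add: divide_simps card_gt_0_iff del: power_Suc)
qed

lemma mean_energy_concat_le:
  assumes step: "\<And>As g. As \<in> set Bss \<Longrightarrow> regular N w l g \<Longrightarrow>
      mean_list As (\<lambda>xs. energy s T (mixl xs g)) \<le> \<rho> * energy s T g"
    and "0 \<le> \<rho>" "regular N w l g"
  shows "mean_list (concat Bss) (\<lambda>xs. energy s T (mixl xs g)) \<le> \<rho> ^ length Bss * energy s T g"
  using assms
proof (induction Bss arbitrary: g)
  case (Cons As Bss)
  have "mean_list (concat (As # Bss)) (\<lambda>xs. energy s T (mixl xs g))
     = mean_list As (\<lambda>xs. mean_list (concat Bss) (\<lambda>ys. energy s T (mixl ys (mixl xs g))))"
    by (simp add: mean_list_append mixl_append)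
  also have "\<dots> \<le> mean_list As (\<lambda>xs. \<rho> ^ length Bss * energy s T (mixl xs g))"
    using Cons.prems by (intro mean_list_mono Cons.IH regular_mixl) auto
  also have "\<dots> \<le> \<rho> ^ length Bss * (\<rho> * energy s T g)"
    unfolding mean_list_cmult using Cons.prems by (intro mult_left_mono Cons.prems(1)) auto
  finally show ?case by (simp add: mult_ac)
qed simp

end

section \<open>Near-periods of sparse sets\<close>

text \<open>Sparseness is required of the thickened set, because near-periods of \<open>B\<close>
  reach a given distance only up to an error of at most \<open>l\<close>.\<close>

definition thick_sparse :: "nat \<Rightarrow> nat \<Rightarrow> int set \<Rightarrow> bool" where
  "thick_sparse N l B \<longleftrightarrow> (\<forall>z. 2 * card {x\<in>{z - int N..z}. \<exists>e\<in>{0..int l}. x + e \<in> B} < N + 1)"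

lemma thick_sparse_subset:
  assumes "thick_sparse N l B" "B' \<subseteq> B" shows "thick_sparse N l B'"
  unfolding thick_sparse_def
proof
  fix z
  have "card {x\<in>{z - int N..z}. \<exists>e\<in>{0..int l}. x + e \<in> B'} \<le> card {x\<in>{z - int N..z}. \<exists>e\<in>{0..int l}. x + e \<in> B}"
  proof (rule card_mono)
    show "finite {x\<in>{z - int N..z}. \<exists>e\<in>{0..int l}. x + e \<in> B}"
      by (rule finite_subset[of _ "{z - int N..z}"]) auto
  qed (use assms(2) in blast)
  moreover have "2 * card {x\<in>{z - int N..z}. \<exists>e\<in>{0..int l}. x + e \<in> B} < N + 1"
    using assms(1) unfolding thick_sparse_def by blast
  ultimately show "2 * card {x\<in>{z - int N..z}. \<exists>e\<in>{0..int l}. x + e \<in> B'} < N + 1"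
    by linarith
qed

text \<open>Walking from \<open>y\<close> to \<open>x\<close>: the cell \<open>c + P - P\<close> containing the current point is left for good at
  its last point below \<open>x\<close>, so each cell costs two differences of \<open>P\<close> and one unit step.\<close>

lemma walk_through_cover:
  fixes \<phi> :: "int \<Rightarrow> real"
  assumes sub: "\<And>a b. \<phi> (a + b) \<le> \<phi> a + \<phi> b"
    and diff: "\<And>u v. u \<in> P \<Longrightarrow> v \<in> P \<Longrightarrow> \<phi> (u - v) \<le> \<mu>" and "0 \<le> \<mu>"
    and "finite D" "y \<le> x"
    and "\<And>z. z \<in> {y..x} \<Longrightarrow> \<exists>c\<in>D. \<exists>u\<in>P. \<exists>v\<in>P. z = c + u - v"
  shows "\<exists>e\<in>{0..int (card D)}. \<phi> (x - y - e) \<le> 2 * real (card D) * \<mu>"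
  using assms(4-)
proof (induction "card D" arbitrary: D y)
  case 0
  then have "D = {}" by simp
  with 0 show ?case by force
next
  case (Suc k)
  have "y \<in> {y..x}" using Suc.prems by simp
  then obtain c u v where c: "c \<in> D" "u \<in> P" "v \<in> P" "y = c + u - v" using Suc.prems(3) by blast
  define S where "S = {z\<in>{y..x}. \<exists>u\<in>P. \<exists>v\<in>P. z = c + u - v}"
  have fS: "finite S" by (rule finite_subset[of _ "{y..x}"]) (auto simp: S_def)
  have yS: "y \<in> S" unfolding S_def using c \<open>y \<in> {y..x}\<close> by blast
  define z where "z = Max S"
  have z: "z \<in> S" unfolding z_def by (rule Max_in[OF fS]) (use yS in blast)
  have zmax: "w \<le> z" if "w \<in> S" for w unfolding z_def by (rule Max_ge[OF fS that])
  from z obtain u' v' where uv: "u' \<in> P" "v' \<in> P" "z = c + u' - v'"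
    unfolding S_def by blast
  from z have zx: "y \<le> z" "z \<le> x" unfolding S_def by simp_all
  have "z - y = (u' - v') + (v - u)" using uv c by simp
  then have zy: "\<phi> (z - y) \<le> 2 * \<mu>"
    using sub[of "u' - v'" "v - u"] diff[OF uv(1,2)] diff[OF c(3,2)] by simp
  show ?case
  proof (cases "z = x")
    case True
    have "2 * \<mu> \<le> 2 * real (card D) * \<mu>"
      using Suc.hyps(2) \<open>0 \<le> \<mu>\<close> by (simp flip: Suc.hyps(2) add: algebra_simps)
    then have "\<phi> (x - y - 0) \<le> 2 * real (card D) * \<mu>" using zy True by simp
    then show ?thesis by (intro bexI[of _ 0]) auto
  next
    case False
    have k: "k = card (D - {c})" using Suc.hyps(2) c(1) Suc.prems(1) by simp
    have cov: "\<exists>c'\<in>D - {c}. \<exists>u\<in>P. \<exists>v\<in>P. w = c' + u - v" if w: "w \<in> {z + 1..x}" for w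
    proof -
      have "w \<in> {y..x}" using w zx by auto
      then obtain c' where c': "c' \<in> D" "\<exists>u\<in>P. \<exists>v\<in>P. w = c' + u - v" using Suc.prems(3) by blast
      have "c' \<noteq> c"
      proof
        assume "c' = c"
        then have "w \<in> S" unfolding S_def using c'(2) \<open>w \<in> {y..x}\<close> by blast
        then show False using zmax[of w] w by simp
      qed
      then show ?thesis using c' by blast
    qed
    have "\<exists>e\<in>{0..int (card (D - {c}))}. \<phi> (x - (z + 1) - e) \<le> 2 * real (card (D - {c})) * \<mu>"
      by (rule Suc.hyps(1)[OF k]) (use Suc.prems False zx cov in auto)
    then obtain e where e: "e \<in> {0..int k}" "\<phi> (x - (z + 1) - e) \<le> 2 * real k * \<mu>"
      using k by auto
    \<comment> \<open>The unit step from \<open>z\<close> to \<open>z + 1\<close> is not charged to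
      \<phi> but left out, so each cell adds one to the error \<open>e\<close>.\<close>
    have "x - y - (e + 1) = (x - (z + 1) - e) + (z - y)" by simp
    then have "\<phi> (x - y - (e + 1)) \<le> 2 * real k * \<mu> + 2 * \<mu>"
      using sub[of "x - (z + 1) - e" "z - y"] e zy by (simp only: )
    then have "\<phi> (x - y - (e + 1)) \<le> 2 * real (card D) * \<mu>"
      by (simp flip: Suc.hyps(2) add: algebra_simps)
    then show ?thesis using e by (intro bexI[of _ "e + 1"]) (auto simp flip: Suc.hyps(2))
  qed
qed

text \<open>Ruzsa's covering argument: take a largest \<open>D\<close> within \<open>[0, N]\<close>
  whose translates of \<open>P\<close> are disjoint. They fit into an interval, which bounds
  \<open>card D\<close>; by maximality \<open>z + P\<close> meets some \<open>c + P\<close>, which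
  puts \<open>z\<close> into \<open>c + P - P\<close>.\<close>

lemma maximal_disjoint_translates:
  fixes P :: "int set"
  assumes P: "P \<subseteq> {a..b}" "P \<noteq> {}"
  shows "\<exists>D. finite D \<and> card D * card P \<le> nat (b - a + 1) + N \<and>
    (\<forall>z\<in>{0..int N}. \<exists>c\<in>D. \<exists>u\<in>P. \<exists>v\<in>P. z = c + u - v)"
proof -
  have finP: "finite P" using P finite_subset by auto
  define Q where "Q D \<longleftrightarrow> D \<subseteq> {0..int N} \<and>
    (\<forall>c\<in>D. \<forall>d\<in>D. c \<noteq> d \<longrightarrow> ((+) c ` P) \<inter> ((+) d ` P) = {})" for D
  have bd: "\<forall>D. Q D \<longrightarrow> card D < N + 2"
  proof (intro allI impI)
    fix D assume "Q D"
    then have "card D \<le> card {0..int N}" unfolding Q_def by (intro card_mono) auto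
    then show "card D < N + 2" by simp
  qed
  have "Q {}" by (simp add: Q_def)
  then obtain D where D: "Q D" "\<And>D'. Q D' \<Longrightarrow> card D' \<le> card D"
    using ex_has_greatest_nat[OF \<open>Q {}\<close> bd] by blast
  have subD: "D \<subseteq> {0..int N}" and disD: "\<And>c d. c \<in> D \<Longrightarrow> d \<in> D \<Longrightarrow> c \<noteq> d \<Longrightarrow> ((+) c ` P) \<inter> ((+) d ` P) = {}"
    using D(1) unfolding Q_def by blast+
  have finD: "finite D" using subD finite_subset by blast
  have "card D * card P = (\<Sum>c\<in>D. card ((+) c ` P))" by (simp add: card_image)
  also have "\<dots> = card (\<Union>c\<in>D. (+) c ` P)"
    using disD finD finP by (intro card_UN_disjoint[symmetric]) simp_all
  also have "\<dots> \<le> card {a..b + int N}"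
  proof (intro card_mono)
    show "(\<Union>c\<in>D. (+) c ` P) \<subseteq> {a..b + int N}"
      using subD P(1) by fastforce
  qed auto
  also have "\<dots> \<le> nat (b - a + 1) + N" by auto
  finally have card: "card D * card P \<le> nat (b - a + 1) + N" .
  have "\<exists>c\<in>D. \<exists>u\<in>P. \<exists>v\<in>P. z = c + u - v" if z: "z \<in> {0..int N}" for z
  proof (rule ccontr)
    assume neg: "\<not> ?thesis"
    obtain u where u: "u \<in> P" using P(2) by blast
    have "z \<notin> D"
    proof
      assume "z \<in> D"
      moreover have "z = z + u - u" by simp
      ultimately show False using neg u by blast
    qed
    have dis: "((+) z ` P) \<inter> ((+) c ` P) = {}" if "c \<in> D" for c
    proof (rule ccontr)
      assume "((+) z ` P) \<inter> ((+) c ` P) \<noteq> {}"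
      then obtain u v where uv: "u \<in> P" "v \<in> P" "z + v = c + u" by blast
      then have "z = c + u - v" by simp
      then show False using neg that uv by blast
    qed
    have "Q (insert z D)"
      unfolding Q_def
    proof (intro conjI ballI impI)
      show "insert z D \<subseteq> {0..int N}" using z subD by blast
      fix c d assume cd: "c \<in> insert z D" "d \<in> insert z D" "c \<noteq> d"
      show "((+) c ` P) \<inter> ((+) d ` P) = {}"
      proof (cases "c = z")
        case True
        then show ?thesis using dis[of d] cd by blast
      next
        case False
        then show ?thesis using dis[of c] cd disD[of c d] by (cases "d = z") blast+
      qed
    qed
    then have "card (insert z D) \<le> card D" by (rule D(2))
    then show False using \<open>z \<notin> D\<close> finD by simp
  qed
  then show ?thesis using finD card by blast
qed

section \<open>Overlaps of two sets under a shift\<close>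

lemma card_filter_split:
  assumes "finite C" shows "card C = card {z\<in>C. Q z} + card {z\<in>C. \<not> Q z}"
proof -
  have "card ({z\<in>C. Q z} \<union> {z\<in>C. \<not> Q z}) = card {z\<in>C. Q z} + card {z\<in>C. \<not> Q z}"
    using assms by (intro card_Un_disjoint) auto
  moreover have "{z\<in>C. Q z} \<union> {z\<in>C. \<not> Q z} = C" by blast
  ultimately show ?thesis by simp
qed

definition overlap :: "int set \<Rightarrow> int set \<Rightarrow> int \<Rightarrow> nat" where
  "overlap B C x = card {y\<in>B. y + x \<in> C}"

lemma overlap_le:
  assumes "finite B" "finite C" shows "overlap B C x \<le> card B" "overlap B C x \<le> card C"
proof -
  show "overlap B C x \<le> card B" unfolding overlap_def using assms by (intro card_mono) auto
  have "card ((\<lambda>y. y + x) ` {y\<in>B. y + x \<in> C}) \<le> card C" using assms by (intro card_mono) auto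
  then show "overlap B C x \<le> card C" unfolding overlap_def by (simp add: card_image)
qed

lemma overlap_le_sqrt:
  assumes "finite B" "finite C"
  shows "real (overlap B C x) \<le> sqrt (real (card B) * real (card C))"
proof -
  have "real (overlap B C x) * real (overlap B C x) \<le> real (card B) * real (card C)"
    using overlap_le[OF assms, of x] by (intro mult_mono) auto
  then show ?thesis by (simp add: real_le_rsqrt power2_eq_square)
qed

text \<open>Differences of the shifts counted here are near-periods of \<open>C\<close>. If there were many such shifts, boundedly
  many differences would reach each \<open>x \<le> N\<close> up to a bounded error \<open>e\<close>, so some point of \<open>C\<close> would see the
  thickened \<open>C\<close> at half of the distances up to \<open>N\<close>.\<close>

lemma few_near_periods:
  assumes fin: "finite B" "finite C" and ne: "B \<noteq> {}" "C \<noteq> {}" and sp: "thick_sparse N l C"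
    and I: "real (card {a..b}) \<le> \<kappa> * real N" and "N \<ge> 1"
    and c: "0 < \<beta>" "0 < \<kappa>" "0 < \<theta>" "\<theta> \<le> 1/2" "(1 + \<kappa>) / \<beta> \<le> real l" "40 * (1 + \<kappa>) * \<theta> \<le> \<beta>"
  shows "real (card {x\<in>{a..b}. real (overlap B C x) \<ge> (1 - \<theta>) * sqrt (real (card B) * real (card C))}) < \<beta> * real N"
proof (rule ccontr)
  define P where "P = {x\<in>{a..b}. real (overlap B C x) \<ge> (1 - \<theta>) * sqrt (real (card B) * real (card C))}"
  assume "\<not> ?thesis"
  then have big: "\<beta> * real N \<le> real (card P)" by (simp add: P_def)
  have N: "real N > 0" using \<open>N \<ge> 1\<close> by simp
  have "0 < \<beta> * real N" using c N by simp
  with big have "real (card P) > 0" by linarith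
  then have neP: "P \<noteq> {}" by fastforce
  have subP: "P \<subseteq> {a..b}" unfolding P_def by blast
  define b0 where "b0 = real (card B)"
  define b1 where "b1 = real (card C)"
  have b: "b0 > 0" "b1 > 0" using fin ne by (auto simp: b0_def b1_def card_gt_0_iff)
  have Pr: "(1 - \<theta>) * sqrt (b0 * b1) \<le> real (overlap B C x)" if "x \<in> P" for x
    using that by (simp add: P_def b0_def b1_def)
  obtain x0 where x0: "x0 \<in> P" using neP by blast
  \<comment> \<open>A single shift with nearly full overlap forces \<open>B\<close> and
    \<open>C\<close> to have nearly equal sizes, since the overlap is at most the smaller of
    them.\<close>
  have bb: "(1 - \<theta>)\<^sup>2 * b1 \<le> b0" "(1 - \<theta>)\<^sup>2 * b0 \<le> b1"
  proof -
    have le: "(1 - \<theta>) * sqrt (b0 * b1) \<le> b0" "(1 - \<theta>) * sqrt (b0 * b1) \<le> b1"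
      using Pr[OF x0] overlap_le[OF fin, of x0] by (auto simp: b0_def b1_def)
    have "((1 - \<theta>) * sqrt (b0 * b1))\<^sup>2 \<le> b0\<^sup>2" "((1 - \<theta>) * sqrt (b0 * b1))\<^sup>2 \<le> b1\<^sup>2"
      using le c b by (auto intro!: power_mono)
    then have "((1 - \<theta>)\<^sup>2 * b1) * b0 \<le> b0 * b0" "((1 - \<theta>)\<^sup>2 * b0) * b1 \<le> b1 * b1"
      using b by (auto simp: power_mult_distrib power2_eq_square mult_ac)
    then show "(1 - \<theta>)\<^sup>2 * b1 \<le> b0" "(1 - \<theta>)\<^sup>2 * b0 \<le> b1" using b by auto
  qed
  have sq: "sqrt (b0 * b1) \<ge> (1 - \<theta>) * b1" "sqrt (b0 * b1) \<ge> (1 - \<theta>) * b0"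
  proof -
    have "((1 - \<theta>)\<^sup>2 * b1) * b1 \<le> b0 * b1" "((1 - \<theta>)\<^sup>2 * b0) * b0 \<le> b1 * b0"
      using bb b by (auto intro!: mult_right_mono)
    then show "sqrt (b0 * b1) \<ge> (1 - \<theta>) * b1" "sqrt (b0 * b1) \<ge> (1 - \<theta>) * b0"
      by (auto intro!: real_le_rsqrt simp: power_mult_distrib power2_eq_square mult_ac)
  qed
  have one: "1 - 2 * \<theta> \<le> (1 - \<theta>)\<^sup>2" by (simp add: power2_eq_square algebra_simps)
  have r: "b1 - real (overlap B C x) \<le> 2 * \<theta> * b1" "b0 - real (overlap B C x) \<le> 8 * \<theta> * b1" if "x \<in> P" for x
  proof -
    have ge: "real (overlap B C x) \<ge> (1 - \<theta>) * ((1 - \<theta>) * b1)" "real (overlap B C x) \<ge> (1 - \<theta>) * ((1 - \<theta>) * b0)"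
      using Pr[OF that] mult_left_mono[OF sq(1), of "1 - \<theta>"] mult_left_mono[OF sq(2), of "1 - \<theta>"] c
      by linarith+
    have le: "(1 - 2 * \<theta>) * b1 \<le> (1 - \<theta>)\<^sup>2 * b1" "(1 - 2 * \<theta>) * b0 \<le> (1 - \<theta>)\<^sup>2 * b0"
      using one b by (auto intro!: mult_right_mono)
    show "b1 - real (overlap B C x) \<le> 2 * \<theta> * b1" using ge le by (simp add: power2_eq_square algebra_simps)
    have "b0 - real (overlap B C x) \<le> 2 * \<theta> * b0" using ge le by (simp add: power2_eq_square algebra_simps)
    moreover have "b0 \<le> 4 * b1"
    proof -
      have "(1/2)\<^sup>2 \<le> (1 - \<theta>)\<^sup>2" using c by (intro power_mono) auto
      then have "(1/2)\<^sup>2 * b0 \<le> (1 - \<theta>)\<^sup>2 * b0" using b by (intro mult_right_mono) auto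
      then show ?thesis using bb by (simp add: power2_eq_square)
    qed
    then have "2 * \<theta> * b0 \<le> 2 * \<theta> * (4 * b1)" using c by (intro mult_left_mono) auto
    ultimately show "b0 - real (overlap B C x) \<le> 8 * \<theta> * b1" by simp
  qed
  \<comment> \<open>The part of \<open>C\<close> lost under a shift by \<open>d\<close>: subadditive
    in \<open>d\<close> and small at near-periods, as \<open>walk_through_cover\<close>
    requires.\<close>
  define \<phi> where "\<phi> d = real (card {z\<in>C. z - d \<notin> C})" for d
  have sub: "\<phi> (d + e) \<le> \<phi> d + \<phi> e" for d e
  proof -
    have "card {z\<in>C. z - (d + e) \<notin> C} \<le> card ({z\<in>C. z - d \<notin> C} \<union> (+) d ` {w\<in>C. w - e \<notin> C})"
    proof (intro card_mono subsetI)
      fix z assume z: "z \<in> {z\<in>C. z - (d + e) \<notin> C}"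
      show "z \<in> {z\<in>C. z - d \<notin> C} \<union> (+) d ` {w\<in>C. w - e \<notin> C}"
      proof (cases "z - d \<in> C")
        case True
        then have "z - d \<in> {w\<in>C. w - e \<notin> C}" using z by (simp add: algebra_simps)
        then have "d + (z - d) \<in> (+) d ` {w\<in>C. w - e \<notin> C}" by blast
        then show ?thesis by simp
      qed (use z in auto)
    qed (use fin in auto)
    also have "\<dots> \<le> card {z\<in>C. z - d \<notin> C} + card ((+) d ` {w\<in>C. w - e \<notin> C})" by (rule card_Un_le)
    also have "card ((+) d ` {w\<in>C. w - e \<notin> C}) = card {w\<in>C. w - e \<notin> C}" by (simp add: card_image)
    finally show ?thesis by (simp add: \<phi>_def)
  qed
  \<comment> \<open>Go from \<open>C\<close> back to \<open>B\<close> by \<open>u\<close> and on to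
    \<open>C\<close> by \<open>v\<close>; the losses \<open>2 * \<theta> * b1\<close> and
    \<open>8 * \<theta> * b1\<close> of the two moves add up.\<close>
  have diff: "\<phi> (u - v) \<le> 10 * \<theta> * b1" if "u \<in> P" "v \<in> P" for u v
  proof -
    have "card {z\<in>C. z - (u - v) \<notin> C} \<le> card ({z\<in>C. z - u \<notin> B} \<union> (+) u ` {y\<in>B. y + v \<notin> C})"
    proof (intro card_mono subsetI)
      fix z assume z: "z \<in> {z\<in>C. z - (u - v) \<notin> C}"
      show "z \<in> {z\<in>C. z - u \<notin> B} \<union> (+) u ` {y\<in>B. y + v \<notin> C}"
      proof (cases "z - u \<in> B")
        case True
        then have "z - u \<in> {y\<in>B. y + v \<notin> C}" using z by (simp add: algebra_simps)
        then have "u + (z - u) \<in> (+) u ` {y\<in>B. y + v \<notin> C}" by blast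
        then show ?thesis by simp
      qed (use z in auto)
    qed (use fin in auto)
    also have "\<dots> \<le> card {z\<in>C. z - u \<notin> B} + card ((+) u ` {y\<in>B. y + v \<notin> C})" by (rule card_Un_le)
    also have "card ((+) u ` {y\<in>B. y + v \<notin> C}) = card {y\<in>B. y + v \<notin> C}" by (simp add: card_image)
    finally have 1: "\<phi> (u - v) \<le> real (card {z\<in>C. z - u \<notin> B}) + real (card {y\<in>B. y + v \<notin> C})"
      by (simp add: \<phi>_def flip: of_nat_add)
    have "(+) u ` {y\<in>B. y + u \<in> C} = {z\<in>C. z - u \<in> B}"
      by (force simp: image_iff algebra_simps)
    then have "overlap B C u = card {z\<in>C. z - u \<in> B}"
      using card_image[of "(+) u" "{y\<in>B. y + u \<in> C}"] unfolding overlap_def by simp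
    moreover have "card C = card {z\<in>C. z - u \<in> B} + card {z\<in>C. z - u \<notin> B}"
      by (rule card_filter_split[OF fin(2)])
    ultimately have 2: "real (card {z\<in>C. z - u \<notin> B}) = b1 - real (overlap B C u)"
      by (simp add: b1_def)
    have "card B = card {y\<in>B. y + v \<in> C} + card {y\<in>B. y + v \<notin> C}"
      by (rule card_filter_split[OF fin(1)])
    then have 3: "real (card {y\<in>B. y + v \<notin> C}) = b0 - real (overlap B C v)"
      by (simp add: b0_def overlap_def)
    show ?thesis using 1 2 3 r(1)[OF that(1)] r(2)[OF that(2)] by (simp add: algebra_simps)
  qed
  obtain D where D: "finite D" "card D * card P \<le> nat (b - a + 1) + N"
    "\<And>z. z \<in> {0..int N} \<Longrightarrow> \<exists>c\<in>D. \<exists>u\<in>P. \<exists>v\<in>P. z = c + u - v"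
    using maximal_disjoint_translates[OF subP neP, of N] by blast
  have cardD: "real (card D) \<le> (1 + \<kappa>) / \<beta>"
  proof -
    have "real (card D) * (\<beta> * real N) \<le> real (card D) * real (card P)" using big by (intro mult_left_mono) auto
    also have "\<dots> = real (card D * card P)" by simp
    also have "\<dots> \<le> real (nat (b - a + 1) + N)" using D(2) by (simp only: of_nat_le_iff)
    also have "\<dots> \<le> (1 + \<kappa>) * real N" using I by (simp add: algebra_simps)
    finally have "(real (card D) * \<beta>) * real N \<le> (1 + \<kappa>) * real N" by (simp add: mult_ac)
    then have "real (card D) * \<beta> \<le> 1 + \<kappa>" using N by (simp only: mult_le_cancel_right_pos)
    then show ?thesis using c by (simp only: pos_le_divide_eq)
  qed
  have half: "b1 / 2 \<le> real (card {z\<in>C. \<exists>e\<in>{0..int l}. (z - x) + e \<in> C})" if x: "x \<in> {0..int N}" for x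
  proof -
    have "\<exists>e\<in>{0..int (card D)}. \<phi> (x - 0 - e) \<le> 2 * real (card D) * (10 * \<theta> * b1)"
      by (rule walk_through_cover[OF sub diff]) (use D x b c in auto)
    then obtain e where e: "e \<in> {0..int (card D)}" "\<phi> (x - e) \<le> 2 * real (card D) * (10 * \<theta> * b1)" by auto
    \<comment> \<open>The assumption \<open>40 * (1 + \<kappa>) * \<theta> \<le> \<beta>\<close> is
      made for this point: a walk through at most \<open>(1 + \<kappa>) / \<beta>\<close> cells
      loses at most half of \<open>C\<close>.\<close>
    have "2 * real (card D) * (10 * \<theta> * b1) \<le> 2 * ((1 + \<kappa>) / \<beta>) * (10 * \<theta> * b1)"
      using cardD c b by (intro mult_right_mono mult_left_mono) auto
    also have "\<dots> = (40 * (1 + \<kappa>) * \<theta>) / \<beta> * (b1 / 2)" using c by (simp add: field_simps)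
    also have "\<dots> \<le> 1 * (b1 / 2)" using c b by (intro mult_right_mono) auto
    finally have "\<phi> (x - e) \<le> b1 / 2" using e by simp
    moreover have "card C = card {z\<in>C. z - (x - e) \<in> C} + card {z\<in>C. z - (x - e) \<notin> C}"
      by (rule card_filter_split[OF fin(2)])
    ultimately have "b1 / 2 \<le> real (card {z\<in>C. z - (x - e) \<in> C})" by (simp add: \<phi>_def b1_def)
    also have "card {z\<in>C. z - (x - e) \<in> C} \<le> card {z\<in>C. \<exists>e\<in>{0..int l}. (z - x) + e \<in> C}"
    proof (intro card_mono subsetI)
      fix z assume z: "z \<in> {z\<in>C. z - (x - e) \<in> C}"
      have "real (card D) \<le> real l" using cardD c by simp
      then have "e \<in> {0..int l}" using e by auto
      moreover have "z - x + e = z - (x - e)" by simp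
      ultimately have "\<exists>e\<in>{0..int l}. (z - x) + e \<in> C" using z by (metis (mono_tags, lifting) mem_Collect_eq)
      then show "z \<in> {z\<in>C. \<exists>e\<in>{0..int l}. (z - x) + e \<in> C}" using z by simp
    qed (use fin in auto)
    finally show ?thesis by simp
  qed
  define th where "th w \<longleftrightarrow> (\<exists>e\<in>{0..int l}. w + e \<in> C)" for w
  have "(real N + 1) * (b1 / 2) = (\<Sum>x\<in>{0..int N}. b1 / 2)" by (simp add: algebra_simps)
  also have "\<dots> \<le> (\<Sum>x\<in>{0..int N}. real (card {z\<in>C. th (z - x)}))"
    unfolding th_def by (intro sum_mono half)
  also have "\<dots> = (\<Sum>x\<in>{0..int N}. \<Sum>z\<in>C. of_bool (th (z - x)))"
    using fin by (simp add: of_bool_def sum.If_cases Int_def)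
  also have "\<dots> = (\<Sum>z\<in>C. \<Sum>x\<in>{0..int N}. of_bool (th (z - x)))" by (rule sum.swap)
  also have "\<dots> < (\<Sum>z\<in>C. (real N + 1) / 2)"
  proof (rule sum_strict_mono)
    fix z assume "z \<in> C"
    have "(\<Sum>x\<in>{0..int N}. of_bool (th (z - x))) = (\<Sum>w\<in>{z - int N..z}. of_bool (th w) :: real)"
      by (rule sum.reindex_bij_witness[of _ "\<lambda>w. z - w" "\<lambda>x. z - x"]) auto
    also have "\<dots> = real (card {w\<in>{z - int N..z}. th w})"
      by (simp add: of_bool_def sum.If_cases Int_def)
    also have "\<dots> < (real N + 1) / 2"
    proof -
      have "2 * card {w\<in>{z - int N..z}. th w} < N + 1"
        using sp unfolding thick_sparse_def th_def by blast
      then have "real (2 * card {w\<in>{z - int N..z}. th w}) < real (N + 1)" by (simp only: of_nat_less_iff)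
      then show ?thesis by simp
    qed
    finally show "(\<Sum>x\<in>{0..int N}. of_bool (th (z - x))) < (real N + 1) / 2" .
  qed (use fin ne in auto)
  finally show False by (simp add: b1_def)
qed

text \<open>Shifts of nearly full overlap are fewer than \<open>\<beta> * N\<close>. All others, at
  most \<open>\<kappa> * N\<close> in number, carry the factor
  \<open>(1 - \<theta>) ^ (2 * k)\<close>, and \<open>k\<close> is large enough for them to
  contribute no more than another \<open>\<beta> * N\<close>.\<close>

lemma overlap_moment:
  assumes fin: "finite B" "finite C" and sp: "thick_sparse N l C"
    and I: "real (card {a..b}) \<le> \<kappa> * real N" and "N \<ge> 1"
    and c: "0 < \<beta>" "0 < \<kappa>" "0 < \<theta>" "\<theta> \<le> 1/2" "(1 + \<kappa>) / \<beta> \<le> real l" "40 * (1 + \<kappa>) * \<theta> \<le> \<beta>"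
    and k: "0 < k" "\<kappa> * (1 - \<theta>) ^ (2 * k) \<le> \<beta>"
  shows "(\<Sum>x\<in>{a..b}. real (overlap B C x) ^ (2 * k)) \<le> 2 * \<beta> * real N * (real (card B) ^ k * real (card C) ^ k)"
proof (cases "B = {} \<or> C = {}")
  case True
  then have "overlap B C x = 0" for x by (auto simp: overlap_def)
  then show ?thesis using k True by (auto simp: power_0_left)
next
  case False
  let ?s = "sqrt (real (card B) * real (card C))"
  let ?P = "{x\<in>{a..b}. real (overlap B C x) \<ge> (1 - \<theta>) * ?s}"
  have s: "?s ^ (2 * k) = real (card B) ^ k * real (card C) ^ k"
    by (simp add: power_mult power_mult_distrib)
  have each: "real (overlap B C x) ^ (2 * k) \<le> (if x \<in> ?P then ?s ^ (2 * k) else 0) + (1 - \<theta>) ^ (2 * k) * ?s ^ (2 * k)"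
    if "x \<in> {a..b}" for x
  proof (cases "x \<in> ?P")
    case True
    have "real (overlap B C x) ^ (2 * k) \<le> ?s ^ (2 * k)" by (intro power_mono overlap_le_sqrt fin) auto
    moreover have "0 \<le> (1 - \<theta>) ^ (2 * k) * ?s ^ (2 * k)" using c by (intro mult_nonneg_nonneg) auto
    ultimately have "real (overlap B C x) ^ (2 * k) \<le> ?s ^ (2 * k) + (1 - \<theta>) ^ (2 * k) * ?s ^ (2 * k)"
      by linarith
    then show ?thesis using True by (simp only: if_True)
  next
    case False
    then have "real (overlap B C x) ^ (2 * k) \<le> ((1 - \<theta>) * ?s) ^ (2 * k)"
      using that by (intro power_mono) auto
    then show ?thesis using False by (simp only: if_False power_mult_distrib add_0_left)
  qed
  have "(\<Sum>x\<in>{a..b}. real (overlap B C x) ^ (2 * k))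
     \<le> (\<Sum>x\<in>{a..b}. (if x \<in> ?P then ?s ^ (2 * k) else 0) + (1 - \<theta>) ^ (2 * k) * ?s ^ (2 * k))"
    by (intro sum_mono each)
  also have "\<dots> = real (card ?P) * ?s ^ (2 * k) + real (card {a..b}) * ((1 - \<theta>) ^ (2 * k) * ?s ^ (2 * k))"
  proof -
    have "(\<Sum>x\<in>{a..b}. if x \<in> ?P then ?s ^ (2 * k) else 0) = real (card ?P) * ?s ^ (2 * k)"
      by (subst sum.mono_neutral_cong_right[of _ ?P _ "\<lambda>_. ?s ^ (2 * k)"]) auto
    then show ?thesis by (simp add: sum.distrib)
  qed
  also have "\<dots> \<le> (\<beta> * real N) * ?s ^ (2 * k) + (\<kappa> * real N) * ((1 - \<theta>) ^ (2 * k) * ?s ^ (2 * k))"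
    using few_near_periods[OF fin _ _ sp I \<open>N \<ge> 1\<close> c] False I c
    by (intro add_mono mult_right_mono) auto
  also have "\<dots> = (\<beta> + \<kappa> * (1 - \<theta>) ^ (2 * k)) * (real N * ?s ^ (2 * k))" by (simp add: algebra_simps)
  also have "\<dots> \<le> (\<beta> + \<beta>) * (real N * ?s ^ (2 * k))"
    using k(2) by (intro mult_right_mono) auto
  finally show ?thesis unfolding s by (simp add: mult_ac)
qed

lemma overlap_first_moment:
  assumes "finite B" "finite C" "finite I"
  shows "(\<Sum>x\<in>I. overlap B C x) \<le> card B * card C"
proof -
  have "(\<Sum>x\<in>I. overlap B C x) = card (SIGMA x:I. {y\<in>B. y + x \<in> C})"
    unfolding overlap_def using assms by simp
  also have "\<dots> \<le> card (B \<times> C)"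
    by (rule card_inj_on_le[of "\<lambda>(x, y). (y, y + x)"]) (use assms in \<open>auto simp: inj_on_def\<close>)
  finally show ?thesis by (simp add: card_cartesian_product)
qed

section \<open>Counting cubes\<close>

text \<open>The vertex \<open>u\<close> of a cube gets its own target set \<open>\<B> u\<close>: the two halves of an \<open>A i\<close> may be
  far apart, so different vertices look at unrelated parts of the line.\<close>

definition merge :: "(bool list \<Rightarrow> int set) \<Rightarrow> int \<Rightarrow> bool list \<Rightarrow> int set" where
  "merge \<B> x u = {y \<in> \<B> (False # u). y + x \<in> \<B> (True # u)}"

text \<open>The geometric mean of \<open>2 ^ k\<close> cardinalities, taken along the binary tree of
  vertices so that Cauchy-Schwarz can be applied one level at a time.\<close>

fun gmean :: "nat \<Rightarrow> (bool list \<Rightarrow> int set) \<Rightarrow> real" where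
  "gmean 0 \<B> = real (card (\<B> []))"
| "gmean (Suc k) \<B> = sqrt (gmean k (\<lambda>u. \<B> (False # u)) * gmean k (\<lambda>u. \<B> (True # u)))"

text \<open>Counts cubes, with roots and steps both varying, whose vertices lie in their respective
  sets. The normalisation by \<open>N\<close> instead of \<open>card I\<close> matches
  \<open>interval_mean\<close>.\<close>

fun cube_count :: "nat \<Rightarrow> int set list \<Rightarrow> (bool list \<Rightarrow> int set) \<Rightarrow> real" where
  "cube_count N [] \<B> = real (card (\<B> []))"
| "cube_count N (I # Is) \<B> = (\<Sum>x\<in>I. cube_count N Is (merge \<B> x)) / real N"

lemma gmean_nonneg: "0 \<le> gmean k \<B>"
  by (induction k arbitrary: \<B>) auto

lemma gmean_le:
  assumes "\<And>u. length u = k \<Longrightarrow> real (card (\<B> u)) \<le> b"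
  shows "gmean k \<B> \<le> b"
  using assms
proof (induction k arbitrary: \<B>)
  case (Suc k)
  let ?x = "gmean k (\<lambda>u. \<B> (False # u))" and ?y = "gmean k (\<lambda>u. \<B> (True # u))"
  have le: "?x \<le> b" "?y \<le> b" using Suc.prems by (auto intro!: Suc.IH)
  have "?x * ?y \<le> b * b" using le gmean_nonneg[of k] by (intro mult_mono) (auto intro: order_trans)
  then have "sqrt (?x * ?y) \<le> sqrt (b * b)" by (rule real_sqrt_le_mono)
  moreover have "0 \<le> b" using le gmean_nonneg order_trans by blast
  ultimately show ?case by simp
qed simp

text \<open>Hoelder's inequality for \<open>2 ^ k\<close> functions, as one Cauchy-Schwarz per level
  of the tree. A moment bound for single pairs of sets thus passes to whole families with the same
  constant.\<close>

lemma gmean_holder: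
  assumes "\<And>u. length u = k \<Longrightarrow>
      (\<Sum>x\<in>I. real (card (\<F> x u)) ^ e) \<le> c * (real (card (\<A> u)) ^ f * real (card (\<C> u)) ^ f)"
    and "0 \<le> c"
  shows "(\<Sum>x\<in>I. gmean k (\<F> x) ^ e) \<le> c * (gmean k \<A> ^ f * gmean k \<C> ^ f)"
  using assms
proof (induction k arbitrary: \<F> \<A> \<C>)
  case (Suc k)
  define \<alpha> where "\<alpha> x = gmean k (\<lambda>u. \<F> x (False # u))" for x
  define \<beta> where "\<beta> x = gmean k (\<lambda>u. \<F> x (True # u))" for x
  let ?A0 = "gmean k (\<lambda>u. \<A> (False # u))" and ?A1 = "gmean k (\<lambda>u. \<A> (True # u))"
  let ?C0 = "gmean k (\<lambda>u. \<C> (False # u))" and ?C1 = "gmean k (\<lambda>u. \<C> (True # u))"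
  have nn: "0 \<le> \<alpha> x" "0 \<le> \<beta> x" for x by (auto simp: \<alpha>_def \<beta>_def gmean_nonneg)
  have I0: "(\<Sum>x\<in>I. \<alpha> x ^ e) \<le> c * (?A0 ^ f * ?C0 ^ f)"
    unfolding \<alpha>_def by (rule Suc.IH[of "\<lambda>x u. \<F> x (False # u)"]) (use Suc.prems in auto)
  have I1: "(\<Sum>x\<in>I. \<beta> x ^ e) \<le> c * (?A1 ^ f * ?C1 ^ f)"
    unfolding \<beta>_def by (rule Suc.IH[of "\<lambda>x u. \<F> x (True # u)"]) (use Suc.prems in auto)
  have "(\<Sum>x\<in>I. gmean (Suc k) (\<F> x) ^ e) = (\<Sum>x\<in>I. sqrt (\<alpha> x ^ e) * sqrt (\<beta> x ^ e))"
    by (simp add: \<alpha>_def \<beta>_def real_sqrt_mult power_mult_distrib real_sqrt_power)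
  also have "\<dots> \<le> sqrt (\<Sum>x\<in>I. \<alpha> x ^ e) * sqrt (\<Sum>x\<in>I. \<beta> x ^ e)"
    using L2_set_mult_ineq[of "\<lambda>x. sqrt (\<alpha> x ^ e)" "\<lambda>x. sqrt (\<beta> x ^ e)" I] nn
    by (simp add: L2_set_def)
  also have "\<dots> \<le> sqrt (c * (?A0 ^ f * ?C0 ^ f)) * sqrt (c * (?A1 ^ f * ?C1 ^ f))"
    by (intro mult_mono real_sqrt_le_mono I0 I1 real_sqrt_ge_zero sum_nonneg zero_le_power nn mult_nonneg_nonneg gmean_nonneg Suc.prems)
  also have "\<dots> = c * (sqrt (?A0 * ?A1) ^ f * sqrt (?C0 * ?C1) ^ f)"
    using \<open>0 \<le> c\<close> by (simp add: real_sqrt_mult real_sqrt_power power_mult_distrib mult_ac)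
  finally show ?case by simp
qed simp

lemma cube_count_mono:
  assumes "\<And>u. length u = length Is \<Longrightarrow> \<B> u \<subseteq> \<C> u" "\<And>u. length u = length Is \<Longrightarrow> finite (\<C> u)"
  shows "cube_count N Is \<B> \<le> cube_count N Is \<C>"
  using assms
proof (induction Is arbitrary: \<B> \<C>)
  case Nil
  then show ?case by (simp add: card_mono)
next
  case (Cons I Is)
  have "cube_count N Is (merge \<B> x) \<le> cube_count N Is (merge \<C> x)" for x
  proof (rule Cons.IH)
    fix u :: "bool list" assume u: "length u = length Is"
    show "merge \<B> x u \<subseteq> merge \<C> x u"
      using Cons.prems(1)[of "False # u"] Cons.prems(1)[of "True # u"] u unfolding merge_def by auto
    show "finite (merge \<C> x u)" using Cons.prems(2)[of "False # u"] u unfolding merge_def by auto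
  qed
  then show ?case by (auto intro!: divide_right_mono sum_mono)
qed

text \<open>The linear term of the bound starts the induction; the power \<open>2 * a\<close> absorbs the first moment \<open>z\<^sup>2\<close> when
  the density \<open>z\<close> is not small, where only high moments of the overlaps decay.\<close>

lemma cube_count_le:
  fixes \<tau> \<sigma> :: real
  assumes mom: "\<And>I B C. I \<in> set Is \<Longrightarrow> finite B \<Longrightarrow> finite C \<Longrightarrow> thick_sparse N l C \<Longrightarrow>
      (\<Sum>x\<in>I. real (overlap B C x) ^ (2 * a)) \<le> \<tau> / 2 * real N * (real (card B) ^ a * real (card C) ^ a)"
    and fin: "\<And>I. I \<in> set Is \<Longrightarrow> finite I" and "N \<ge> 1" "0 < \<tau>" "1 \<le> a"
    and \<sigma>: "\<sigma> = 2 * \<tau> / \<tau> ^ (2 * a)"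
    and "\<And>u. length u = length Is \<Longrightarrow> finite (\<B> u) \<and> thick_sparse N l (\<B> u)"
  shows "cube_count N Is \<B> \<le> \<tau> ^ length Is * real N *
     (gmean (length Is) \<B> / real N + \<sigma> * (gmean (length Is) \<B> / real N) ^ (2 * a))"
  using assms(1,2,7)
proof (induction Is arbitrary: \<B>)
  case Nil
  have "0 \<le> \<sigma>" using \<sigma> \<open>0 < \<tau>\<close> by simp
  then show ?case using \<open>N \<ge> 1\<close> by (simp add: distrib_left)
next
  case (Cons I Is)
  have N: "real N > 0" using \<open>N \<ge> 1\<close> by simp
  have \<sigma>0: "0 \<le> \<sigma>" using \<sigma> \<open>0 < \<tau>\<close> by simp
  let ?k = "length Is"
  let ?B0 = "\<lambda>u. \<B> (False # u)" and ?B1 = "\<lambda>u. \<B> (True # u)"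
  define z where "z = gmean (Suc ?k) \<B> / real N"
  define y where "y x = gmean ?k (merge \<B> x) / real N" for x
  have z0: "0 \<le> z" by (simp only: z_def gmean_nonneg divide_nonneg_nonneg of_nat_0_le_iff)
  have zz: "gmean ?k ?B0 * gmean ?k ?B1 = (real N * z)\<^sup>2"
    using N gmean_nonneg[of ?k] by (simp add: z_def)
  have fB: "finite (\<B> (b # u))" "thick_sparse N l (\<B> (b # u))" if "length u = ?k" for b u
    using Cons.prems(3)[of "b # u"] that by auto
  have sub: "merge \<B> x u \<subseteq> \<B> (False # u)" for x u by (auto simp: merge_def)
  have card_merge: "card (merge \<B> x u) = overlap (?B0 u) (?B1 u) x" for x u
    by (simp add: merge_def overlap_def)
  have IH: "cube_count N Is (merge \<B> x) \<le> \<tau> ^ ?k * real N * (y x + \<sigma> * y x ^ (2 * a))" for x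
    unfolding y_def
  proof (rule Cons.IH)
    fix u :: "bool list" assume "length u = ?k"
    then show "finite (merge \<B> x u) \<and> thick_sparse N l (merge \<B> x u)"
      using fB sub finite_subset thick_sparse_subset by meson
  qed (use Cons.prems in auto)
  have "(\<Sum>x\<in>I. gmean ?k (merge \<B> x) ^ 1) \<le> 1 * (gmean ?k ?B0 ^ 1 * gmean ?k ?B1 ^ 1)"
  proof (rule gmean_holder)
    fix u :: "bool list" assume u: "length u = ?k"
    have "real (\<Sum>x\<in>I. overlap (?B0 u) (?B1 u) x) \<le> real (card (?B0 u) * card (?B1 u))"
      using overlap_first_moment[of "?B0 u" "?B1 u" I] fB[OF u] Cons.prems(2)[of I] by (simp only: of_nat_le_iff) simp
    then show "(\<Sum>x\<in>I. real (card (merge \<B> x u)) ^ 1) \<le> 1 * (real (card (?B0 u)) ^ 1 * real (card (?B1 u)) ^ 1)"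
      by (simp add: card_merge)
  qed simp
  then have "(\<Sum>x\<in>I. gmean ?k (merge \<B> x)) \<le> (real N * z)\<^sup>2" using zz by simp
  then have first: "(\<Sum>x\<in>I. y x) \<le> real N * z\<^sup>2"
    using N by (simp add: y_def field_simps power2_eq_square flip: sum_divide_distrib)
  have "(\<Sum>x\<in>I. gmean ?k (merge \<B> x) ^ (2 * a)) \<le> (\<tau> / 2 * real N) * (gmean ?k ?B0 ^ a * gmean ?k ?B1 ^ a)"
  proof (rule gmean_holder)
    fix u :: "bool list" assume u: "length u = ?k"
    show "(\<Sum>x\<in>I. real (card (merge \<B> x u)) ^ (2 * a)) \<le> (\<tau> / 2 * real N) * (real (card (?B0 u)) ^ a * real (card (?B1 u)) ^ a)"
      unfolding card_merge by (rule Cons.prems(1)) (use fB[OF u] in auto)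
  qed (use \<open>0 < \<tau>\<close> in simp)
  also have "gmean ?k ?B0 ^ a * gmean ?k ?B1 ^ a = (real N * z) ^ (2 * a)"
    by (simp only: zz power_mult flip: power_mult_distrib)
  finally have "(\<Sum>x\<in>I. gmean ?k (merge \<B> x) ^ (2 * a)) / real N ^ (2 * a) \<le> \<tau> / 2 * real N * z ^ (2 * a)"
    using N by (simp add: divide_le_eq power_mult_distrib mult_ac)
  then have second: "(\<Sum>x\<in>I. y x ^ (2 * a)) \<le> \<tau> / 2 * real N * z ^ (2 * a)"
    by (simp add: y_def power_divide flip: sum_divide_distrib)
  \<comment> \<open>Below \<tau> the linear term suffices. Above it, \<sigma> is chosen so that
    \<open>\<sigma> * (\<tau> / 2)\<close> equals \<open>1 / \<tau> ^ (2 * a - 2)\<close>, which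
    makes the high power dominate \<open>z\<^sup>2\<close>. This uses half of
    \<open>\<sigma> * \<tau>\<close>; the moment bound \<open>second\<close> uses the other
    half.\<close>
  have key: "z\<^sup>2 \<le> \<tau> * z + \<sigma> * (\<tau> / 2) * z ^ (2 * a)"
  proof (cases "z \<le> \<tau>")
    case True
    then have "z\<^sup>2 \<le> \<tau> * z" using z0 by (simp add: power2_eq_square mult_right_mono)
    moreover have "0 \<le> \<sigma> * (\<tau> / 2) * z ^ (2 * a)" using \<sigma>0 \<open>0 < \<tau>\<close> z0 by simp
    ultimately show ?thesis by linarith
  next
    case False
    have "2 * a = (2 * a - 2) + 2" using \<open>1 \<le> a\<close> by simp
    then have pw: "w ^ (2 * a) = w ^ (2 * a - 2) * w\<^sup>2" for w :: real by (metis power_add)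
    have "\<tau> ^ (2 * a - 2) \<le> z ^ (2 * a - 2)" using False \<open>0 < \<tau>\<close> by (intro power_mono) auto
    then have "\<tau> ^ (2 * a - 2) * z\<^sup>2 \<le> z ^ (2 * a)" unfolding pw[of z] by (intro mult_right_mono) auto
    moreover have "\<sigma> * (\<tau> / 2) = 1 / \<tau> ^ (2 * a - 2)"
      using \<open>0 < \<tau>\<close> unfolding \<sigma> pw[of \<tau>] by (simp add: power2_eq_square)
    moreover have "z\<^sup>2 = (1 / \<tau> ^ (2 * a - 2)) * (\<tau> ^ (2 * a - 2) * z\<^sup>2)" using \<open>0 < \<tau>\<close> by simp
    ultimately have "z\<^sup>2 \<le> \<sigma> * (\<tau> / 2) * z ^ (2 * a)"
      using \<open>0 < \<tau>\<close> mult_left_mono[of "\<tau> ^ (2 * a - 2) * z\<^sup>2" "z ^ (2 * a)" "1 / \<tau> ^ (2 * a - 2)"]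
      by (metis less_imp_le zero_le_divide_1_iff zero_le_power)
    moreover have "0 \<le> \<tau> * z" using z0 \<open>0 < \<tau>\<close> by simp
    ultimately show ?thesis by linarith
  qed
  have "cube_count N (I # Is) \<B> \<le> (\<Sum>x\<in>I. \<tau> ^ ?k * real N * (y x + \<sigma> * y x ^ (2 * a))) / real N"
    by (auto intro!: divide_right_mono sum_mono IH)
  also have "\<dots> = \<tau> ^ ?k * ((\<Sum>x\<in>I. y x) + \<sigma> * (\<Sum>x\<in>I. y x ^ (2 * a)))"
    using N by (simp add: sum.distrib flip: sum_distrib_left)
  also have "\<dots> \<le> \<tau> ^ ?k * (real N * z\<^sup>2 + \<sigma> * (\<tau> / 2 * real N * z ^ (2 * a)))"
    using first second \<sigma>0 \<open>0 < \<tau>\<close> by (intro mult_left_mono add_mono) auto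
  also have "\<dots> = \<tau> ^ ?k * real N * (z\<^sup>2 + \<sigma> * (\<tau> / 2) * z ^ (2 * a))" by (simp add: algebra_simps)
  also have "\<dots> \<le> \<tau> ^ ?k * real N * ((\<tau> * z + \<sigma> * (\<tau> / 2) * z ^ (2 * a)) + \<sigma> * (\<tau> / 2) * z ^ (2 * a))"
    using key \<open>0 < \<tau>\<close> by (intro mult_left_mono) auto
  also have "\<dots> = \<tau> ^ length (I # Is) * real N * (z + \<sigma> * z ^ (2 * a))" by (simp add: algebra_simps)
  finally show ?case by (simp only: z_def list.size(4) One_nat_def add_Suc_right add_0_right)
qed

section \<open>Cubes of subset sums and the ranges of their vertices\<close>

fun cube_in :: "int set \<Rightarrow> int list \<Rightarrow> int \<Rightarrow> bool" where
  "cube_in B [] t \<longleftrightarrow> t \<in> B"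
| "cube_in B (x # xs) t \<longleftrightarrow> cube_in B xs t \<and> cube_in B xs (t + x)"

text \<open>A step can be absorbed into the target set instead of splitting the root, which is how
  \<open>merge\<close> consumes it.\<close>

lemma cube_in_Cons: "cube_in B (x # xs) t \<longleftrightarrow> cube_in {z\<in>B. z + x \<in> B} xs t"
proof -
  have "cube_in {z\<in>B. z + x \<in> B} xs t \<longleftrightarrow> cube_in B xs t \<and> cube_in B xs (t + x)"
    by (induction xs arbitrary: t) (auto simp: add_ac)
  then show ?thesis by simp
qed

text \<open>The places that vertex \<open>u\<close> can reach from roots in \<open>V\<close>. The
  ranges of different vertices may be far apart, but each has bounded length, and this bounds the
  densities in \<open>cube_count_le\<close>.\<close>

fun vertex_range :: "int set \<Rightarrow> int set list \<Rightarrow> bool list \<Rightarrow> int set" where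
  "vertex_range V (I # Is) (b # u) = vertex_range (if b then (\<lambda>(v, x). v + x) ` (V \<times> I) else V) Is u"
| "vertex_range V _ _ = V"

lemma vertex_range_add:
  assumes "z \<in> vertex_range V Is u" "x \<in> I"
  shows "z + x \<in> vertex_range ((\<lambda>(v, x). v + x) ` (V \<times> I)) Is u"
proof -
  have "z + x \<in> vertex_range W Is u"
    if "z \<in> vertex_range V Is u" "\<And>v. v \<in> V \<Longrightarrow> v + x \<in> W" for V W
    using that
  proof (induction V Is u arbitrary: W rule: vertex_range.induct)
    case (1 V J Is b u)
    let ?f = "\<lambda>S. if b then (\<lambda>(v, x). v + x) ` (S \<times> J) else S"
    have "z + x \<in> vertex_range (?f W) Is u"
    proof (rule "1.IH")
      show "z \<in> vertex_range (?f V) Is u" using "1.prems"(1) by simp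
      fix v assume v: "v \<in> ?f V"
      show "v + x \<in> ?f W"
      proof (cases b)
        case True
        then obtain v' j where vj: "v' \<in> V" "j \<in> J" "v = v' + j" using v by auto
        have "(v' + x, j) \<in> W \<times> J" using "1.prems"(2) vj by blast
        moreover have "v + x = (\<lambda>(v, x). v + x) (v' + x, j)" using vj by simp
        ultimately have "v + x \<in> (\<lambda>(v, x). v + x) ` (W \<times> J)" by (rule rev_image_eqI)
        with True show ?thesis by (simp only: if_True)
      next
        case False
        then show ?thesis using v "1.prems"(2) by (simp only: if_False)
      qed
    qed
    then show ?case by (simp only: vertex_range.simps)
  qed simp_all
  note * = this
  show ?thesis
  proof (rule *[OF assms(1)])
    fix v assume "v \<in> V"
    then have "(v, x) \<in> V \<times> I" using assms(2) by blast
    then show "v + x \<in> (\<lambda>(v, x). v + x) ` (V \<times> I)" by (rule rev_image_eqI) simp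
  qed
qed

lemma vertex_range_subset:
  assumes "V \<subseteq> {a..a + h}" "\<And>I. I \<in> set Is \<Longrightarrow> \<exists>c. I \<subseteq> {c..c + h}" "0 \<le> h"
  shows "\<exists>c. vertex_range V Is u \<subseteq> {c..c + int (length Is + 1) * h}"
proof -
  \<comment> \<open>Every \<open>True\<close> in \<open>u\<close> replaces \<open>V\<close> by a
    sumset with a further interval, so the induction has to allow base sets of length
    \<open>k * h\<close>.\<close>
  have "\<exists>c. vertex_range V Is u \<subseteq> {c..c + int (length Is + k) * h}" if "V \<subseteq> {a..a + int k * h}" for a k
    using that assms(2)
  proof (induction Is arbitrary: V u a k)
    case (Cons I Is)
    obtain c where c: "I \<subseteq> {c..c + h}" using Cons.prems(2)[of I] by auto
    show ?case
    proof (cases u)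
      case Nil
      have "{a..a + int k * h} \<subseteq> {a..a + int (length (I # Is) + k) * h}"
        using \<open>0 \<le> h\<close> by (auto simp: algebra_simps intro: order_trans)
      then show ?thesis using Cons.prems(1) Nil by (intro exI[of _ a]) auto
    next
      case u: (Cons b u')
      define V' where "V' = (if b then (\<lambda>(v, x). v + x) ` (V \<times> I) else V)"
      have "\<exists>a'. V' \<subseteq> {a'..a' + int (k + 1) * h}"
      proof (cases b)
        case True
        have "V' \<subseteq> {(a + c)..(a + c) + int (k + 1) * h}"
        proof
          fix w assume "w \<in> V'"
          then obtain v x where vx: "v \<in> V" "x \<in> I" "w = v + x" using True by (auto simp: V'_def)
          then have "a \<le> v" "v \<le> a + int k * h" "c \<le> x" "x \<le> c + h" using Cons.prems(1) c by auto
          then show "w \<in> {(a + c)..(a + c) + int (k + 1) * h}" using vx by (simp add: algebra_simps)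
        qed
        then show ?thesis by blast
      next
        case False
        have "V \<subseteq> {a..a + int (k + 1) * h}"
          using Cons.prems(1) \<open>0 \<le> h\<close> by (auto simp: algebra_simps intro: order_trans)
        then show ?thesis using False V'_def by auto
      qed
      then obtain a' where "V' \<subseteq> {a'..a' + int (k + 1) * h}" by blast
      then have "\<exists>c. vertex_range V' Is u' \<subseteq> {c..c + int (length Is + (k + 1)) * h}"
        by (rule Cons.IH) (use Cons.prems in auto)
      then show ?thesis using u by (simp add: V'_def)
    qed
  next
    case Nil
    then show ?case by auto
  qed
  from this[of a 1] assms(1) show ?thesis by simp
qed

fun interval_mean :: "nat \<Rightarrow> int set list \<Rightarrow> (int list \<Rightarrow> real) \<Rightarrow> real" where
  "interval_mean N [] F = F []"
| "interval_mean N (I # Is) F = (\<Sum>x\<in>I. interval_mean N Is (\<lambda>xs. F (x # xs))) / real N"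

lemma interval_mean_sum:
  "finite S \<Longrightarrow> interval_mean N Is (\<lambda>xs. \<Sum>i\<in>S. F i xs) = (\<Sum>i\<in>S. interval_mean N Is (F i))"
proof (induction Is arbitrary: F)
  case (Cons I Is)
  then show ?case
    by (simp add: sum_divide_distrib) (rule sum.swap)
qed simp

lemma interval_mean_divide: "interval_mean N Is (\<lambda>xs. F xs / c) = interval_mean N Is F / c"
  by (induction Is arbitrary: F) (simp_all add: sum_divide_distrib mult.commute)

text \<open>As \<open>card A\<close> is at least \<open>2 * N\<close>, the mean over
  \<open>I \<union> J\<close> is at most the average of the sums over \<open>I\<close> and over
  \<open>J\<close>, each divided by \<open>N\<close>. So a bound that holds for every choice of one
  interval per step suffices.\<close>

lemma mean_list_le_interval_mean:
  assumes "\<And>A. A \<in> set As \<Longrightarrow> \<exists>I J. A = I \<union> J \<and> G I \<and> G J \<and> finite A \<and> 2 * N \<le> card A"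
    and "N \<ge> 1" "\<And>xs. 0 \<le> F xs"
    and "\<And>Is. length Is = length As \<Longrightarrow> (\<And>I. I \<in> set Is \<Longrightarrow> G I) \<Longrightarrow> interval_mean N Is F \<le> c"
  shows "mean_list As F \<le> c"
  using assms(1,3,4)
proof (induction As arbitrary: F)
  case Nil
  then show ?case using Nil(3)[of "[]"] by simp
next
  case (Cons A As)
  obtain I J where A: "A = I \<union> J" "G I" "G J" "finite A" "2 * N \<le> card A" using Cons.prems(1)[of A] by auto
  have cA: "2 * real N \<le> real (card A)" "real N > 0" using A(5) \<open>N \<ge> 1\<close> by linarith+
  have fin: "finite I" "finite J" using A by auto
  \<comment> \<open>The bound \<open>c\<close> is known for complete choices of intervals, not for a
    single value \<open>x\<close> of the first step. Hence the first step is averaged before the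
    induction hypothesis is applied.\<close>
  have part: "(\<Sum>x\<in>H. mean_list As (\<lambda>xs. F (x # xs))) / real N \<le> c" if H: "finite H" "G H" for H
  proof -
    have "(\<Sum>x\<in>H. mean_list As (\<lambda>xs. F (x # xs))) / real N = mean_list As (\<lambda>xs. (\<Sum>x\<in>H. F (x # xs)) / real N)"
      using mean_list_cmult[of As "1 / real N" "\<lambda>xs. \<Sum>x\<in>H. F (x # xs)"] H by (simp add: mean_list_sum)
    also have "\<dots> \<le> c"
    proof (rule Cons.IH)
      fix Is :: "int set list" assume Is: "length Is = length As" "\<And>I. I \<in> set Is \<Longrightarrow> G I"
      have "interval_mean N Is (\<lambda>xs. (\<Sum>x\<in>H. F (x # xs)) / real N) = interval_mean N (H # Is) F"
        using H by (simp add: interval_mean_divide interval_mean_sum)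
      also have "\<dots> \<le> c" by (rule Cons.prems(3)) (use Is H in auto)
      finally show "interval_mean N Is (\<lambda>xs. (\<Sum>x\<in>H. F (x # xs)) / real N) \<le> c" .
    qed (use Cons.prems in \<open>auto intro!: divide_nonneg_nonneg sum_nonneg\<close>)
    finally show ?thesis .
  qed
  define M where "M x = mean_list As (\<lambda>xs. F (x # xs))" for x
  have M0: "0 \<le> M x" for x unfolding M_def by (intro mean_list_nonneg Cons.prems)
  have "(\<Sum>x\<in>A. M x) \<le> (\<Sum>x\<in>I. M x) + (\<Sum>x\<in>J. M x)"
  proof -
    have "0 \<le> sum M (I \<inter> J)" by (intro sum_nonneg M0)
    then show ?thesis unfolding A(1) using sum.union_inter[OF fin, of M] by linarith
  qed
  also have "\<dots> \<le> c * real N + c * real N"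
    using part[OF fin(1) A(2)] part[OF fin(2) A(3)] cA unfolding M_def by (intro add_mono) (simp_all add: pos_divide_le_eq)
  also have "\<dots> = c * (2 * real N)" by simp
  also have "\<dots> \<le> c * real (card A)"
  proof (intro mult_left_mono cA)
    have "0 \<le> (\<Sum>x\<in>I. M x) / real N" using M0 by (intro divide_nonneg_nonneg sum_nonneg) auto
    then show "0 \<le> c" using part[OF fin(1) A(2)] unfolding M_def by linarith
  qed
  finally show ?case using cA by (simp add: M_def pos_divide_le_eq)
qed

text \<open>A cube with root in \<open>V\<close> has each vertex in its range, so cutting
  \<open>B\<close> down to the ranges loses no cube and makes the target sets finite.\<close>

lemma interval_mean_roots_le:
  assumes "finite V" "\<And>I. I \<in> set Is \<Longrightarrow> finite I"
  shows "interval_mean N Is (\<lambda>xs. real (card {y\<in>V. cube_in B xs y})) \<le> cube_count N Is (\<lambda>u. B \<inter> vertex_range V Is u)"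
  using assms
proof (induction Is arbitrary: B V)
  case Nil
  have "{y\<in>V. y \<in> B} = B \<inter> V" by auto
  then show ?case by simp
next
  case (Cons I Is)
  have finV: "finite (vertex_range V Is u)" if "finite V" "\<And>I. I \<in> set Is \<Longrightarrow> finite I" for V Is u
    using that
  proof (induction V Is u rule: vertex_range.induct)
    case (1 V I Is b u)
    then show ?case by (cases b) auto
  qed auto
  have "interval_mean N Is (\<lambda>xs. real (card {y\<in>V. cube_in B (x # xs) y}))
     \<le> cube_count N Is (merge (\<lambda>u. B \<inter> vertex_range V (I # Is) u) x)" if x: "x \<in> I" for x
  proof -
    have "interval_mean N Is (\<lambda>xs. real (card {y\<in>V. cube_in B (x # xs) y}))
      \<le> cube_count N Is (\<lambda>u. {z\<in>B. z + x \<in> B} \<inter> vertex_range V Is u)"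
      unfolding cube_in_Cons by (rule Cons.IH) (use Cons.prems in auto)
    also have "\<dots> \<le> cube_count N Is (merge (\<lambda>u. B \<inter> vertex_range V (I # Is) u) x)"
    proof (rule cube_count_mono)
      fix u :: "bool list"
      show "{z\<in>B. z + x \<in> B} \<inter> vertex_range V Is u \<subseteq> merge (\<lambda>u. B \<inter> vertex_range V (I # Is) u) x u"
        using vertex_range_add[OF _ x, of _ V Is u] by (auto simp: merge_def)
      show "finite (merge (\<lambda>u. B \<inter> vertex_range V (I # Is) u) x u)"
        unfolding merge_def by (rule finite_subset[OF _ finV[of V Is u]]) (use Cons.prems in auto)
    qed
    finally show ?thesis .
  qed
  then show ?case by (auto intro!: divide_right_mono sum_mono)
qed

section \<open>Energy decay over a block of steps\<close>

lemma exp_beats_power: 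
  fixes c C :: real
  assumes "0 < c" shows "(\<lambda>m. C * real (m + r) ^ k * exp (- c * real m)) \<longlonglongrightarrow> 0"
proof -
  have "((\<lambda>x. x ^ k / exp x) \<longlongrightarrow> (0::real)) at_top" by (rule tendsto_power_div_exp_0)
  moreover have "filterlim (\<lambda>m. c * real (m + r)) at_top sequentially"
    using assms filterlim_tendsto_pos_mult_at_top[OF tendsto_const[of c] assms]
      filterlim_compose[OF filterlim_real_sequentially filterlim_add_const_nat_at_top[of r]] by blast
  ultimately have "(\<lambda>m. (c * real (m + r)) ^ k / exp (c * real (m + r))) \<longlonglongrightarrow> 0"
    by (rule filterlim_compose)
  then have "(\<lambda>m. (C / c ^ k * exp (c * real r)) * ((c * real (m + r)) ^ k / exp (c * real (m + r)))) \<longlonglongrightarrow> 0"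
    by (rule tendsto_mult_right_zero)
  moreover have "(C / c ^ k * exp (c * real r)) * ((c * real (m + r)) ^ k / exp (c * real (m + r)))
      = C * real (m + r) ^ k * exp (- c * real m)" for m
  proof -
    define y where "y = real (m + r)"
    have "exp (c * y) = exp (c * real m) * exp (c * real r)" by (simp add: y_def distrib_left exp_add)
    then show ?thesis using assms unfolding y_def[symmetric]
      by (simp add: power_mult_distrib exp_minus field_simps)
  qed
  ultimately show ?thesis by simp
qed

text \<open>The root \<open>y\<close> is fixed, whereas \<open>cube_count_le\<close> counts over all
  roots; so one of the \<open>Suc m\<close> steps is spent on making the root random. The other
  \<open>m\<close> gain \<open>exp (- 2 * c * m)\<close> up to factors polynomial in
  \<open>m\<close>, harmless for large \<open>m\<close>.\<close>

lemma cube_event_bound: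
  fixes \<kappa> c :: real
  assumes "0 < \<kappa>" "0 < c"
  obtains m l :: nat where
    "\<And>N As B y. N \<ge> 1 \<Longrightarrow> length As = Suc m \<Longrightarrow>
      (\<And>A. A \<in> set As \<Longrightarrow> (\<exists>I J. A = I \<union> J \<and> int_interval I \<and> int_interval J) \<and> finite A \<and>
         2 * N \<le> card A \<and> real (card A) \<le> \<kappa> * real N) \<Longrightarrow>
      thick_sparse N l B \<Longrightarrow>
      mean_list As (\<lambda>xs. of_bool (cube_in B xs y)) \<le> exp (- c * real (Suc m))"
proof -
  \<comment> \<open>Twice the desired rate, so that \<open>exp (- c * m)\<close> is left over to
    absorb the polynomial in \<open>m\<close>. The quarter in \<beta> turns the
    \<open>2 * \<beta>\<close> of \<open>overlap_moment\<close> into the \<open>\<tau> / 2\<close>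
    that \<open>cube_count_le\<close> asks for.\<close>
  define \<tau> where "\<tau> = exp (- 2 * c)"
  define \<beta> where "\<beta> = \<tau> / 4"
  define \<theta> where "\<theta> = min (1/2) (\<beta> / (40 * (1 + \<kappa>)))"
  have pos: "0 < \<tau>" "0 < \<beta>" "0 < \<theta>" using assms by (auto simp: \<tau>_def \<beta>_def \<theta>_def)
  have \<theta>: "\<theta> \<le> 1/2" unfolding \<theta>_def by (rule min.cobounded1)
  note pos = pos \<theta>
  have \<theta>\<beta>: "40 * (1 + \<kappa>) * \<theta> \<le> \<beta>"
  proof -
    have "\<theta> \<le> \<beta> / (40 * (1 + \<kappa>))" by (simp add: \<theta>_def)
    then show ?thesis using assms by (simp add: pos_le_divide_eq mult.commute)
  qed
  define l where "l = nat \<lceil>(1 + \<kappa>) / \<beta>\<rceil>"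
  have l: "(1 + \<kappa>) / \<beta> \<le> real l" using assms pos by (simp add: l_def)
  obtain a0 where "(1 - \<theta>) ^ a0 < \<beta> / \<kappa>"
    using real_arch_pow_inv[of "\<beta> / \<kappa>" "1 - \<theta>"] pos assms by auto
  moreover have "(1 - \<theta>) ^ (2 * Suc a0) \<le> (1 - \<theta>) ^ a0" using pos by (intro power_decreasing) auto
  ultimately have "(1 - \<theta>) ^ (2 * Suc a0) \<le> \<beta> / \<kappa>" by linarith
  then have a: "\<kappa> * (1 - \<theta>) ^ (2 * Suc a0) \<le> \<beta>" using assms by (simp add: field_simps)
  define a where "a = Suc a0"
  define \<sigma> where "\<sigma> = 2 * \<tau> / \<tau> ^ (2 * a)"
  have \<sigma>0: "0 \<le> \<sigma>" using pos by (simp add: \<sigma>_def)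
  \<comment> \<open>Bounds the density \<open>card / N\<close> of a target set, which lies in an
    interval of length \<open>(m + 1) * \<kappa> * N\<close>; the slack covers the additional
    endpoint.\<close>
  define Z where "Z m = real (m + 2) * (\<kappa> + 1)" for m :: nat
  have Z0: "0 \<le> Z m" for m using assms by (simp add: Z_def)
  have "(\<lambda>m. exp c * ((\<kappa> + 1) * real (m + 2) ^ 1 * exp (- c * real m)
      + (\<sigma> * (\<kappa> + 1) ^ (2 * a)) * real (m + 2) ^ (2 * a) * exp (- c * real m))) \<longlonglongrightarrow> exp c * (0 + 0)"
    by (intro tendsto_mult_left tendsto_add exp_beats_power assms)
  then have "\<forall>\<^sub>F m in sequentially. exp c * ((\<kappa> + 1) * real (m + 2) ^ 1 * exp (- c * real m)
      + (\<sigma> * (\<kappa> + 1) ^ (2 * a)) * real (m + 2) ^ (2 * a) * exp (- c * real m)) < 1"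
    by (intro order_tendstoD(2)[of _ 0]) auto
  then obtain m where m: "exp c * ((\<kappa> + 1) * real (m + 2) ^ 1 * exp (- c * real m)
      + (\<sigma> * (\<kappa> + 1) ^ (2 * a)) * real (m + 2) ^ (2 * a) * exp (- c * real m)) < 1"
    unfolding eventually_sequentially by auto
  have "\<tau> ^ m * (Z m + \<sigma> * Z m ^ (2 * a))
      = exp (- c * real (Suc m)) * (exp c * ((\<kappa> + 1) * real (m + 2) ^ 1 * exp (- c * real m)
      + (\<sigma> * (\<kappa> + 1) ^ (2 * a)) * real (m + 2) ^ (2 * a) * exp (- c * real m)))"
  proof -
    have "\<tau> ^ m = exp (- c * real (Suc m)) * (exp c * exp (- c * real m))"
      by (simp add: \<tau>_def algebra_simps flip: exp_of_nat_mult exp_add)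
    moreover have "Z m ^ (2 * a) = (\<kappa> + 1) ^ (2 * a) * real (m + 2) ^ (2 * a)"
      by (simp only: Z_def power_mult_distrib mult.commute)
    ultimately have "\<tau> ^ m * (Z m + \<sigma> * Z m ^ (2 * a)) = exp (- c * real (Suc m)) * (exp c * exp (- c * real m))
        * ((\<kappa> + 1) * real (m + 2) + \<sigma> * ((\<kappa> + 1) ^ (2 * a) * real (m + 2) ^ (2 * a)))"
      by (simp only:) (simp only: Z_def mult.commute)
    then show ?thesis by (simp only: power_one_right distrib_left mult_ac)
  qed
  also have "\<dots> \<le> exp (- c * real (Suc m)) * 1" using m by (intro mult_left_mono) auto
  finally have mfin: "\<tau> ^ m * (Z m + \<sigma> * Z m ^ (2 * a)) \<le> exp (- c * real (Suc m))" by simp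
  show ?thesis
  proof (rule that[of m l])
    fix N :: nat and As :: "int set list" and B :: "int set" and y :: int
    assume N: "N \<ge> 1" and len: "length As = Suc m"
      and As: "\<And>A. A \<in> set As \<Longrightarrow> (\<exists>I J. A = I \<union> J \<and> int_interval I \<and> int_interval J) \<and> finite A \<and>
         2 * N \<le> card A \<and> real (card A) \<le> \<kappa> * real N"
      and sp: "thick_sparse N l B"
    have N0: "real N > 0" using N by simp
    define G where "G I \<longleftrightarrow> int_interval I \<and> real (card I) \<le> \<kappa> * real N" for I
    \<comment> \<open>Only the face of the cube with root \<open>y + x\<close> is kept, where
      \<open>x\<close> is the first step. Summing over \<open>x\<close> then counts roots in a
      translate of the first interval.\<close>
    define F where "F xs = (of_bool (cube_in B (tl xs) (y + hd xs)) :: real)" for xs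
    have "mean_list As (\<lambda>xs. of_bool (cube_in B xs y)) \<le> mean_list As F"
    proof (rule mean_list_mono)
      fix xs assume "xs \<in> listset As"
      then obtain x ys where "xs = x # ys" using len by (cases As) (auto simp: set_Cons_def)
      then show "of_bool (cube_in B xs y) \<le> F xs" by (simp add: F_def)
    qed
    also have "\<dots> \<le> exp (- c * real (Suc m))"
    proof (rule mean_list_le_interval_mean[where G = G and N = N])
      fix A assume A: "A \<in> set As"
      then obtain I J where IJ: "A = I \<union> J" "int_interval I" "int_interval J" using As by blast
      have cA: "real (card A) \<le> \<kappa> * real N" "finite A" "2 * N \<le> card A" using As[OF A] by auto
      have "card I \<le> card A" "card J \<le> card A" using IJ(1) cA by (auto intro!: card_mono)
      then have "G I" "G J" using IJ cA unfolding G_def by auto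
      then show "\<exists>I J. A = I \<union> J \<and> G I \<and> G J \<and> finite A \<and> 2 * N \<le> card A" using IJ(1) cA by blast
    next
      fix Is0 :: "int set list" assume Is0: "length Is0 = length As" "\<And>I. I \<in> set Is0 \<Longrightarrow> G I"
      then obtain I0 Is where Is: "Is0 = I0 # Is" "length Is = m" using len by (cases Is0) auto
      have GI: "G I" if "I = I0 \<or> I \<in> set Is" for I using Is0 Is that by auto
      have finI: "finite I" if "I = I0 \<or> I \<in> set Is" for I
        using GI[OF that] by (auto simp: G_def int_interval_def)
      define h where "h = \<lfloor>\<kappa> * real N\<rfloor>"
      have h0: "0 \<le> h" using assms by (simp add: h_def)
      have short: "\<exists>a. I \<subseteq> {a..a + h}" if "I = I0 \<or> I \<in> set Is" for I
      proof -
        from GI[OF that] obtain a b where ab: "I = {a..b}" by (auto simp: G_def int_interval_def)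
        have "real (card I) \<le> \<kappa> * real N" using GI[OF that] by (simp add: G_def)
        then have "int (card I) \<le> h" unfolding h_def by (simp add: le_floor_iff)
        then have "b - a + 1 \<le> h" using ab h0 by (simp split: if_splits)
        then show ?thesis using ab by (intro exI[of _ a]) auto
      qed
      define V where "V = (\<lambda>x. y + x) ` I0"
      have finV: "finite V" using finI by (simp add: V_def)
      define \<B> where "\<B> u = B \<inter> vertex_range V Is u" for u
      obtain a1 where a1: "I0 \<subseteq> {a1..a1 + h}" using short by blast
      have V: "V \<subseteq> {y + a1..y + a1 + h}" using a1 by (auto simp: V_def)
      have \<B>card: "finite (\<B> u) \<and> real (card (\<B> u)) \<le> Z m * real N" for u
      proof -
        obtain c' where c': "vertex_range V Is u \<subseteq> {c'..c' + int (length Is + 1) * h}"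
          using vertex_range_subset[OF V _ h0, of Is u] short by blast
        then have sub: "\<B> u \<subseteq> {c'..c' + int (m + 1) * h}" using Is by (auto simp: \<B>_def)
        then have "card (\<B> u) \<le> card {c'..c' + int (m + 1) * h}" by (intro card_mono) auto
        moreover have "0 \<le> int (m + 1) * h" using h0 by simp
        ultimately have "int (card (\<B> u)) \<le> int (m + 1) * h + 1" by (simp add: le_nat_iff)
        then have "real (card (\<B> u)) \<le> real_of_int (int (m + 1) * h + 1)" by (metis of_int_le_iff of_int_of_nat_eq)
        also have "\<dots> \<le> real (m + 1) * (\<kappa> * real N) + 1"
          unfolding h_def by (auto intro!: mult_left_mono)
        also have "\<dots> \<le> Z m * real N"
        proof -
          have "1 \<le> real N * real (m + 2)" using N by (intro mult_ge1_I) auto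
          moreover have "real (m + 1) * (\<kappa> * real N) \<le> real (m + 2) * (\<kappa> * real N)"
            using assms by (intro mult_right_mono) auto
          ultimately show ?thesis by (simp add: Z_def algebra_simps)
        qed
        finally show ?thesis using sub finite_subset by blast
      qed
      have "interval_mean N Is0 F = (\<Sum>x\<in>I0. interval_mean N Is (\<lambda>xs. of_bool (cube_in B xs (y + x)))) / real N"
        by (simp add: Is(1) F_def)
      also have "(\<Sum>x\<in>I0. interval_mean N Is (\<lambda>xs. of_bool (cube_in B xs (y + x))))
          = interval_mean N Is (\<lambda>xs. real (card {z\<in>V. cube_in B xs z}))"
      proof -
        have "(\<Sum>x\<in>I0. of_bool (cube_in B xs (y + x))) = real (card {z\<in>V. cube_in B xs z})" for xs
        proof -
          have "(\<Sum>x\<in>I0. of_bool (cube_in B xs (y + x))) = (\<Sum>z\<in>V. of_bool (cube_in B xs z) :: real)"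
            unfolding V_def by (simp add: sum.reindex)
          also have "\<dots> = real (card {z\<in>V. cube_in B xs z})"
            using finV by (simp add: of_bool_def sum.If_cases Int_def)
          finally show ?thesis .
        qed
        then show ?thesis using finI[of I0] by (simp flip: interval_mean_sum)
      qed
      also have "\<dots> / real N \<le> cube_count N Is \<B> / real N"
        unfolding \<B>_def using finV finI by (intro divide_right_mono interval_mean_roots_le) auto
      also have "\<dots> \<le> \<tau> ^ m * (gmean m \<B> / real N + \<sigma> * (gmean m \<B> / real N) ^ (2 * a))"
      proof -
        have "cube_count N Is \<B> \<le> \<tau> ^ length Is * real N *
          (gmean (length Is) \<B> / real N + \<sigma> * (gmean (length Is) \<B> / real N) ^ (2 * a))"
        proof (rule cube_count_le[where l = l])
          fix I B C :: "int set" assume I: "I \<in> set Is" "finite B" "finite C" "thick_sparse N l C"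
          obtain a' b' where ab: "I = {a'..b'}" using GI[of I] I by (auto simp: G_def int_interval_def)
          have "(\<Sum>x\<in>{a'..b'}. real (overlap B C x) ^ (2 * a)) \<le> 2 * \<beta> * real N * (real (card B) ^ a * real (card C) ^ a)"
            by (rule overlap_moment[where \<kappa> = \<kappa> and \<theta> = \<theta> and l = l])
              (use I ab GI[of I] N pos assms l \<theta>\<beta> a in \<open>auto simp: a_def G_def\<close>)
          then show "(\<Sum>x\<in>I. real (overlap B C x) ^ (2 * a)) \<le> \<tau> / 2 * real N * (real (card B) ^ a * real (card C) ^ a)"
            by (simp add: ab \<beta>_def)
        next
          fix u
          show "finite (\<B> u) \<and> thick_sparse N l (\<B> u)"
            using \<B>card[of u] thick_sparse_subset[OF sp, of "\<B> u"] by (auto simp: \<B>_def)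
        qed (use N pos finI in \<open>auto simp: a_def \<sigma>_def\<close>)
        then show ?thesis using N0 Is by (simp add: divide_le_eq mult_ac)
      qed
      also have "\<dots> \<le> \<tau> ^ m * (Z m + \<sigma> * Z m ^ (2 * a))"
      proof -
        have "gmean m \<B> \<le> Z m * real N" using \<B>card by (intro gmean_le) auto
        then have "gmean m \<B> / real N \<le> Z m" using N0 by (simp add: divide_le_eq)
        then show ?thesis using pos \<sigma>0 gmean_nonneg[of m \<B>]
          by (intro mult_left_mono add_mono power_mono) auto
      qed
      also note mfin
      finally show "interval_mean N Is0 F \<le> exp (- c * real (Suc m))" .
    qed (use N in \<open>auto simp: F_def\<close>)
    finally show "mean_list As (\<lambda>xs. of_bool (cube_in B xs y)) \<le> exp (- c * real (Suc m))" .
  qed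
qed

text \<open>The inductive step of Hoelder's inequality on a cube. A constant \<kappa> may vanish: in
  \<open>mixl_power_le\<close> it is \<open>1 - p ^ 0\<close> for the empty cube at a point outside
  \<open>B\<close>.\<close>

lemma hoelder_2:
  fixes a b A B \<alpha> \<beta> \<kappa>1 \<kappa>2 :: real
  assumes nn: "0 \<le> a" "0 \<le> b" "0 \<le> A" "0 \<le> B" "0 \<le> \<alpha>" "0 \<le> \<beta>" "0 \<le> \<kappa>1" "0 \<le> \<kappa>2"
    and le: "a ^ Suc s \<le> \<kappa>1 ^ s * A" "b ^ Suc s \<le> \<kappa>2 ^ s * B"
  shows "(\<alpha> * a + \<beta> * b) ^ Suc s \<le> (\<alpha> * \<kappa>1 + \<beta> * \<kappa>2) ^ s * (\<alpha> * A + \<beta> * B)"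
proof -
  have one: "(\<beta> * b) ^ Suc s \<le> (\<beta> * \<kappa>2) ^ s * (\<beta> * B)"
    if "0 \<le> \<beta>" "b ^ Suc s \<le> \<kappa>2 ^ s * B" for \<beta> b \<kappa>2 B :: real
    using mult_left_mono[OF that(2), of "\<beta> ^ Suc s"] that(1) by (simp add: power_mult_distrib mult_ac)
  \<comment> \<open>For \<open>s = 0\<close> a vanishing constant has power 1 and forces nothing, so
    this case is separate; otherwise the corresponding value is 0 and only one term remains.\<close>
  consider "s = 0" | "s > 0" "\<kappa>1 = 0" | "s > 0" "\<kappa>2 = 0" | "\<kappa>1 > 0" "\<kappa>2 > 0"
    using nn by linarith
  then show ?thesis
  proof cases
    case 1
    then show ?thesis using le nn by (auto intro!: add_mono mult_left_mono)
  next
    case 2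
    then have "a ^ Suc s \<le> 0" using le by (simp add: power_0_left)
    then have "a = 0" using nn by (metis power_le_zero_eq zero_less_Suc order.antisym)
    then have "(\<alpha> * a + \<beta> * b) ^ Suc s \<le> (\<beta> * \<kappa>2) ^ s * (\<beta> * B)" using one[OF nn(6) le(2)] by simp
    also have "\<dots> \<le> (\<beta> * \<kappa>2) ^ s * (\<alpha> * A + \<beta> * B)" using nn by (intro mult_left_mono) auto
    finally show ?thesis using 2 by simp
  next
    case 3
    then have "b ^ Suc s \<le> 0" using le by (simp add: power_0_left)
    then have "b = 0" using nn by (metis power_le_zero_eq zero_less_Suc order.antisym)
    then have "(\<alpha> * a + \<beta> * b) ^ Suc s \<le> (\<alpha> * \<kappa>1) ^ s * (\<alpha> * A)" using one[OF nn(5) le(1)] by simp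
    also have "\<dots> \<le> (\<alpha> * \<kappa>1) ^ s * (\<alpha> * A + \<beta> * B)" using nn by (intro mult_left_mono) auto
    finally show ?thesis using 3 by simp
  next
    case 4
    have "(\<alpha> * a + \<beta> * b) ^ Suc s = ((\<alpha> * \<kappa>1) * (a / \<kappa>1) + (\<beta> * \<kappa>2) * (b / \<kappa>2)) ^ Suc s" using 4 by simp
    also have "\<dots> \<le> (\<alpha> * \<kappa>1 + \<beta> * \<kappa>2) ^ s * ((\<alpha> * \<kappa>1) * (a / \<kappa>1) ^ Suc s + (\<beta> * \<kappa>2) * (b / \<kappa>2) ^ Suc s)"
      using nn 4 by (intro power_mean_2) auto
    also have "\<dots> \<le> (\<alpha> * \<kappa>1 + \<beta> * \<kappa>2) ^ s * (\<alpha> * A + \<beta> * B)"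
    proof (intro mult_left_mono add_mono)
      have "\<kappa>1 * (a / \<kappa>1) ^ Suc s = a ^ Suc s / \<kappa>1 ^ s" using 4 by (simp add: power_divide)
      also have "\<dots> \<le> A" using le 4 by (simp add: divide_le_eq mult.commute)
      finally show "(\<alpha> * \<kappa>1) * (a / \<kappa>1) ^ Suc s \<le> \<alpha> * A" using nn by (simp only: mult.assoc mult_left_mono)
      have "\<kappa>2 * (b / \<kappa>2) ^ Suc s = b ^ Suc s / \<kappa>2 ^ s" using 4 by (simp add: power_divide)
      also have "\<dots> \<le> B" using le 4 by (simp add: divide_le_eq mult.commute)
      finally show "(\<beta> * \<kappa>2) * (b / \<kappa>2) ^ Suc s \<le> \<beta> * B" using nn by (simp only: mult.assoc mult_left_mono)
    qed (use nn in auto)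
    finally show ?thesis .
  qed
qed

section \<open>Hoelder's inequality on a cube and the gain of a block\<close>

context bernoulli_mixing
begin

text \<open>As \<open>p \<le> 1 - p\<close>, every vertex of the cube has weight at least
  \<open>p ^ length xs\<close>. If some vertex lies outside \<open>B\<close>, then \<phi> vanishes
  there and Hoelder's inequality uses a total weight of at most
  \<open>1 - p ^ length xs\<close>.\<close>

lemma mixl_power_le:
  assumes \<phi>: "\<And>z. 0 \<le> \<phi> z" "\<And>z. z \<notin> B \<Longrightarrow> \<phi> z = 0"
  shows "mixl xs \<phi> t ^ Suc s \<le>
    (if cube_in B xs t then 1 else 1 - p ^ length xs) ^ s * mixl xs (\<lambda>z. \<phi> z ^ Suc s) t"
proof (induction xs arbitrary: t)
  case Nil
  show ?case using \<phi>(2)[of t] by (cases "t \<in> B") auto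
next
  case (Cons x xs)
  define K where "K t = (if cube_in B xs t then 1 else 1 - p ^ length xs)" for t
  let ?m = "\<lambda>t. mixl xs \<phi> t" and ?M = "\<lambda>t. mixl xs (\<lambda>z. \<phi> z ^ Suc s) t"
  have p1: "0 \<le> p ^ length xs" "p ^ length xs \<le> 1" using p_pos p_le by (auto intro!: power_le_one)
  then have K0: "0 \<le> K t" "K t \<le> 1" for t by (auto simp: K_def)
  have q: "0 \<le> 1 - p" "0 \<le> p" using p_pos p_le by auto
  have "mixl (x # xs) \<phi> t ^ Suc s \<le> ((1 - p) * K t + p * K (t + x)) ^ s * ((1 - p) * ?M t + p * ?M (t + x))"
    unfolding mixl_Cons using \<phi> K0 q
    by (intro hoelder_2) (auto intro!: mixl_nonneg Cons.IH[folded K_def] simp del: power_Suc)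
  also have "\<dots> \<le> (if cube_in B (x # xs) t then 1 else 1 - p ^ length (x # xs)) ^ s * ((1 - p) * ?M t + p * ?M (t + x))"
  proof (intro mult_right_mono power_mono)
    have "p * p ^ length xs \<le> (1 - p) * p ^ length xs" using p1 p_le by (intro mult_right_mono) auto
    then show "(1 - p) * K t + p * K (t + x) \<le> (if cube_in B (x # xs) t then 1 else 1 - p ^ length (x # xs))"
      using p1 q mult_nonneg_nonneg[OF q(2) p1(1)] mult_right_mono[of p 1 "p ^ length xs"] by (auto simp: K_def algebra_simps)
    show "0 \<le> (1 - p) * ?M t + p * ?M (t + x)"
      using q \<phi> by (intro add_nonneg_nonneg mult_nonneg_nonneg mixl_nonneg) auto
  qed (use K0 q in auto)
  finally show ?case by (simp only: mixl_Cons)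
qed

lemma mixl_infsum:
  assumes "E summable_on UNIV"
  shows "mixl xs E summable_on UNIV" "(\<Sum>\<^sub>\<infinity>t. mixl xs E t) = (\<Sum>\<^sub>\<infinity>t. E t)"
proof -
  have "mixl xs E summable_on UNIV \<and> (\<Sum>\<^sub>\<infinity>t. mixl xs E t) = (\<Sum>\<^sub>\<infinity>t. E t)"
    using assms
  proof (induction xs)
    case (Cons x xs)
    then have IH: "mixl xs E summable_on UNIV" "(\<Sum>\<^sub>\<infinity>t. mixl xs E t) = (\<Sum>\<^sub>\<infinity>t. E t)" by auto
    have sm: "(\<lambda>t. (1 - p) * mixl xs E t) summable_on UNIV" "(\<lambda>t. p * mixl xs E (t + x)) summable_on UNIV"
      using IH by (auto intro!: summable_on_cmult_right simp: infsum_translate(2))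
    have eq: "mixl (x # xs) E = (\<lambda>t. (1 - p) * mixl xs E t + p * mixl xs E (t + x))"
      using mixl_Cons by blast
    have "(\<Sum>\<^sub>\<infinity>t. (1 - p) * mixl xs E t + p * mixl xs E (t + x)) = (1 - p) * (\<Sum>\<^sub>\<infinity>t. E t) + p * (\<Sum>\<^sub>\<infinity>t. E t)"
      by (simp only: infsum_add[OF sm] infsum_cmult_right' infsum_translate(1) IH)
    then show ?case unfolding eq using summable_on_add[OF sm] by (simp add: algebra_simps)
  qed simp
  then show "mixl xs E summable_on UNIV" "(\<Sum>\<^sub>\<infinity>t. mixl xs E t) = (\<Sum>\<^sub>\<infinity>t. E t)" by auto
qed

text \<open>By the symmetry of the step sets, the weight of a root may be moved back from the vertices
  to the root.\<close>

lemma mean_list_mixl_cube: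
  assumes E: "E summable_on UNIV" "\<And>t. 0 \<le> E t"
    and "\<forall>A\<in>set As. finite A \<and> A \<noteq> {} \<and> origin_symmetric A"
  shows "mean_list As (\<lambda>xs. \<Sum>\<^sub>\<infinity>t. mixl xs E t * of_bool (cube_in B xs t))
     = mean_list As (\<lambda>xs. \<Sum>\<^sub>\<infinity>t. E t * of_bool (cube_in B xs t))"
  using assms(3)
proof (induction As arbitrary: B)
  case (Cons A As)
  define R where "R x = mean_list As (\<lambda>xs. \<Sum>\<^sub>\<infinity>t. E t * of_bool (cube_in B (x # xs) t))" for x
  have step: "(\<Sum>\<^sub>\<infinity>t. mixl (x # xs) E t * of_bool (cube_in B (x # xs) t))
    = (1 - p) * (\<Sum>\<^sub>\<infinity>t. mixl xs E t * of_bool (cube_in {z\<in>B. z + x \<in> B} xs t))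
      + p * (\<Sum>\<^sub>\<infinity>t. mixl xs E t * of_bool (cube_in {z\<in>B. z + - x \<in> B} xs t))" for x xs
  proof -
    let ?m = "mixl xs E"
    have sm: "(\<lambda>t. ?m t * of_bool (Q t)) summable_on UNIV" for Q
      using E by (intro summable_mult_le_one mixl_infsum) (auto intro: mixl_nonneg)
    \<comment> \<open>Seen from the other end of its first step, a cube with first step
      \<open>x\<close> is a cube with first step \<open>- x\<close>.\<close>
    have tr: "(\<lambda>t. ?m (t + x) * of_bool (cube_in B (x # xs) t)) summable_on UNIV"
      "(\<Sum>\<^sub>\<infinity>t. ?m (t + x) * of_bool (cube_in B (x # xs) t)) = (\<Sum>\<^sub>\<infinity>t. ?m t * of_bool (cube_in B (- x # xs) t))"
      using infsum_translate[of "\<lambda>t. ?m t * of_bool (cube_in B (- x # xs) t)" x]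
        sm[of "\<lambda>t. cube_in B (- x # xs) t"] by (simp_all add: conj_commute)
    have "(\<Sum>\<^sub>\<infinity>t. mixl (x # xs) E t * of_bool (cube_in B (x # xs) t))
      = (\<Sum>\<^sub>\<infinity>t. (1 - p) * (?m t * of_bool (cube_in B (x # xs) t)) + p * (?m (t + x) * of_bool (cube_in B (x # xs) t)))"
      by (simp only: mixl_Cons distrib_right mult.assoc)
    also have "\<dots> = (1 - p) * (\<Sum>\<^sub>\<infinity>t. ?m t * of_bool (cube_in B (x # xs) t))
        + p * (\<Sum>\<^sub>\<infinity>t. ?m (t + x) * of_bool (cube_in B (x # xs) t))"
      using sm[of "cube_in B (x # xs)"] tr(1)
      by (subst infsum_add) (auto intro: summable_on_cmult_right simp only: infsum_cmult_right')
    finally show ?thesis unfolding tr unfolding cube_in_Cons .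
  qed
  have R: "mean_list As (\<lambda>xs. \<Sum>\<^sub>\<infinity>t. mixl xs E t * of_bool (cube_in {z\<in>B. z + x \<in> B} xs t)) = R x" for x
    using Cons.IH Cons.prems by (simp only: R_def cube_in_Cons) simp
  have "mean_list (A # As) (\<lambda>xs. \<Sum>\<^sub>\<infinity>t. mixl xs E t * of_bool (cube_in B xs t))
    = (\<Sum>x\<in>A. (1 - p) * R x + p * R (- x)) / real (card A)"
    by (simp only: mean_list.simps step mean_list_linear R)
  also have "(\<Sum>x\<in>A. (1 - p) * R x + p * R (- x)) = (1 - p) * (\<Sum>x\<in>A. R x) + p * (\<Sum>x\<in>A. R (- x))"
    by (simp add: sum.distrib sum_distrib_left)
  also have "(\<Sum>x\<in>A. R (- x)) = (\<Sum>x\<in>A. R x)"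
    by (rule sum.reindex_bij_witness[of _ uminus uminus])
      (use Cons.prems in \<open>auto simp: origin_symmetric_def\<close>)
  finally show ?case by (simp add: R_def algebra_simps)
qed simp

text \<open>Roots whose cube leaves the level set gain \<open>(1 - p ^ length As) ^ s\<close>. The
  others gain nothing, but once their weight is moved back to the root it no longer depends on the
  steps, and the probability \<rho> of the cube event factors out.\<close>

lemma mean_energy_block_le:
  assumes g: "regular N w l g" and T: "0 \<le> T"
    and As: "\<forall>A\<in>set As. finite A \<and> A \<noteq> {} \<and> origin_symmetric A"
    and \<rho>: "\<And>y. mean_list As (\<lambda>xs. of_bool (cube_in {z. g z > T} xs y)) \<le> \<rho>"
  shows "mean_list As (\<lambda>xs. energy s T (mixl xs g)) \<le> ((1 - p ^ length As) ^ s + \<rho>) * energy s T g"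
proof -
  let ?E = "excess s T g" and ?B = "{z. g z > T}"
  let ?K = "(1 - p ^ length As) ^ s"
  note sE = excess_summable[OF g T, of s]
  define \<phi> where "\<phi> z = max 0 (g z - T)" for z
  have E: "?E = (\<lambda>z. \<phi> z ^ Suc s)" by (simp add: excess_def[abs_def] \<phi>_def)
  have p1: "p ^ length As \<le> 1" using p_pos p_le by (auto intro!: power_le_one)
  have one: "energy s T (mixl xs g) \<le> ?K * energy s T g + (\<Sum>\<^sub>\<infinity>t. mixl xs ?E t * of_bool (cube_in ?B xs t))"
    if xs: "xs \<in> listset As" for xs
  proof -
    have len: "length xs = length As"
      using xs by (induction As arbitrary: xs) (auto simp: set_Cons_def)
    have pt: "excess s T (mixl xs g) t \<le> ?K * mixl xs ?E t + mixl xs ?E t * of_bool (cube_in ?B xs t)" for t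
    proof -
      have "mixl xs g t \<le> mixl xs (\<lambda>z. 1 * \<phi> z + 1 * T) t" by (intro mixl_mono) (simp add: \<phi>_def)
      also have "\<dots> = mixl xs \<phi> t + T" using mixl_linear[of xs 1 \<phi> 1 "\<lambda>_. T"] mixl_const by simp
      finally have "max 0 (mixl xs g t - T) \<le> mixl xs \<phi> t"
        using mixl_nonneg[of \<phi> xs t] by (simp add: \<phi>_def)
      then have "excess s T (mixl xs g) t \<le> mixl xs \<phi> t ^ Suc s"
        unfolding excess_def by (intro power_mono) auto
      also have "\<dots> \<le> (if cube_in ?B xs t then 1 else 1 - p ^ length xs) ^ s * mixl xs ?E t"
        unfolding E by (rule mixl_power_le) (auto simp: \<phi>_def)
      also have "\<dots> \<le> ?K * mixl xs ?E t + mixl xs ?E t * of_bool (cube_in ?B xs t)"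
        using mixl_nonneg[of ?E xs t] excess_nonneg p1 by (simp add: len)
      finally show ?thesis .
    qed
    have sm: "(\<lambda>t. mixl xs ?E t * of_bool (cube_in ?B xs t)) summable_on UNIV"
      by (intro summable_mult_le_one mixl_infsum sE mixl_nonneg excess_nonneg) auto
    have "energy s T (mixl xs g) \<le> (\<Sum>\<^sub>\<infinity>t. ?K * mixl xs ?E t + mixl xs ?E t * of_bool (cube_in ?B xs t))"
      unfolding energy_def
      by (intro infsum_mono pt excess_summable[OF regular_mixl[OF g] T] summable_on_add
          summable_on_cmult_right mixl_infsum sE sm)
    also have "\<dots> = ?K * energy s T g + (\<Sum>\<^sub>\<infinity>t. mixl xs ?E t * of_bool (cube_in ?B xs t))"
      by (subst infsum_add) (auto intro!: summable_on_cmult_right mixl_infsum sE sm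
          simp: infsum_cmult_right' mixl_infsum(2)[OF sE] energy_def)
    finally show ?thesis .
  qed
  have "mean_list As (\<lambda>xs. energy s T (mixl xs g))
     \<le> mean_list As (\<lambda>xs. ?K * energy s T g + (\<Sum>\<^sub>\<infinity>t. mixl xs ?E t * of_bool (cube_in ?B xs t)))"
    by (intro mean_list_mono one)
  also have "\<dots> = ?K * energy s T g + mean_list As (\<lambda>xs. \<Sum>\<^sub>\<infinity>t. ?E t * of_bool (cube_in ?B xs t))"
    using As by (simp add: mean_list_add mean_list_const mean_list_mixl_cube[OF sE excess_nonneg])
  also have "mean_list As (\<lambda>xs. \<Sum>\<^sub>\<infinity>t. ?E t * of_bool (cube_in ?B xs t))
     = (\<Sum>\<^sub>\<infinity>t. ?E t * mean_list As (\<lambda>xs. of_bool (cube_in ?B xs t)))"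
    using mean_list_infsum[of "\<lambda>xs t. ?E t * of_bool (cube_in ?B xs t)" As]
      summable_mult_le_one[OF sE excess_nonneg] As by (simp add: mean_list_cmult)
  also have "\<dots> \<le> (\<Sum>\<^sub>\<infinity>t. \<rho> * ?E t)"
  proof (rule infsum_mono)
    show "(\<lambda>t. ?E t * mean_list As (\<lambda>xs. of_bool (cube_in ?B xs t))) summable_on UNIV"
      using As by (intro summable_mult_le_one sE excess_nonneg mean_list_nonneg mean_list_le) auto
    fix t
    show "?E t * mean_list As (\<lambda>xs. of_bool (cube_in ?B xs t)) \<le> \<rho> * ?E t"
      using mult_left_mono[OF \<rho>[of t] excess_nonneg[of s T g t]] by (simp add: mult.commute)
  qed (intro summable_on_cmult_right sE)
  also have "\<dots> = \<rho> * energy s T g" by (simp add: infsum_cmult_right' energy_def)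
  finally show ?thesis by (simp add: distrib_right)
qed

end

section \<open>The two stages\<close>

lemma window_sum_interval_le:
  fixes g :: "int \<Rightarrow> real"
  assumes g: "\<And>t. 0 \<le> g t" "\<And>a. (\<Sum>t\<in>{a..<a + int N}. g t) \<le> w" and N: "N \<ge> 1"
  shows "(\<Sum>x\<in>{a..b}. g x) \<le> (real (card {a..b}) / real N + 1) * w"
proof -
  have block: "(\<Sum>t\<in>{a..<a + int (r * N)}. g t) \<le> real r * w" for a r
  proof (induction r)
    case (Suc r)
    have "{a..<a + int (Suc r * N)} = {a..<a + int (r * N)} \<union> {a + int (r * N)..<a + int (r * N) + int N}"
    proof -
      have "int (Suc r * N) = int (r * N) + int N" "0 \<le> int (r * N)" by simp_all
      then show ?thesis by (simp only: add.assoc[symmetric]) (intro ivl_disj_un(17)[symmetric], simp_all)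
    qed
    moreover have "{a..<a + int (r * N)} \<inter> {a + int (r * N)..<a + int (r * N) + int N} = {}" by auto
    ultimately have "(\<Sum>t\<in>{a..<a + int (Suc r * N)}. g t)
      = (\<Sum>t\<in>{a..<a + int (r * N)}. g t) + (\<Sum>t\<in>{a + int (r * N)..<a + int (r * N) + int N}. g t)"
      by (simp only: finite_atLeastLessThan_int sum.union_disjoint)
    then show ?case using Suc g(2)[of "a + int (r * N)"] by (simp add: algebra_simps)
  qed simp
  define r where "r = card {a..b} div N + 1"
  have "w \<ge> 0" using order_trans[OF sum_nonneg g(2)[of 0]] g(1) by blast
  have "card {a..b} < r * N"
    using N unfolding r_def by (metis Suc_eq_plus1 dividend_less_times_div less_le_trans mult.commute zero_less_one add.commute mult_Suc)
  then have "b - a + 1 < int (r * N)" by (simp del: of_nat_mult split: if_splits)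
  then have "{a..b} \<subseteq> {a..<a + int (r * N)}" by (auto simp del: of_nat_mult)
  then have "(\<Sum>x\<in>{a..b}. g x) \<le> (\<Sum>t\<in>{a..<a + int (r * N)}. g t)" using g(1) by (intro sum_mono2) auto
  also have "\<dots> \<le> real r * w" by (rule block)
  also have "\<dots> \<le> (real (card {a..b}) / real N + 1) * w"
    using \<open>w \<ge> 0\<close> of_nat_div_le_of_nat[where 'a = real, of "card {a..b}" N] by (intro mult_right_mono) (auto simp: r_def)
  finally show ?thesis .
qed

text \<open>Every \<open>A i\<close> has at least \<open>N\<close> points, so by the bound on the
  product of cardinalities at most half of them exceed \<open>(K + 1)\<^sup>2 * N\<close>. The base
  is \<open>K + 1\<close> because \<open>K\<close> may be 1, and exponents can only be compared for
  a base above 1.\<close>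

lemma select_coordinates:
  assumes adm: "admissible N n K \<delta> A" and "N \<ge> 1" "K \<ge> 1" "\<delta> \<le> 1"
    and k: "4 * real k \<le> \<delta> * real n" "2 \<le> \<delta> * real n" "k2 \<le> k"
  obtains js0 js1 js2 where "distinct (js0 @ js1 @ js2)" "set (js0 @ js1 @ js2) = {1..n}"
    "length js0 = k" "length js2 = k2" "\<And>i. i \<in> set js0 \<Longrightarrow> real i \<le> \<delta> * real n"
    "\<And>i. i \<in> set js2 \<Longrightarrow> real (card (A i)) \<le> (K + 1)\<^sup>2 * real N"
proof -
  define S2 where "S2 = {i\<in>{1..n}. real (card (A i)) \<le> (K + 1)\<^sup>2 * real N}"
  define C where "C = {1..n} - S2"
  have ge: "real N \<le> real (card (A i))" if "i \<in> {1..n}" for i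
    using adm that unfolding admissible_def by (cases "real i \<le> \<delta> * real n") fastforce+
  have cards: "card C + card S2 = n"
  proof -
    have "card (C \<union> S2) = card C + card S2" by (rule card_Un_disjoint) (auto simp: C_def S2_def)
    moreover have "C \<union> S2 = {1..n}" by (auto simp: C_def S2_def)
    ultimately show ?thesis by simp
  qed
  have "(\<Prod>i\<in>{1..n}. if i \<in> C then (K + 1)\<^sup>2 * real N else real N) \<le> (\<Prod>i\<in>{1..n}. real (card (A i)))"
    using ge \<open>K \<ge> 1\<close> by (intro prod_mono) (auto simp: C_def S2_def not_le)
  also have "\<dots> \<le> (K * real N) ^ n" using adm by (simp add: admissible_def)
  also have "\<dots> \<le> ((K + 1) * real N) ^ n" using \<open>K \<ge> 1\<close> by (intro power_mono mult_right_mono) auto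
  also have "(\<Prod>i\<in>{1..n}. if i \<in> C then (K + 1)\<^sup>2 * real N else real N)
      = ((K + 1)\<^sup>2 * real N) ^ card C * real N ^ card S2"
  proof -
    have "{1..n} \<inter> {i. i \<in> C} = C" "{1..n} \<inter> - {i. i \<in> C} = S2" by (auto simp: C_def S2_def)
    then show ?thesis by (simp add: prod.If_cases)
  qed
  also have "\<dots> = (K + 1) ^ (2 * card C) * real N ^ n"
    using cards by (simp add: power_mult_distrib power_mult flip: power_add)
  finally have "(K + 1) ^ (2 * card C) * real N ^ n \<le> (K + 1) ^ n * real N ^ n"
    by (simp add: power_mult_distrib)
  then have "(K + 1) ^ (2 * card C) \<le> (K + 1) ^ n" using \<open>N \<ge> 1\<close> by simp
  then have "2 * card C \<le> n" using \<open>K \<ge> 1\<close> by (simp add: power_increasing_iff)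
  moreover have "4 * real k \<le> real n" using k(1) \<open>\<delta> \<le> 1\<close> mult_right_mono[of \<delta> 1 "real n"] by simp
  ultimately have "k2 \<le> card S2" using cards k(3) by linarith
  then obtain J2 where J2: "J2 \<subseteq> S2" "card J2 = k2" "finite J2" using obtain_subset_with_card_n by metis
  define S0 where "S0 = {1..nat \<lfloor>\<delta> * real n\<rfloor>}"
  have dn: "\<delta> * real n \<le> real n" using \<open>\<delta> \<le> 1\<close> mult_right_mono[of \<delta> 1 "real n"] by simp
  have S0: "i \<le> n \<and> real i \<le> \<delta> * real n" if "i \<in> S0" for i
  proof -
    have "int i \<le> \<lfloor>\<delta> * real n\<rfloor>" using that by (auto simp: S0_def)
    then have "real i \<le> \<delta> * real n" by linarith
    then show ?thesis using dn by linarith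
  qed
  \<comment> \<open>The coordinates of \<open>js2\<close> may occupy part of the first
    \<open>\<delta> * n\<close>; by the factor 4 in the assumption on \<open>k\<close>, enough of
    these remain for \<open>js0\<close>.\<close>
  have "real (card S0) \<ge> \<delta> * real n - 1" using k(2) by (simp add: S0_def)
  moreover have "card S0 - card J2 \<le> card (S0 - J2)" using J2 by (intro diff_card_le_card_Diff)
  ultimately have "k \<le> card (S0 - J2)" using J2(2) k by linarith
  then obtain J0 where J0: "J0 \<subseteq> S0 - J2" "card J0 = k" "finite J0" using obtain_subset_with_card_n by metis
  define J1 where "J1 = {1..n} - J0 - J2"
  have sub: "J0 \<subseteq> {1..n}" "J2 \<subseteq> {1..n}" using J0(1) J2(1) S0 by (auto simp: S0_def S2_def)
  have fin: "finite J1" by (simp add: J1_def)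
  show ?thesis
  proof (rule that[of "sorted_list_of_set J0" "sorted_list_of_set J1" "sorted_list_of_set J2"])
    show "distinct (sorted_list_of_set J0 @ sorted_list_of_set J1 @ sorted_list_of_set J2)"
      using J0 J2 fin by (auto simp: J1_def)
    show "set (sorted_list_of_set J0 @ sorted_list_of_set J1 @ sorted_list_of_set J2) = {1..n}"
      using J0(3) J2(3) fin sub by (simp add: J1_def) blast
  qed (use J0 J2 S0 in \<open>auto simp: S2_def\<close>)
qed

lemma admissible_coordinate:
  assumes adm: "admissible N n K \<delta> A" and "N \<ge> 1" "i \<in> {1..n}"
  shows "finite (A i)" "A i \<noteq> {}" "origin_symmetric (A i)" "2 * N \<le> card (A i)"
    "\<exists>I J. A i = I \<union> J \<and> int_interval I \<and> int_interval J"
    "real i \<le> \<delta> * real n \<Longrightarrow> x \<in> A i \<Longrightarrow> int N < \<bar>x\<bar>"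
proof -
  show "origin_symmetric (A i)" using adm assms(3) unfolding admissible_def by blast
  show c: "2 * N \<le> card (A i)"
    using adm assms(3) unfolding admissible_def by (cases "real i \<le> \<delta> * real n") fastforce+
  then have "card (A i) > 0" using \<open>N \<ge> 1\<close> by simp
  then show "finite (A i)" "A i \<noteq> {}" by (auto simp: card_gt_0_iff)
  show "\<exists>I J. A i = I \<union> J \<and> int_interval I \<and> int_interval J"
  proof (cases "real i \<le> \<delta> * real n")
    case True
    then show ?thesis using adm assms(3) unfolding admissible_def by blast
  next
    case False
    then have "int_interval (A i)" using adm assms(3) unfolding admissible_def by force
    then show ?thesis by (intro exI[of _ "A i"]) auto
  qed
  show "int N < \<bar>x\<bar>" if "real i \<le> \<delta> * real n" "x \<in> A i"
  proof -
    have "A i \<inter> {- int N..int N} = {}" using adm assms(3) that(1) unfolding admissible_def by blast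
    then have "x \<notin> {- int N..int N}" using that(2) by blast
    then show ?thesis by auto
  qed
qed

lemma chunk_list:
  assumes "length xs = k * m"
  obtains yss where "concat yss = xs" "length yss = k" "\<And>ys. ys \<in> set yss \<Longrightarrow> length ys = m"
proof -
  have "\<exists>yss. concat yss = xs \<and> length yss = k \<and> (\<forall>ys\<in>set yss. length ys = m)"
    using assms
  proof (induction k arbitrary: xs)
    case (Suc k)
    have "length (drop m xs) = k * m" using Suc.prems by simp
    then obtain yss where "concat yss = drop m xs" "length yss = k" "\<forall>ys\<in>set yss. length ys = m"
      using Suc.IH by blast
    then show ?case using Suc.prems by (intro exI[of _ "take m xs # yss"]) auto
  qed simp
  then show ?thesis using that by blast
qed

section \<open>Level sets and the combination of both stages\<close>

context bernoulli_mixing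
begin

text \<open>Markov's inequality: each of the two intervals is covered by at most
  \<open>card A / N + 1\<close> windows of mass at most \<open>w\<close>, and
  \<open>2 * card A / N + 2\<close> is at most \<open>3 * card A / N\<close>.\<close>

lemma level_set_density_le:
  assumes g: "regular N w l g" and N: "N \<ge> 1" and "0 < T" "finite A" "2 * N \<le> card A"
    and A: "\<exists>I J. A = I \<union> J \<and> int_interval I \<and> int_interval J"
  shows "real (card {x\<in>A. g (t + x) > T}) \<le> 3 * w / (real N * T) * real (card A)"
proof -
  obtain I J where IJ: "A = I \<union> J" "int_interval I" "int_interval J" using A by blast
  have fin: "finite I" "finite J" using IJ \<open>finite A\<close> by auto
  have N0: "real N > 0" using N by simp
  have g0: "\<And>t. 0 \<le> g t" "\<And>a. (\<Sum>t\<in>{a..<a + int N}. g t) \<le> w" using g by (auto simp: regular_def)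
  have w0: "0 \<le> w" using order_trans[OF sum_nonneg g0(2)[of 0]] g0(1) by blast
  have one: "(\<Sum>x\<in>H. g (t + x)) \<le> (real (card A) / real N + 1) * w" if H: "int_interval H" "H \<subseteq> A" for H
  proof -
    obtain a b where ab: "H = {a..b}" using H by (auto simp: int_interval_def)
    have "(\<Sum>x\<in>H. g (t + x)) = (\<Sum>x\<in>{t + a..t + b}. g x)"
      unfolding ab by (rule sum.reindex_bij_witness[of _ "\<lambda>x. x - t" "\<lambda>x. t + x"]) auto
    also have "\<dots> \<le> (real (card {t + a..t + b}) / real N + 1) * w"
      by (intro window_sum_interval_le g0 N)
    also have "card {t + a..t + b} = card H" by (simp add: ab)
    also have "(real (card H) / real N + 1) * w \<le> (real (card A) / real N + 1) * w"
      using card_mono[OF \<open>finite A\<close> H(2)] w0 by (intro mult_right_mono add_right_mono divide_right_mono) auto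
    finally show ?thesis .
  qed
  have "real (card {x\<in>A. g (t + x) > T}) * T = (\<Sum>x\<in>{x\<in>A. g (t + x) > T}. T)" by simp
  also have "\<dots> \<le> (\<Sum>x\<in>{x\<in>A. g (t + x) > T}. g (t + x))" by (intro sum_mono) auto
  also have "\<dots> \<le> (\<Sum>x\<in>A. g (t + x))" using \<open>finite A\<close> g0 by (intro sum_mono2) auto
  also have "\<dots> \<le> (\<Sum>x\<in>I. g (t + x)) + (\<Sum>x\<in>J. g (t + x))"
  proof -
    have "0 \<le> (\<Sum>x\<in>I \<inter> J. g (t + x))" by (intro sum_nonneg g0)
    then show ?thesis unfolding IJ(1) using sum.union_inter[OF fin, of "\<lambda>x. g (t + x)"] by linarith
  qed
  also have "\<dots> \<le> (2 * (real (card A) / real N) + 2) * w"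
  proof -
    have sub: "I \<subseteq> A" "J \<subseteq> A" using IJ(1) by auto
    have "(2 * c + 2) * w = (c + 1) * w + (c + 1) * w" for c by (simp add: algebra_simps)
    then show ?thesis using add_mono[OF one[OF IJ(2) sub(1)] one[OF IJ(3) sub(2)]] by (simp only:)
  qed
  also have "\<dots> \<le> (3 * (real (card A) / real N)) * w"
  proof (intro mult_right_mono w0)
    have "real (2 * N) \<le> real (card A)" using assms(5) by (simp only: of_nat_le_iff)
    then show "2 * (real (card A) / real N) + 2 \<le> 3 * (real (card A) / real N)"
      using N0 by (simp add: field_simps)
  qed
  finally show ?thesis using \<open>0 < T\<close> N0 by (simp add: field_simps)
qed

text \<open>By doubling, \<open>g\<close> exceeds \<open>T / 2\<close> on the thickened level set.
  The \<open>N + 1\<close> points lie in two windows of total mass at most \<open>2 * w\<close>, so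
  at most \<open>4 * w / T\<close> of them are hit, and 9 is large enough for this to stay below
  half.\<close>

lemma level_set_thick_sparse:
  assumes g: "regular N w l g" and N: "N \<ge> 1" and T: "0 < T" "9 * w \<le> T * real N"
  shows "thick_sparse N l {z. g z > T}"
  unfolding thick_sparse_def
proof
  fix z
  let ?X = "{x\<in>{z - int N..z}. \<exists>e\<in>{0..int l}. x + e \<in> {z. g z > T}}"
  have g0: "\<And>t. 0 \<le> g t" "\<And>a. (\<Sum>t\<in>{a..<a + int N}. g t) \<le> w" using g by (auto simp: regular_def)
  have fin: "finite ?X" by (rule finite_subset[of _ "{z - int N..z}"]) auto
  have "real (card ?X) * (T / 2) = (\<Sum>x\<in>?X. T / 2)" by simp
  also have "\<dots> \<le> (\<Sum>x\<in>?X. g x)"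
  proof (rule sum_mono)
    fix x assume "x \<in> ?X"
    then obtain e where e: "e \<in> {0..int l}" "g (x + e) > T" by auto
    have "g (x + e) \<le> 2 * g x" using g e(1) unfolding regular_def by blast
    then show "T / 2 \<le> g x" using e(2) by simp
  qed
  also have "\<dots> \<le> (\<Sum>x\<in>{z - int N..<z - int N + int N} \<union> {z..<z + int N}. g x)"
    using g0 N by (intro sum_mono2) auto
  also have "\<dots> = (\<Sum>x\<in>{z - int N..<z - int N + int N}. g x) + (\<Sum>x\<in>{z..<z + int N}. g x)"
    by (rule sum.union_disjoint) auto
  also have "\<dots> \<le> 2 * w" using g0(2)[of "z - int N"] g0(2)[of z] by simp
  finally have "9 * (real (card ?X) * T) \<le> 4 * (T * real N)" using T(2) by linarith
  then have "(9 * real (card ?X)) * T \<le> (4 * real N) * T" by (simp only: mult_ac)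
  then have "9 * real (card ?X) \<le> 4 * real N" using T(1) by (simp only: mult_le_cancel_right_pos)
  then show "2 * card ?X < N + 1" by linarith
qed

lemma energy_ge_of_large_value:
  assumes "regular N w l g" "0 \<le> T" "g t > 2 * T" shows "T ^ Suc s \<le> energy s T g"
proof -
  have "T ^ Suc s \<le> excess s T g t" unfolding excess_def using assms by (intro power_mono) auto
  then show ?thesis using energy_ge_point[OF assms(1,2)] order_trans by blast
qed

text \<open>With \<open>w\<close> the window bound, \<open>W\<close> is \<open>3 * w / N\<close>.
  The first stage runs at threshold \<open>R * W\<close>, where level sets have density at most
  \<open>1 / R\<close>; the second at \<open>3 * W = 9 * w / N\<close>, as sparseness demands.
  Markov's inequality doubles each threshold, hence \<open>6 * W\<close>, in which \<open>R\<close>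
  does not occur.\<close>

lemma tail_bound:
  fixes s1 s2 m :: nat and R \<rho> :: real
  assumes f: "\<And>t. 0 \<le> f t" "(f has_sum 1) UNIV" "\<And>t e. e \<in> {0..int l} \<Longrightarrow> f (t + e) \<le> 2 * f t"
    and N: "N \<ge> 1" and k: "length As0 = k" "0 < k" and R: "R > 0"
    and As: "\<And>A. A \<in> set (As0 @ As1 @ concat Bss) \<Longrightarrow> finite A \<and> A \<noteq> {} \<and> origin_symmetric A \<and>
        2 * N \<le> card A \<and> (\<exists>I J. A = I \<union> J \<and> int_interval I \<and> int_interval J)"
    and far: "\<And>A x. A \<in> set As0 \<Longrightarrow> x \<in> A \<Longrightarrow> int N < \<bar>x\<bar>"
    and cube: "\<And>As B y. As \<in> set Bss \<Longrightarrow> thick_sparse N l B \<Longrightarrow>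
        mean_list As (\<lambda>xs. of_bool (cube_in B xs y)) \<le> \<rho>"
    and len: "\<And>As. As \<in> set Bss \<Longrightarrow> length As = m"
    and W: "W = 12 / (real N * sqrt (real k * p * (1 - p)))"
  shows "mean_list (As0 @ As1 @ concat Bss) (\<lambda>xs. of_bool (\<exists>t. mixl xs f t > 6 * W))
    \<le> ((1 - p ^ m) ^ s2 + \<rho>) ^ length Bss * (2 * (R * W)) ^ s2 / (3 * W) ^ Suc s2
      + ((1 - p) ^ Suc s1 + p ^ Suc s1 + 1 / R) ^ length As1 / (R * W) ^ Suc s1"
    (is "_ \<le> ?a + ?b")
proof -
  define w where "w = 4 / sqrt (real k * p * (1 - p))"
  have q: "0 < 1 - p" "1 - p < 1" "p < 1" using p_pos p_le by auto
  have N0: "real N > 0" using N by simp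
  have w0: "w > 0" using k q p_pos by (simp add: w_def)
  have Ww: "W = 3 * w / real N" by (simp add: W w_def)
  have W0: "W > 0" using w0 N0 by (simp add: Ww)
  define T1 where "T1 = R * W"
  define T2 where "T2 = 3 * W"
  have T: "T1 > 0" "T2 > 0" using W0 R by (auto simp: T1_def T2_def)
  have p1: "p ^ m \<le> 1" using p_pos q by (auto intro!: power_le_one)
  have f1: "regular N 1 l f" using f by (auto simp: regular_def intro!: finite_sum_le_has_sum)
  have reg0: "regular N w l (mixl xs f)" if xs: "xs \<in> listset As0" for xs
  proof -
    have mem: "list_all2 (\<in>) xs As0"
      using xs by (induction As0 arbitrary: xs) (auto simp: set_Cons_def)
    then have "length xs = k" using k by (simp add: list_all2_lengthD)
    moreover have "\<forall>x\<in>set xs. int N < \<bar>x\<bar>"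
    proof
      fix x assume "x \<in> set xs"
      then obtain i where i: "i < length xs" "xs ! i = x" by (auto simp: in_set_conv_nth)
      then have "x \<in> As0 ! i" "As0 ! i \<in> set As0"
        using list_all2_nthD[OF mem i(1)] list_all2_lengthD[OF mem] by auto
      then show "int N < \<bar>x\<bar>" by (rule far[rotated])
    qed
    ultimately have "(\<Sum>t\<in>{a..<a + int N}. mixl xs f t) \<le> w" for a
      unfolding w_def using k f by (intro littlewood_offord_window) auto
    then show ?thesis using regular_mixl[OF f1, of xs] by (simp add: regular_def)
  qed
  have fne: "\<forall>A\<in>set As1. finite A \<and> A \<noteq> {}" "\<forall>A\<in>set (concat Bss). finite A \<and> A \<noteq> {}" "\<forall>A\<in>set As0. finite A \<and> A \<noteq> {}"
    using As by auto
  \<comment> \<open>The sign of \<rho> follows from any one block, applied to the empty target set;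
    without blocks \<rho> enters only through a power with exponent 0.\<close>
  have \<rho>nn: "0 \<le> (1 - p ^ m) ^ s2 + \<rho>" if "Bss \<noteq> []"
  proof -
    from that obtain As where "As \<in> set Bss" by (cases Bss) auto
    moreover have "thick_sparse N l {}" by (simp add: thick_sparse_def)
    ultimately have "mean_list As (\<lambda>xs. of_bool (cube_in {} xs 0)) \<le> \<rho>" using cube by blast
    moreover have "0 \<le> mean_list As (\<lambda>xs. of_bool (cube_in {} xs 0))" by (intro mean_list_nonneg) simp
    ultimately show ?thesis using p1 by (smt (verit) zero_le_power)
  qed
  have a0: "0 \<le> ?a"
    using \<rho>nn T unfolding T1_def[symmetric] T2_def[symmetric]
    by (cases "Bss = []") (auto intro!: divide_nonneg_nonneg mult_nonneg_nonneg)
  have second: "mean_list (concat Bss) (\<lambda>xs. of_bool (\<exists>t. mixl xs g t > 6 * W)) \<le> ?a"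
    if g: "regular N w l g" "\<And>t. g t \<le> 2 * T1" for g
  proof -
    have "mean_list (concat Bss) (\<lambda>xs. of_bool (\<exists>t. mixl xs g t > 6 * W))
      \<le> mean_list (concat Bss) (\<lambda>xs. 1 / T2 ^ Suc s2 * energy s2 T2 (mixl xs g))"
    proof (rule mean_list_mono)
      fix xs
      show "of_bool (\<exists>t. mixl xs g t > 6 * W) \<le> 1 / T2 ^ Suc s2 * energy s2 T2 (mixl xs g)"
      proof (cases "\<exists>t. mixl xs g t > 6 * W")
        case True
        then obtain t where "mixl xs g t > 2 * T2" by (auto simp: T2_def)
        then have "T2 ^ Suc s2 \<le> energy s2 T2 (mixl xs g)"
          using T by (intro energy_ge_of_large_value[OF regular_mixl[OF g(1)]]) auto
        then show ?thesis using True T by (simp add: pos_le_divide_eq del: power_Suc)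
      next
        case False
        then show ?thesis using T energy_nonneg by simp
      qed
    qed
    also have "\<dots> = mean_list (concat Bss) (\<lambda>xs. energy s2 T2 (mixl xs g)) / T2 ^ Suc s2"
      unfolding mean_list_cmult by simp
    also have "\<dots> \<le> (((1 - p ^ m) ^ s2 + \<rho>) ^ length Bss * energy s2 T2 g) / T2 ^ Suc s2"
    proof (cases "Bss = []")
      case False
      have "mean_list (concat Bss) (\<lambda>xs. energy s2 T2 (mixl xs g)) \<le> ((1 - p ^ m) ^ s2 + \<rho>) ^ length Bss * energy s2 T2 g"
      proof (rule mean_energy_concat_le[OF _ \<rho>nn[OF False] g(1)])
        fix As' g assume As': "As' \<in> set Bss" "regular N w l g"
        have "thick_sparse N l {z. g z > T2}"
          using N0 T by (intro level_set_thick_sparse[OF As'(2) N]) (auto simp: T2_def Ww)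
        then show "mean_list As' (\<lambda>xs. energy s2 T2 (mixl xs g)) \<le> ((1 - p ^ m) ^ s2 + \<rho>) * energy s2 T2 g"
          using mean_energy_block_le[OF As'(2), of T2 As' \<rho> s2] T As As'(1) cube[OF As'(1)] len[OF As'(1)] by auto
      qed
      then show ?thesis using T by (intro divide_right_mono) auto
    qed simp
    also have "\<dots> \<le> (((1 - p ^ m) ^ s2 + \<rho>) ^ length Bss * (2 * T1) ^ s2) / T2 ^ Suc s2"
    proof (cases "Bss = []")
      case False
      then show ?thesis using T \<rho>nn g
        by (intro divide_right_mono mult_left_mono energy_le_sup[OF g(1)]) auto
    next
      case True
      have "energy s2 T2 g \<le> (2 * T1) ^ s2" using T g by (intro energy_le_sup[OF g(1)]) auto
      then show ?thesis using True T by (auto intro!: divide_right_mono simp del: power_Suc)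
    qed
    finally show ?thesis by (simp only: T1_def T2_def)
  qed
  \<comment> \<open>Where the supremum after the first stage is still above \<open>2 * T1\<close>,
    the second stage is estimated by 1, and the energy at \<open>T1\<close> pays for this
    event.\<close>
  have first: "mean_list As1 (\<lambda>xs1. mean_list (concat Bss) (\<lambda>xs2. of_bool (\<exists>t. mixl xs2 (mixl xs1 g) t > 6 * W)))
     \<le> ?a + ?b" if g: "regular N w l g" for g
  proof -
    have "mean_list As1 (\<lambda>xs1. mean_list (concat Bss) (\<lambda>xs2. of_bool (\<exists>t. mixl xs2 (mixl xs1 g) t > 6 * W)))
      \<le> mean_list As1 (\<lambda>xs1. ?a + 1 / T1 ^ Suc s1 * energy s1 T1 (mixl xs1 g))"
    proof (rule mean_list_mono)
      fix xs1
      have r: "regular N w l (mixl xs1 g)" by (rule regular_mixl[OF g])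
      show "mean_list (concat Bss) (\<lambda>xs2. of_bool (\<exists>t. mixl xs2 (mixl xs1 g) t > 6 * W))
        \<le> ?a + 1 / T1 ^ Suc s1 * energy s1 T1 (mixl xs1 g)"
      proof (cases "\<exists>t. mixl xs1 g t > 2 * T1")
        case True
        then have "T1 ^ Suc s1 \<le> energy s1 T1 (mixl xs1 g)"
          using T energy_ge_of_large_value[OF r] by (meson less_imp_le)
        then have "1 \<le> 1 / T1 ^ Suc s1 * energy s1 T1 (mixl xs1 g)" using T by (simp add: pos_le_divide_eq del: power_Suc)
        moreover have "mean_list (concat Bss) (\<lambda>xs2. of_bool (\<exists>t. mixl xs2 (mixl xs1 g) t > 6 * W)) \<le> 1"
          using fne by (intro mean_list_le) auto
        ultimately show ?thesis using a0 by linarith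
      next
        case False
        then have "mean_list (concat Bss) (\<lambda>xs2. of_bool (\<exists>t. mixl xs2 (mixl xs1 g) t > 6 * W)) \<le> ?a"
          using second[OF r] by (meson not_le)
        moreover have "0 \<le> 1 / T1 ^ Suc s1 * energy s1 T1 (mixl xs1 g)" using T energy_nonneg by simp
        ultimately show ?thesis by linarith
      qed
    qed
    also have "\<dots> = ?a + 1 / T1 ^ Suc s1 * mean_list As1 (\<lambda>xs. energy s1 T1 (mixl xs g))"
      unfolding mean_list_add mean_list_cmult mean_list_const[OF fne(1)] ..
    also have "\<dots> \<le> ?a + 1 / T1 ^ Suc s1 * ((1 - p) ^ Suc s1 + p ^ Suc s1 + 1 / R) ^ length As1"
    proof -
      have c: "concat (map (\<lambda>A. [A]) As1) = As1" by (induction As1) auto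
      have "mean_list (concat (map (\<lambda>A. [A]) As1)) (\<lambda>xs. energy s1 T1 (mixl xs g))
          \<le> ((1 - p) ^ Suc s1 + p ^ Suc s1 + 1 / R) ^ length (map (\<lambda>A. [A]) As1) * energy s1 T1 g"
      proof (rule mean_energy_concat_le[OF _ _ g])
        fix As' g assume As': "As' \<in> set (map (\<lambda>A. [A]) As1)" "regular N w l g"
        then obtain A where A: "As' = [A]" "A \<in> set As1" by auto
        have AA: "finite A" "A \<noteq> {}" "origin_symmetric A" "2 * N \<le> card A"
          "\<exists>I J. A = I \<union> J \<and> int_interval I \<and> int_interval J" using As[of A] A(2) by auto
        have "3 * w / (real N * T1) = 1 / R" using w0 N0 R by (simp add: T1_def Ww)
        then have "real (card {x\<in>A. g (t + x) > T1}) \<le> 1 / R * real (card A)" for t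
          using level_set_density_le[OF As'(2) N T(1) AA(1,4,5), of t] by simp
        then show "mean_list As' (\<lambda>xs. energy s1 T1 (mixl xs g)) \<le> ((1 - p) ^ Suc s1 + p ^ Suc s1 + 1 / R) * energy s1 T1 g"
          unfolding A(1) using T AA by (intro mean_energy_mix_le[OF As'(2)]) auto
      qed (use R q p_pos in \<open>auto intro!: add_nonneg_nonneg\<close>)
      also have "\<dots> \<le> ((1 - p) ^ Suc s1 + p ^ Suc s1 + 1 / R) ^ length As1 * 1"
        unfolding length_map using T R q p_pos
        by (intro mult_left_mono energy_le_one[OF g] zero_le_power add_nonneg_nonneg) auto
      finally show ?thesis using T unfolding c by (intro add_left_mono mult_left_mono) auto
    qed
    finally show ?thesis by (simp add: T1_def del: power_Suc)
  qed
  have "mean_list (As0 @ As1 @ concat Bss) (\<lambda>xs. of_bool (\<exists>t. mixl xs f t > 6 * W))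
     = mean_list As0 (\<lambda>xs0. mean_list As1 (\<lambda>xs1. mean_list (concat Bss)
        (\<lambda>xs2. of_bool (\<exists>t. mixl xs2 (mixl xs1 (mixl xs0 f)) t > 6 * W))))"
    by (simp only: mean_list_append mixl_append)
  also have "\<dots> \<le> ?a + ?b"
    by (rule mean_list_le[OF fne(3)]) (rule first[OF reg0])
  finally show ?thesis .
qed

end

section \<open>Choice of the constants\<close>

lemma log_lipschitz_imp_doubling:
  fixes f :: "int \<Rightarrow> real"
  assumes pos: "\<And>t. 0 < f t" and lip: "\<And>t. \<bar>log 2 (f t) - log 2 (f (t + 1))\<bar> \<le> 1 / (real l + 1)"
    and e: "e \<in> {0..int l}"
  shows "f (t + e) \<le> 2 * f t"
proof -
  have "log 2 (f (t + int k)) \<le> log 2 (f t) + real k / (real l + 1)" for k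
  proof (induction k)
    case (Suc k)
    have "log 2 (f (t + int k + 1)) \<le> log 2 (f (t + int k)) + 1 / (real l + 1)"
      using lip[of "t + int k"] by linarith
    then show ?case using Suc by (simp add: add_divide_distrib add_ac)
  qed simp
  from this[of "nat e"] have "log 2 (f (t + e)) \<le> log 2 (f t) + real (nat e) / (real l + 1)" using e by simp
  also have "\<dots> \<le> log 2 (f t) + 1" using e by (simp add: divide_le_eq)
  also have "\<dots> = log 2 (2 * f t)" using pos[of t] by (simp add: log_mult)
  finally show ?thesis using pos[of t] pos[of "t + e"] by simp
qed

lemma sup_norm_le:
  assumes "\<And>t. 0 \<le> g t" "\<And>t. g t \<le> c" shows "sup_norm g \<le> c"
  unfolding sup_norm_def by (rule cSUP_least) (use assms in auto)

context bernoulli_mixing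
begin

text \<open>With \<open>R = 1 / (1 - p) ^ Suc s\<close> all three terms of the contraction factor
  are at most \<open>(1 - p) ^ Suc s\<close>. Over \<open>(1 - 2 * \<gamma>) * n\<close> steps this
  beats the cost \<open>(1 / W) ^ Suc s\<close> by the rate \<open>\<omega> * Suc s\<close>; the
  powers of 3 cost \<open>exp (2 * n)\<close>, hence \<open>M + 4\<close>.\<close>

lemma first_stage_bound:
  fixes n k i :: nat and r \<gamma> \<omega> M W :: real
  assumes r: "1 - p < r" "r < 1" and \<gamma>: "0 < \<gamma>" "\<gamma> \<le> 1/4"
    and \<omega>: "\<omega> = ln r - (1 - 2 * \<gamma>) * ln (1 - p)" "0 < \<omega>" and S: "M + 4 \<le> \<omega> * real (Suc s)"
    and i: "(1 - 2 * \<gamma>) * real n \<le> real i" "i \<le> n" and W: "0 < W" "1 / W \<le> real n * exp (- ln r * real n)"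
  shows "((1 - p) ^ Suc s + p ^ Suc s + 1 / (1 / (1 - p) ^ Suc s)) ^ i / ((1 / (1 - p) ^ Suc s) * W) ^ Suc s
    \<le> real n ^ Suc s * exp (- (M + 2) * real n)"
proof -
  define q where "q = 1 - p"
  define S where "S = Suc s"
  have q: "0 < q" "q < 1" "p \<le> q" using p_pos p_le by (auto simp: q_def)
  have qS: "0 < q ^ S" "q ^ S \<le> 1" using q by (auto intro: power_le_one)
  have "p ^ S \<le> q ^ S" using q p_pos by (intro power_mono) auto
  then have "(q ^ S + p ^ S + 1 / (1 / q ^ S)) ^ i \<le> (3 * q ^ S) ^ i"
    using qS p_pos by (intro power_mono) auto
  also have "\<dots> = 3 ^ i * (q ^ S) ^ i" by (simp add: power_mult_distrib)
  also have "\<dots> \<le> exp (2 * real n) * exp ((1 - 2 * \<gamma>) * ln q * (real S * real n))"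
  proof (rule mult_mono)
    have "(3::real) ^ i \<le> 3 ^ n" using i by (intro power_increasing) auto
    also have "\<dots> \<le> exp 2 ^ n" using exp_ge_add_one_self[of 2] by (intro power_mono) auto
    finally show "(3::real) ^ i \<le> exp (2 * real n)" by (simp add: exp_of_nat2_mult)
    have "(q ^ S) ^ i = exp (ln q * (real S * real i))"
      using q by (simp add: exp_of_nat2_mult[symmetric] power_mult[symmetric] mult.assoc[symmetric])
        (metis exp_ln exp_of_nat2_mult power_mult mult.commute)
    also have "\<dots> \<le> exp ((1 - 2 * \<gamma>) * ln q * (real S * real n))"
    proof -
      have "ln q * real S * real i \<le> ln q * real S * ((1 - 2 * \<gamma>) * real n)"
        using i q by (intro mult_left_mono_neg) (auto simp: mult_nonpos_nonneg)
      then show ?thesis by (simp add: mult_ac)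
    qed
    finally show "(q ^ S) ^ i \<le> exp ((1 - 2 * \<gamma>) * ln q * (real S * real n))" .
  qed (use qS in auto)
  finally have num: "(q ^ S + p ^ S + 1 / (1 / q ^ S)) ^ i \<le> exp (2 * real n) * exp ((1 - 2 * \<gamma>) * ln q * (real S * real n))" .
  have "1 / ((1 / q ^ S) * W) ^ S \<le> (1 / W) ^ S"
  proof -
    have "1 / ((1 / q ^ S) * W) = q ^ S * (1 / W)" by simp
    also have "\<dots> \<le> 1 * (1 / W)" using qS W by (intro mult_right_mono) auto
    finally have "(1 / ((1 / q ^ S) * W)) ^ S \<le> (1 / W) ^ S" using qS W by (intro power_mono) auto
    then show ?thesis by (simp add: power_divide)
  qed
  also have "\<dots> \<le> (real n * exp (- ln r * real n)) ^ S" using W by (intro power_mono) auto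
  also have "\<dots> = real n ^ S * exp (- ln r * (real S * real n))"
    by (simp add: power_mult_distrib exp_of_nat_mult[symmetric] mult_ac)
  finally have den: "1 / ((1 / q ^ S) * W) ^ S \<le> real n ^ S * exp (- ln r * (real S * real n))" .
  have "(q ^ S + p ^ S + 1 / (1 / q ^ S)) ^ i / ((1 / q ^ S) * W) ^ S
      = (q ^ S + p ^ S + 1 / (1 / q ^ S)) ^ i * (1 / ((1 / q ^ S) * W) ^ S)" by simp
  also have "\<dots> \<le> (exp (2 * real n) * exp ((1 - 2 * \<gamma>) * ln q * (real S * real n))) * (real n ^ S * exp (- ln r * (real S * real n)))"
    using qS W by (intro mult_mono num den) auto
  also have "\<dots> = real n ^ S * exp (2 * real n + (1 - 2 * \<gamma>) * ln q * (real S * real n) + - ln r * (real S * real n))"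
    by (simp only: exp_add mult_ac)
  also have "2 * real n + (1 - 2 * \<gamma>) * ln q * (real S * real n) + - ln r * (real S * real n) = (2 - \<omega> * real S) * real n"
    by (simp add: \<omega>(1) q_def algebra_simps)
  also have "real n ^ S * exp ((2 - \<omega> * real S) * real n) \<le> real n ^ S * exp (- (M + 2) * real n)"
    using S unfolding S_def by (intro mult_left_mono) (auto intro!: mult_right_mono)
  finally show ?thesis by (simp only: q_def S_def)
qed

text \<open>In the quotient of the powers of \<open>W\<close> a single \<open>1 / W\<close>
  survives, whatever \<open>s\<close> is. It costs at most \<open>n * exp n\<close>, as
  \<open>r\<close> is at least 1/2, and reduces the gain \<open>exp (- (M + 3) * n)\<close> of the
  blocks to \<open>M + 2\<close>.\<close>

lemma second_stage_bound:
  fixes n m nb s :: nat and c \<gamma> M W R \<rho> :: real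
  assumes r: "1 - p < r" "r < 1" and \<gamma>: "0 < \<gamma>" and c: "c = (M + 3) / \<gamma>" "M \<ge> 1" and R: "0 < R"
    and nb: "\<gamma> * real n - 1 - real m \<le> real (m * nb)" and W: "0 < W" "1 / W \<le> real n * exp (- ln r * real n)"
    and \<rho>: "0 \<le> \<rho>" "\<rho> \<le> exp (- c * real m)"
  shows "\<rho> ^ nb * (2 * (R * W)) ^ s / (3 * W) ^ Suc s
    \<le> ((2 * R) ^ s * exp (c * (real m + 1))) * real n * exp (- (M + 2) * real n)"
proof -
  have c0: "c > 0" using c \<gamma> by simp
  have "\<rho> ^ nb \<le> exp (- c * real m) ^ nb" using \<rho> by (intro power_mono) auto
  also have "\<dots> = exp (- c * real (m * nb))" by (simp add: exp_of_nat2_mult[symmetric] mult.assoc)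
  also have "\<dots> \<le> exp (- c * (\<gamma> * real n - 1 - real m))" using nb c0 by (simp del: of_nat_mult)
  also have "\<dots> = exp (c * (real m + 1)) * exp (- (M + 3) * real n)"
  proof -
    have "- c * (\<gamma> * real n - 1 - real m) = c * (real m + 1) + - (c * \<gamma>) * real n" by (simp add: algebra_simps)
    also have "c * \<gamma> = M + 3" using c \<gamma> by simp
    finally show ?thesis by (simp only: exp_add)
  qed
  finally have 1: "\<rho> ^ nb \<le> exp (c * (real m + 1)) * exp (- (M + 3) * real n)" .
  have "(2 * (R * W)) ^ s / (3 * W) ^ Suc s = ((2 * R) ^ s * (1 / W)) / (3 * 3 ^ s)"
    using W by (simp add: power_mult_distrib field_simps)
  also have "\<dots> \<le> ((2 * R) ^ s * (1 / W)) / 1"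
  proof (rule divide_left_mono)
    have "1 \<le> (3::real) ^ s" by simp
    then show "1 \<le> 3 * (3::real) ^ s" by linarith
  qed (use R W in auto)
  also have "\<dots> \<le> (2 * R) ^ s * (real n * exp (- ln r * real n))"
    using R mult_left_mono[OF W(2), of "(2 * R) ^ s"] by simp
  also have "\<dots> \<le> (2 * R) ^ s * (real n * exp (real n))"
  proof -
    have "1 / 2 \<le> r" using r p_le by simp
    then have "- ln r \<le> ln 2" using r p_le ln_mono[of "1/2" r] by (simp add: ln_div)
    also have "ln 2 \<le> (1::real)" using ln_le_minus_one[of 2] by simp
    finally have "- ln r * real n \<le> 1 * real n" by (intro mult_right_mono) auto
    then show ?thesis using R by (intro mult_left_mono) auto
  qed
  finally have 2: "(2 * (R * W)) ^ s / (3 * W) ^ Suc s \<le> (2 * R) ^ s * (real n * exp (real n))" .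
  have "\<rho> ^ nb * (2 * (R * W)) ^ s / (3 * W) ^ Suc s = \<rho> ^ nb * ((2 * (R * W)) ^ s / (3 * W) ^ Suc s)" by simp
  also have "\<dots> \<le> (exp (c * (real m + 1)) * exp (- (M + 3) * real n)) * ((2 * R) ^ s * (real n * exp (real n)))"
    using R W \<rho> by (intro mult_mono 1 2) auto
  also have "\<dots> = ((2 * R) ^ s * exp (c * (real m + 1))) * real n * exp (- (M + 3) * real n + real n)"
    by (simp only: exp_add mult_ac)
  also have "- (M + 3) * real n + real n = - (M + 2) * real n" by (simp add: algebra_simps)
  finally show ?thesis .
qed

lemma prob_sup_norm_le:
  fixes \<delta> K r \<gamma> \<omega> M c C :: real and m l s1 s2 n1 :: nat
  assumes \<delta>: "0 < \<delta>" "\<delta> \<le> 1" and K: "K \<ge> 1" and r: "1 - p < r" "r < 1"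
    and \<gamma>: "0 < \<gamma>" "4 * \<gamma> \<le> \<delta>" and \<omega>: "\<omega> = ln r - (1 - 2 * \<gamma>) * ln (1 - p)" "0 < \<omega>"
    and M: "M \<ge> 1" and c: "c = (M + 3) / \<gamma>" and S: "M + 4 \<le> \<omega> * real (Suc s1)"
    and cube: "\<And>N As B y. N \<ge> 1 \<Longrightarrow> length As = Suc m \<Longrightarrow>
      (\<And>A. A \<in> set As \<Longrightarrow> (\<exists>I J. A = I \<union> J \<and> int_interval I \<and> int_interval J) \<and> finite A \<and>
         2 * N \<le> card A \<and> real (card A) \<le> (K + 1)\<^sup>2 * real N) \<Longrightarrow>
      thick_sparse N l B \<Longrightarrow>
      mean_list As (\<lambda>xs. of_bool (cube_in B xs y)) \<le> exp (- (c + 1) * real (Suc m))"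
    and s2: "(1 - p ^ Suc m) ^ s2 \<le> exp (- c * real (Suc m)) / 2"
    and C: "C = (2 * (1 / (1 - p) ^ Suc s1)) ^ s2 * exp (c * (real (Suc m) + 1))"
    and n: "2 \<le> \<gamma> * real n" "(C * real n + real n ^ Suc s1) * exp (- 2 * real n) \<le> 1"
    and N: "1 \<le> N" "real N \<le> 1 / r ^ n" and adm: "admissible N n K \<delta> A"
    and f: "\<And>t. f t > 0" "(f has_sum 1) UNIV" "\<And>t e. e \<in> {0..int l} \<Longrightarrow> f (t + e) \<le> 2 * f t"
  shows "prob_unif n A (\<lambda>X. sup_norm (f_Apl f p n X) > (72 / sqrt (\<gamma> / 2 * p * (1 - p))) / (real N * sqrt (real n)))
    \<le> exp (- M * real n)"
proof -
  \<comment> \<open>The first \<open>k\<close> coordinates serve for Littlewood-Offord and at most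
    \<open>k\<close> others for the blocks; at least \<open>(1 - 2 * \<gamma>) * n\<close> remain
    for the first stage.\<close>
  define k where "k = nat \<lfloor>\<gamma> * real n\<rfloor>"
  define nb where "nb = k div Suc m"
  have q: "0 < 1 - p" "1 - p < 1" using p_pos p_le by auto
  have n0: "real n > 0" using n(1) \<gamma> by (cases "n = 0") auto
  have k: "real k \<le> \<gamma> * real n" "\<gamma> * real n - 1 \<le> real k" "\<gamma> * real n / 2 \<le> real k" "0 < k"
    using n(1) unfolding k_def by linarith+
  have k2: "Suc m * nb \<le> k" "real k - real (Suc m) \<le> real (Suc m * nb)"
  proof -
    have "k = Suc m * nb + k mod Suc m" unfolding nb_def by (rule mult_div_mod_eq[symmetric])
    moreover have "k mod Suc m < Suc m" by simp
    ultimately have "Suc m * nb \<le> k" "k \<le> Suc m * nb + Suc m" by linarith+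
    then show "Suc m * nb \<le> k" "real k - real (Suc m) \<le> real (Suc m * nb)" by linarith+
  qed
  have \<delta>n: "4 * \<gamma> * real n \<le> \<delta> * real n" using \<gamma> by (intro mult_right_mono) auto
  obtain js0 js1 js2 where js: "distinct (js0 @ js1 @ js2)" "set (js0 @ js1 @ js2) = {1..n}"
    "length js0 = k" "length js2 = Suc m * nb" "\<And>i. i \<in> set js0 \<Longrightarrow> real i \<le> \<delta> * real n"
    "\<And>i. i \<in> set js2 \<Longrightarrow> real (card (A i)) \<le> (K + 1)\<^sup>2 * real N"
  proof (rule select_coordinates[OF adm N(1) K \<delta>(2) _ _ k2(1)])
    show "4 * real k \<le> \<delta> * real n" "2 \<le> \<delta> * real n" using k \<delta>n n(1) by linarith+
  qed blast
  let ?js = "js0 @ js1 @ js2"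
  have "length js2 = nb * Suc m" using js(4) by simp
  then obtain jss where jss: "concat jss = js2" "length jss = nb" "\<And>ys. ys \<in> set jss \<Longrightarrow> length ys = Suc m"
    using chunk_list by metis
  define Bss where "Bss = map (map A) jss"
  have Bss: "concat Bss = map A js2" "length Bss = nb"
    using jss by (auto simp: Bss_def simp flip: map_concat)
  have co: "i \<in> {1..n}" if "i \<in> set ?js" for i using js(2) that by blast
  have len: "length ?js = n" using js(1,2) distinct_card[of ?js] by simp
  define i where "i = length js1"
  have i: "(1 - 2 * \<gamma>) * real n \<le> real i" "i \<le> n"
  proof -
    have "real n = real k + real i + real (Suc m * nb)" using len js(3,4) by (simp add: i_def del: of_nat_mult)
    moreover have "real (Suc m * nb) \<le> real k" using k2(1) by (simp only: of_nat_le_iff)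
    ultimately have "real i \<ge> real n - 2 * (\<gamma> * real n)" using k(1) by linarith
    then show "(1 - 2 * \<gamma>) * real n \<le> real i" by (simp add: algebra_simps)
    show "i \<le> n" using len by (simp add: i_def)
  qed
  define W where "W = 12 / (real N * sqrt (real k * p * (1 - p)))"
  have N0: "real N > 0" using N by simp
  have kp: "real k * p * (1 - p) > 0" using k q p_pos by simp
  have W0: "W > 0" using N0 kp by (simp add: W_def)
  have Wi: "1 / W \<le> real n * exp (- ln r * real n)"
  proof -
    have "k \<le> n" using k(1) \<gamma> \<delta> mult_right_mono[of \<gamma> 1 "real n"] by linarith
    then have "real k * (p * (1 - p)) \<le> real n * 1"
      using p_pos q by (intro mult_mono mult_le_one) auto
    moreover have "real n * 1 \<le> real n * real n" using n0 by (intro mult_left_mono) auto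
    ultimately have "real k * p * (1 - p) \<le> (real n)\<^sup>2" by (simp add: power2_eq_square mult.assoc)
    then have "sqrt (real k * p * (1 - p)) \<le> real n" by (simp add: real_le_lsqrt)
    then have "real N * sqrt (real k * p * (1 - p)) / 12 \<le> real N * real n / 1"
      using N0 kp by (intro frac_le mult_left_mono) auto
    also have "real N \<le> exp (- ln r * real n)"
    proof -
      have "exp (- ln r * real n) = exp (- ln r) ^ n" by (rule exp_of_nat2_mult)
      also have "exp (- ln r) = 1 / r" using r q by (simp add: exp_minus inverse_eq_divide)
      finally show ?thesis using N(2) by (simp add: power_divide)
    qed
    then have "real N * real n / 1 \<le> real n * exp (- ln r * real n)"
      using mult_left_mono[of "real N" "exp (- ln r * real n)" "real n"] by (simp add: mult.commute)
    finally show ?thesis by (simp add: W_def)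
  qed
  define R where "R = 1 / (1 - p) ^ Suc s1"
  have R0: "R > 0" using q by (simp add: R_def)
  \<comment> \<open>The spare 1 in \<open>c + 1\<close> is worth a factor
    \<open>exp (Suc m)\<close>, which is at least 2; so \<rho> and the Hoelder gain each take half
    of \<open>exp (- c * Suc m)\<close>.\<close>
  define \<rho> where "\<rho> = exp (- (c + 1) * real (Suc m))"
  define \<rho>2 where "\<rho>2 = (1 - p ^ Suc m) ^ s2 + \<rho>"
  have \<rho>2: "0 \<le> \<rho>2" "\<rho>2 \<le> exp (- c * real (Suc m))"
  proof -
    have "p ^ Suc m \<le> 1" using p_pos q by (intro power_le_one) auto
    then show "0 \<le> \<rho>2" by (simp add: \<rho>2_def \<rho>_def del: power_Suc)
    have "2 \<le> exp (1::real)" using exp_ge_add_one_self[of 1] by simp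
    moreover have "exp (1::real) \<le> exp (real (Suc m))" by simp
    ultimately have "2 \<le> exp (real (Suc m))" by linarith
    moreover have "\<rho> = exp (- c * real (Suc m)) / exp (real (Suc m))"
      by (simp add: \<rho>_def algebra_simps flip: exp_diff)
    ultimately have "\<rho> \<le> exp (- c * real (Suc m)) / 2" by (simp only: frac_le exp_ge_zero order_refl zero_less_numeral)
    then show "\<rho>2 \<le> exp (- c * real (Suc m))" using s2 unfolding \<rho>2_def by linarith
  qed
  have Bset: "As' \<in> set Bss \<Longrightarrow> \<exists>ys\<in>set jss. As' = map A ys" for As' by (auto simp: Bss_def)
  have in2: "ys \<in> set jss \<Longrightarrow> j \<in> set ys \<Longrightarrow> j \<in> set js2" for ys j using jss(1) by auto
  have tail: "mean_list (map A js0 @ map A js1 @ concat Bss) (\<lambda>xs. of_bool (\<exists>t. mixl xs f t > 6 * W))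
    \<le> ((1 - p ^ Suc m) ^ s2 + \<rho>) ^ length Bss * (2 * (R * W)) ^ s2 / (3 * W) ^ Suc s2
      + ((1 - p) ^ Suc s1 + p ^ Suc s1 + 1 / R) ^ length (map A js1) / (R * W) ^ Suc s1"
  proof (rule tail_bound[where N = N and l = l and k = k])
    show "0 \<le> f t" for t using f(1)[of t] by simp
    fix H assume "H \<in> set (map A js0 @ map A js1 @ concat Bss)"
    then obtain j where j: "H = A j" "j \<in> {1..n}" using co Bss(1) by auto
    show "finite H \<and> H \<noteq> {} \<and> origin_symmetric H \<and> 2 * N \<le> card H \<and> (\<exists>I J. H = I \<union> J \<and> int_interval I \<and> int_interval J)"
      using admissible_coordinate[OF adm N(1) j(2)] unfolding j(1) by blast
  next
    fix H x assume H: "H \<in> set (map A js0)" "x \<in> H"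
    then obtain j where j: "H = A j" "j \<in> set js0" by auto
    then show "int N < \<bar>x\<bar>"
      using admissible_coordinate(6)[OF adm N(1) co] js(5) H(2) by auto
  next
    fix As' B y assume B: "As' \<in> set Bss" "thick_sparse N l B"
    obtain ys where ys: "ys \<in> set jss" "As' = map A ys" using Bset[OF B(1)] by blast
    show "mean_list As' (\<lambda>xs. of_bool (cube_in B xs y)) \<le> \<rho>"
      unfolding \<rho>_def
    proof (rule cube[OF N(1) _ _ B(2)])
      show "length As' = Suc m" using ys jss(3) by simp
      fix H assume "H \<in> set As'"
      then obtain j where j: "H = A j" "j \<in> set js2" using ys in2 by auto
      have jn: "j \<in> {1..n}" using co j(2) by simp
      show "(\<exists>I J. H = I \<union> J \<and> int_interval I \<and> int_interval J) \<and> finite H \<and> 2 * N \<le> card H \<and>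
          real (card H) \<le> (K + 1)\<^sup>2 * real N"
        unfolding j(1) by (intro conjI admissible_coordinate(1,4,5)[OF adm N(1) jn] js(6)[OF j(2)])
    qed
  next
    fix As' assume "As' \<in> set Bss"
    then show "length As' = Suc m" using Bset jss(3) by fastforce
  qed (use f(2,3) N k js(3) R0 in \<open>auto simp: W_def\<close>)
  have sup: "\<exists>t. mixl (map X ?js) f t > 6 * W"
    if "sup_norm (f_Apl f p n X) > (72 / sqrt (\<gamma> / 2 * p * (1 - p))) / (real N * sqrt (real n))" for X
  proof (rule ccontr)
    assume "\<not> ?thesis"
    then have "sup_norm (mixl (map X ?js) f) \<le> 6 * W"
      using f(1) by (intro sup_norm_le mixl_nonneg) (auto simp: not_less less_imp_le)
    moreover have "f_Apl f p n X = mixl (map X ?js) f" by (rule f_Apl_eq_mixl[OF js(1,2)])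
    \<comment> \<open>Here 72 is 6 times the 12 in \<open>W\<close>, and the
      \<open>\<gamma> / 2\<close> under the root makes up for rounding \<open>\<gamma> * n\<close>
      down to \<open>k\<close>.\<close>
    moreover have "6 * W \<le> (72 / sqrt (\<gamma> / 2 * p * (1 - p))) / (real N * sqrt (real n))"
    proof -
      have "sqrt (\<gamma> / 2 * p * (1 - p)) * sqrt (real n) = sqrt (\<gamma> * real n / 2 * (p * (1 - p)))"
        by (simp add: real_sqrt_mult[symmetric] mult_ac)
      also have "\<dots> \<le> sqrt (real k * (p * (1 - p)))"
        using k(3) p_pos q by (intro real_sqrt_le_mono mult_right_mono) auto
      finally have "sqrt (\<gamma> / 2 * p * (1 - p)) * sqrt (real n) \<le> sqrt (real k * p * (1 - p))" by (simp add: mult.assoc)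
      moreover have "0 < sqrt (\<gamma> / 2 * p * (1 - p)) * sqrt (real n)" using \<gamma> p_pos q n0 by simp
      ultimately have "72 / (real N * sqrt (real k * p * (1 - p))) \<le> 72 / (real N * (sqrt (\<gamma> / 2 * p * (1 - p)) * sqrt (real n)))"
        using N0 kp by (intro divide_left_mono mult_left_mono mult_pos_pos[OF N0] real_sqrt_gt_zero) auto
      then show ?thesis by (simp add: W_def mult_ac)
    qed
    ultimately show False using that by simp
  qed
  have fin: "finite (A i)" if "i \<in> {1..n}" for i using admissible_coordinate(1)[OF adm N(1) that] .
  have "prob_unif n A (\<lambda>X. sup_norm (f_Apl f p n X) > (72 / sqrt (\<gamma> / 2 * p * (1 - p))) / (real N * sqrt (real n)))
      \<le> prob_unif n A (\<lambda>X. \<exists>t. mixl (map X ?js) f t > 6 * W)"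
  proof -
    have "finite (PiE {1..n} A)" using fin by (intro finite_PiE) auto
    then show ?thesis unfolding prob_unif_def using sup
      by (intro divide_right_mono) (auto intro!: card_mono)
  qed
  also have "\<dots> = mean_list (map A ?js) (\<lambda>xs. of_bool (\<exists>t. mixl xs f t > 6 * W))"
    by (rule prob_unif_eq_mean_list[OF js(1,2) fin])
  also have "map A ?js = map A js0 @ map A js1 @ concat Bss" by (simp add: Bss)
  also note tail
  also have "((1 - p ^ Suc m) ^ s2 + \<rho>) ^ length Bss * (2 * (R * W)) ^ s2 / (3 * W) ^ Suc s2
      \<le> C * real n * exp (- (M + 2) * real n)"
    unfolding C R_def[symmetric] \<rho>2_def[symmetric] Bss(2)
  proof (rule second_stage_bound[OF r \<gamma>(1) c M R0 _ W0 Wi \<rho>2])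
    show "\<gamma> * real n - 1 - real (Suc m) \<le> real (Suc m * nb)" using k(2) k2(2) by linarith
  qed
  also have "((1 - p) ^ Suc s1 + p ^ Suc s1 + 1 / R) ^ length (map A js1) / (R * W) ^ Suc s1
      \<le> real n ^ Suc s1 * exp (- (M + 2) * real n)"
    unfolding R_def length_map i_def[symmetric]
    by (rule first_stage_bound[OF r \<gamma>(1) _ \<omega> S i W0 Wi]) (use \<gamma> \<delta> in simp)
  also have "C * real n * exp (- (M + 2) * real n) + real n ^ Suc s1 * exp (- (M + 2) * real n)
      = ((C * real n + real n ^ Suc s1) * exp (- 2 * real n)) * exp (- M * real n)"
  proof -
    have "exp (- (M + 2) * real n) = exp (- 2 * real n) * exp (- M * real n)"
      by (simp add: algebra_simps flip: exp_add)
    then show ?thesis by (simp only: distrib_right mult.assoc)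
  qed
  also have "\<dots> \<le> 1 * exp (- M * real n)" using n(2) by (intro mult_right_mono) auto
  finally show ?thesis by simp
qed

end

theorem theorem4p1:
  fixes \<delta> p \<epsilon> K :: real
  assumes "0 < \<delta>" "\<delta> \<le> 1" "0 < p" "p \<le> 1/2" "0 < \<epsilon>" "\<epsilon> < p" "K \<ge> 1"
  shows "\<exists>L > 0. \<forall>M :: real. M \<ge> 1 \<longrightarrow>
           (\<exists>n1 :: nat. n1 \<ge> 1 \<and> (\<exists>\<eta> :: real. 0 < \<eta> \<and> \<eta> \<le> 1 \<and>
             (\<forall>(n :: nat) (N :: nat) (A :: nat \<Rightarrow> int set) (f :: int \<Rightarrow> real).
                n \<ge> n1 \<longrightarrow> 1 \<le> N \<longrightarrow> real N \<le> 1 / (1 - p + \<epsilon>) ^ n \<longrightarrow>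
                admissible N n K \<delta> A \<longrightarrow>
                (\<forall>t. f t > 0) \<longrightarrow> (f has_sum 1) UNIV \<longrightarrow>
                (\<forall>t. \<bar>log 2 (f t) - log 2 (f (t + 1))\<bar> \<le> \<eta>) \<longrightarrow>
                prob_unif n A (\<lambda>X. sup_norm (f_Apl f p n X) > L / (real N * sqrt (real n)))
                  \<le> exp (- M * real n))))"
proof -
  interpret bernoulli_mixing p using assms by unfold_locales
  define r where "r = 1 - p + \<epsilon>"
  have q: "0 < 1 - p" "1 - p < 1" using assms by auto
  have r: "1 - p < r" "r < 1" using assms by (auto simp: r_def)
  define D where "D = ln r - ln (1 - p)"
  have D: "D > 0" using r q by (simp add: D_def)
  have lq: "ln (1 - p) < 0" using q by simp
  \<comment> \<open>The first bound leaves room for \<open>select_coordinates\<close>; the second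
    gives up at most half of the margin \<open>D\<close>, so that \<omega> is at least
    \<open>D / 2\<close>. Neither involves \<open>M\<close>, hence neither does
    \<open>L\<close>.\<close>
  define \<gamma> where "\<gamma> = min (\<delta> / 4) (D / (- 4 * ln (1 - p)))"
  have \<gamma>: "0 < \<gamma>" "4 * \<gamma> \<le> \<delta>" "\<gamma> \<le> D / (- 4 * ln (1 - p))"
    using D lq assms by (auto simp: \<gamma>_def divide_pos_neg intro!: divide_neg_neg)
  define \<omega> where "\<omega> = ln r - (1 - 2 * \<gamma>) * ln (1 - p)"
  have \<omega>: "0 < \<omega>"
  proof -
    have "\<gamma> * (- 4 * ln (1 - p)) \<le> D" using \<gamma>(3) lq by (subst (asm) pos_le_divide_eq) auto
    then have "2 * \<gamma> * ln (1 - p) \<ge> - D / 2" by simp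
    then show ?thesis using D by (simp add: \<omega>_def D_def algebra_simps)
  qed
  have main: "\<exists>n1 :: nat. n1 \<ge> 1 \<and> (\<exists>\<eta> :: real. 0 < \<eta> \<and> \<eta> \<le> 1 \<and>
      (\<forall>(n :: nat) (N :: nat) (A :: nat \<Rightarrow> int set) (f :: int \<Rightarrow> real).
        n \<ge> n1 \<longrightarrow> 1 \<le> N \<longrightarrow> real N \<le> 1 / r ^ n \<longrightarrow> admissible N n K \<delta> A \<longrightarrow>
        (\<forall>t. f t > 0) \<longrightarrow> (f has_sum 1) UNIV \<longrightarrow>
        (\<forall>t. \<bar>log 2 (f t) - log 2 (f (t + 1))\<bar> \<le> \<eta>) \<longrightarrow>
        prob_unif n A (\<lambda>X. sup_norm (f_Apl f p n X) > (72 / sqrt (\<gamma> / 2 * p * (1 - p))) / (real N * sqrt (real n)))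
          \<le> exp (- M * real n)))" if M: "M \<ge> 1" for M :: real
  proof -
    \<comment> \<open>All choices that depend on \<open>M\<close> start here. Of the exponent
      \<open>M + 3\<close>, one unit pays for the factor \<open>N\<close> and two for the factors
      polynomial in \<open>n\<close>.\<close>
    define c where "c = (M + 3) / \<gamma>"
    have c: "0 < c + 1" using M \<gamma> by (simp add: c_def add_pos_pos)
    have K2: "0 < (K + 1)\<^sup>2" using assms by simp
    obtain m l :: nat where cube: "\<And>N As B y. N \<ge> 1 \<Longrightarrow> length As = Suc m \<Longrightarrow>
      (\<And>A. A \<in> set As \<Longrightarrow> (\<exists>I J. A = I \<union> J \<and> int_interval I \<and> int_interval J) \<and> finite A \<and>
         2 * N \<le> card A \<and> real (card A) \<le> (K + 1)\<^sup>2 * real N) \<Longrightarrow>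
      thick_sparse N l B \<Longrightarrow>
      mean_list As (\<lambda>xs. of_bool (cube_in B xs y)) \<le> exp (- (c + 1) * real (Suc m))"
      using cube_event_bound[OF K2 c] by blast
    obtain s1 where "(M + 4) / \<omega> \<le> real s1" using real_arch_simple by blast
    then have s1: "M + 4 \<le> \<omega> * real (Suc s1)" using \<omega> by (simp add: field_simps)
    have "0 < p ^ Suc m" using assms by simp
    then obtain s2 where "(1 - p ^ Suc m) ^ s2 < exp (- c * real (Suc m)) / 2"
      using real_arch_pow_inv[of "exp (- c * real (Suc m)) / 2" "1 - p ^ Suc m"] by auto
    then have s2: "(1 - p ^ Suc m) ^ s2 \<le> exp (- c * real (Suc m)) / 2" by simp
    define C where "C = (2 * (1 / (1 - p) ^ Suc s1)) ^ s2 * exp (c * (real (Suc m) + 1))"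
    have "(\<lambda>n. C * real (n + 0) ^ 1 * exp (- 2 * real n) + 1 * real (n + 0) ^ Suc s1 * exp (- 2 * real n)) \<longlonglongrightarrow> 0 + 0"
      by (intro tendsto_add exp_beats_power) auto
    then have "\<forall>\<^sub>F n in sequentially. C * real (n + 0) ^ 1 * exp (- 2 * real n) + 1 * real (n + 0) ^ Suc s1 * exp (- 2 * real n) < 1"
      by (intro order_tendstoD(2)[of _ 0]) auto
    then obtain n2 where "\<forall>n\<ge>n2. C * real (n + 0) ^ 1 * exp (- 2 * real n) + 1 * real (n + 0) ^ Suc s1 * exp (- 2 * real n) < 1"
      unfolding eventually_sequentially by blast
    then have n2: "(C * real n + real n ^ Suc s1) * exp (- 2 * real n) \<le> 1" if "n \<ge> n2" for n
      using that less_imp_le by (fastforce simp: distrib_right)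
    obtain n3 where n3: "2 / \<gamma> \<le> real n3" using real_arch_simple by blast
    show ?thesis
    \<comment> \<open>Over at most \<open>l\<close> unit steps this \<eta> lets
      \<open>log 2 f\<close> change by less than 1, which is the doubling property.\<close>
    proof (intro exI[of _ "max 1 (max n2 n3)"] conjI exI[of _ "1 / (real l + 1)"] allI impI)
      fix n N A and f :: "int \<Rightarrow> real"
      assume n: "n \<ge> max 1 (max n2 n3)" and N: "1 \<le> N" "real N \<le> 1 / r ^ n" "admissible N n K \<delta> A"
        and f: "\<forall>t. f t > 0" "(f has_sum 1) UNIV" "\<forall>t. \<bar>log 2 (f t) - log 2 (f (t + 1))\<bar> \<le> 1 / (real l + 1)"
      have "2 / \<gamma> \<le> real n" using n n3 by linarith
      then have \<gamma>n: "2 \<le> \<gamma> * real n" using \<gamma> by (simp add: field_simps)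
      have dbl: "f (t + e) \<le> 2 * f t" if "e \<in> {0..int l}" for t e
        using f log_lipschitz_imp_doubling[of f l e t] that by blast
      show "prob_unif n A (\<lambda>X. sup_norm (f_Apl f p n X) > (72 / sqrt (\<gamma> / 2 * p * (1 - p))) / (real N * sqrt (real n)))
          \<le> exp (- M * real n)"
        by (rule prob_sup_norm_le[OF assms(1,2,7) r \<gamma>(1,2) \<omega>_def \<omega> M c_def s1 cube s2 C_def \<gamma>n n2 N f(1)[rule_format] f(2) dbl])
          (use n in auto)
    qed auto
  qed
  have "72 / sqrt (\<gamma> / 2 * p * (1 - p)) > 0" using \<gamma> q assms by simp
  then show ?thesis using main unfolding r_def by blast
qed

end
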